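(* Let $\mathcal{C}$ be a simple closed curve of class $C^2$ on the unit sphere $\mathcal{S}\subset\mathbb{R}^3$ dividing $\mathcal{S}$ into two parts $\mathcal{S}_1$ and $\mathcal{S}_2$, and let $g$ be smooth boundary data on $\mathcal{C}$. Consider the Dirichlet problem of finding a smooth function $u$ with $$-\Delta_{\mathcal{S}}u=0\ \text{ in }\mathcal{S}_2,\qquad u=g\ \text{ on }\mathcal{C}.\qquad(\ast)$$ 1. If a continuous density $\sigma$ on $\mathcal{C}$ solves the boundary integral equation $V\sigma=g$ on $\mathcal{C}$ and also satisfies $\int_{\mathcal{C}}\sigma\,ds=0$, then $u:=\widetilde V\sigma$ solves $(\ast)$. 2. If a continuous density $\mu$ on $\mathcal{C}$ solves $\left(\tfrac12 I+K\right)\mu=g$ on $\mathcal{C}$, then the solution of $(\ast)$ is given by the double layer potential $u:=\widetilde W\mu$.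
   Context: $\mathcal{S}$ is the unit sphere in $\mathbb{R}^3$, with points written $x(\varphi,\theta)=(\cos\varphi\sin\theta,\sin\varphi\sin\theta,\cos\theta)$, $\varphi\in[0,2\pi)$, $\theta\in[0,\pi]$. $\vec e_\varphi,\vec e_\theta$ are the usual spherical unit tangent vectors, $d\sigma$ is surface measure and $ds$ is arc length. $\mathcal{S}_1,\mathcal{S}_2$ are the two disjoint open connected components of $\mathcal{S}\setminus\mathcal{C}$. In $(\ast)$, $u$ is smooth in $\mathcal{S}_2$ and its boundary values on $\mathcal{C}$ are the limits $\lim_{\mathcal{S}_2\ni x\to x_0}u(x)$, $x_0\in\mathcal{C}$. The Laplace–Beltrami operator is $\Delta_{\mathcal{S}}u=\frac{1}{\sin^2\theta}\frac{\partial^2u}{\partial\varphi^2}+\frac{1}{\sin\theta}\frac{\partial}{\partial\theta}\left(\sin\theta\frac{\partial u}{\partial\theta}\right)$. The vectorial surface rotation of a scalar function $f$ is $\underline{\mathrm{curl}}_{\mathcal{S}}f=-\frac{\partial f}{\partial\theta}\vec e_\varphi+\frac{1}{\sin\theta}\frac{\partial f}{\partial\varphi}\vec e_\theta$ (coordinate-free: $-x\times\nabla_{\mathcal{S}}f(x)$, which also defines it at the poles). The scalar surface rotation of a tangential field $\vec V=V_\varphi\vec e_\varphi+V_\theta\vec e_\theta$ is $\mathrm{curl}_{\mathcal{S}}\vec V=\frac{1}{\sin\theta}\left(-\frac{\partial V_\theta}{\partial\varphi}+\frac{\partial}{\partial\theta}(\sin\theta\,V_\varphi)\right)$. The unit tangent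 field $\vec t$ to $\mathcal{C}$ is oriented so that Stokes' theorem $\int_{\mathcal{S}_2}\mathrm{curl}_{\mathcal{S}}\vec V\,d\sigma=\int_{\mathcal{C}}\vec V\cdot\vec t\,ds$ holds (i.e. $\mathcal{S}_2$ lies to the left of $\vec t$ when viewed from outside the sphere). The fundamental solution is $U^*(x,y)=-\frac{1}{4\pi}\log|1-(x,y)|$ for $x\ne y$ in $\mathcal{S}$, where $(\cdot,\cdot)$ is the Euclidean inner product of $\mathbb{R}^3$. Layer potentials, for $x\in\mathcal{S}\setminus\mathcal{C}$: the single layer potential is $(\widetilde V\sigma)(x)=\int_{\mathcal{C}}U^*(x,y)\sigma(y)\,ds_y$; the double layer potential is $(\widetilde W\mu)(x)=\int_{\mathcal{C}}\mu(y)[\underline{\mathrm{curl}}_{\mathcal{S}}U^*(x,y)\cdot\vec t(y)]\,ds_y$, with $\underline{\mathrm{curl}}_{\mathcal{S}}$ acting on $y$. Boundary operators, for $x_0\in\mathcal{C}$: $(V\sigma)(x_0)=\int_{\mathcal{C}}U^*(x_0,y)\sigma(y)\,ds_y$ (weakly singular integral), and $(K\mu)(x_0)=\lim_{\varepsilon\to0}\int_{\{y\in\mathcal{C}:|y-x_0|\ge\varepsilon\}}\mu(y)[\underline{\mathrm{curl}}_{\mathcal{S}}U^*(x_0,y)\cdot\vec t(y)]\,ds_y$, with $\underline{\mathrm{curl}}_{\mathcal{S}}$ acting on $y$. $I$ is the identity operator. *)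

theory Defs
  imports "HOL-Analysis.Analysis"
begin

section \<open>Smooth functions\<close>

primrec Ck_on :: "nat \<Rightarrow> (real^3) set \<Rightarrow> (real^3 \<Rightarrow> real) \<Rightarrow> bool" where
  "Ck_on 0 U f \<longleftrightarrow> continuous_on U f"
| "Ck_on (Suc k) U f \<longleftrightarrow> (\<forall>x\<in>U. f differentiable at x) \<and>
     (\<forall>v. Ck_on k U (\<lambda>x. frechet_derivative f (at x) v))"

text \<open>Smoothness on an arbitrary subset of space: near each point of the set, the function is
  the restriction of a \<open>C\<^sup>\<infinity>\<close> function on an open set.  For relatively open subsets of the
  sphere this is smoothness as a function on the surface.\<close>

definition smooth_on :: "(real^3) set \<Rightarrow> (real^3 \<Rightarrow> real) \<Rightarrow> bool" where
  "smooth_on A f \<longleftrightarrow> (\<forall>x\<in>A. \<exists>U F. open U \<and> x \<in> U \<and> (\<forall>k. Ck_on k U F) \<and> (\<forall>y\<in>A \<inter> U. f y = F y))"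


section \<open>Differential operators on the unit sphere\<close>

definition sph :: "real \<Rightarrow> real \<Rightarrow> real^3" where
  "sph \<phi> \<theta> = vector [cos \<phi> * sin \<theta>, sin \<phi> * sin \<theta>, cos \<theta>]"

definition longitude :: "real^3 \<Rightarrow> real" where
  "longitude x = Arg2pi (Complex (x $ 1) (x $ 2))"

definition colatitude :: "real^3 \<Rightarrow> real" where
  "colatitude x = arccos (x $ 3)"

lemma longitude_range: "longitude x \<in> {0..<2 * pi}"
  using Arg2pi unfolding longitude_def by auto

lemma colatitude_range: "x \<in> sphere 0 1 \<Longrightarrow> colatitude x \<in> {0..pi}"
  unfolding colatitude_def using component_le_norm_cart[of x 3]
  by (auto intro!: arccos_lbound arccos_ubound)

lemma sph_longitude_colatitude:
  assumes "x \<in> sphere 0 1"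
  shows "sph (longitude x) (colatitude x) = x"
proof -
  let ?z = "Complex (x $ 1) (x $ 2)"
  have s: "(x $ 1)\<^sup>2 + (x $ 2)\<^sup>2 + (x $ 3)\<^sup>2 = 1"
    using assms by (simp add: norm_vec_def L2_set_def sum_3)
  have b: "\<bar>x $ 3\<bar> \<le> 1" using component_le_norm_cart[of x 3] assms by simp
  have c: "cos (colatitude x) = x $ 3"
    using b unfolding colatitude_def by (simp add: abs_le_iff cos_arccos)
  have "sin (colatitude x) = sqrt (1 - (x $ 3)\<^sup>2)"
    using b unfolding colatitude_def by (simp add: abs_le_iff sin_arccos)
  also have "\<dots> = cmod ?z" using s by (simp add: cmod_def algebra_simps)
  finally have n: "sin (colatitude x) = cmod ?z" .
  have "?z = cmod ?z * cis (longitude x)"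
    using Arg2pi_eq[of ?z] unfolding longitude_def by (simp add: cis_conv_exp)
  from arg_cong[OF this, of Re] arg_cong[OF this, of Im]
  have "x $ 1 = cmod ?z * cos (longitude x)" "x $ 2 = cmod ?z * sin (longitude x)"
    by simp_all
  then show ?thesis unfolding sph_def by (simp add: vec_eq_iff forall_3 c n mult.commute)
qed

definition laplace_beltrami_coord :: "(real^3 \<Rightarrow> real) \<Rightarrow> real \<Rightarrow> real \<Rightarrow> real" where
  "laplace_beltrami_coord u \<phi> \<theta> =
     1 / (sin \<theta>)\<^sup>2 * deriv (\<lambda>a. deriv (\<lambda>b. u (sph b \<theta>)) a) \<phi>
     + 1 / sin \<theta> * deriv (\<lambda>a. sin a * deriv (\<lambda>b. u (sph \<phi> b)) a) \<theta>"

text \<open>The coordinate expression is singular at the two poles, where the operator is understood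
  as the continuous extension.\<close>

definition laplace_beltrami :: "(real^3 \<Rightarrow> real) \<Rightarrow> real^3 \<Rightarrow> real" where
  "laplace_beltrami u x =
     (let L = \<lambda>y. laplace_beltrami_coord u (longitude y) (colatitude y)
      in if x $ 1 = 0 \<and> x $ 2 = 0 then Lim (at x within sphere 0 1) L else L x)"

definition surface_gradient :: "(real^3 \<Rightarrow> real) \<Rightarrow> real^3 \<Rightarrow> real^3" where
  "surface_gradient f x =
     (THE D. D \<bullet> x = 0 \<and> (f has_derivative (\<lambda>h. D \<bullet> h)) (at x within sphere 0 1))"

lemma surface_gradient_eqI:
  assumes x: "x \<in> sphere 0 1" and D: "D \<bullet> x = 0"
    and df: "(f has_derivative (\<lambda>h. D \<bullet> h)) (at x within sphere 0 1)"
  shows "surface_gradient f x = D"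
  unfolding surface_gradient_def
proof (rule the_equality)
  show "D \<bullet> x = 0 \<and> (f has_derivative (\<lambda>h. D \<bullet> h)) (at x within sphere 0 1)"
    using D df by simp
next
  fix E assume E: "E \<bullet> x = 0 \<and> (f has_derivative (\<lambda>h. E \<bullet> h)) (at x within sphere 0 1)"
  show "E = D"
  proof (rule ccontr)
    assume ne: "E \<noteq> D"
    define v where "v = sgn (E - D)"
    have nv: "norm v = 1" using ne by (simp add: v_def norm_sgn)
    have vx: "v \<bullet> x = 0"
      using E D by (simp add: v_def sgn_div_norm inner_diff_left)
    define c where "c = (\<lambda>e::real. cos e *\<^sub>R x + sin e *\<^sub>R v)"
    have xx: "x \<bullet> x = 1" and vv: "v \<bullet> v = 1"
      using x nv by (simp_all add: norm_eq_1)
    have "c e \<bullet> c e = 1" for e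
      using vx xx vv
      by (simp add: c_def inner_add_left inner_add_right inner_commute[of x v]
            flip: power2_eq_square)
    then have cs: "range c \<subseteq> sphere 0 1" by (auto simp: norm_eq_1)
    have c0: "c 0 = x" by (simp add: c_def)
    have cd: "(c has_derivative (\<lambda>h. h *\<^sub>R v)) (at 0)"
      unfolding c_def by (auto intro!: derivative_eq_intros)
    have ch: "(f \<circ> c has_derivative (\<lambda>h. F \<bullet> h) \<circ> (\<lambda>h. h *\<^sub>R v)) (at 0)"
      if "(f has_derivative (\<lambda>h. F \<bullet> h)) (at x within sphere 0 1)" for F
      by (rule diff_chain_within[OF cd])
         (use that cs in \<open>auto simp: c0 intro: has_derivative_subset\<close>)
    have "((\<lambda>h. E \<bullet> h) \<circ> (\<lambda>h. h *\<^sub>R v)) (1::real) = ((\<lambda>h. D \<bullet> h) \<circ> (\<lambda>h. h *\<^sub>R v)) 1"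
      using has_derivative_unique[OF ch ch, of E D] E df by simp
    then have "(E - D) \<bullet> v = 0" by (simp add: inner_diff_left)
    then show False using ne by (simp add: v_def sgn_div_norm)
  qed
qed

text \<open>In spherical coordinates this is
  \<open>- (\<partial>f / \<partial>\<theta>) e\<^sub>\<phi> + (1 / sin \<theta>) (\<partial>f / \<partial>\<phi>) e\<^sub>\<theta>\<close>.\<close>

definition vector_curl :: "(real^3 \<Rightarrow> real) \<Rightarrow> real^3 \<Rightarrow> real^3" where
  "vector_curl f x = - cross3 x (surface_gradient f x)"


section \<open>The boundary curve\<close>

text \<open>A closed curve is given by a regular parametrization of period 1 on the whole real line,
  so that \<open>C\<^sup>2\<close> regularity includes the point where the curve closes up.\<close>

definition C2_simple_closed_curve :: "(real \<Rightarrow> real^3) \<Rightarrow> bool" where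
  "C2_simple_closed_curve \<gamma> \<longleftrightarrow>
     simple_path \<gamma> \<and> (\<forall>s. \<gamma> (s + 1) = \<gamma> s) \<and>
     \<gamma> C1_differentiable_on UNIV \<and>
     (\<lambda>s. vector_derivative \<gamma> (at s)) C1_differentiable_on UNIV \<and>
     (\<forall>s. vector_derivative \<gamma> (at s) \<noteq> 0)"

definition unit_tangent_field :: "(real \<Rightarrow> real^3) \<Rightarrow> (real^3 \<Rightarrow> real^3) \<Rightarrow> bool" where
  "unit_tangent_field \<gamma> t \<longleftrightarrow> continuous_on (path_image \<gamma>) t \<and>
     (\<forall>s\<in>{0..1}. norm (t (\<gamma> s)) = 1 \<and> t (\<gamma> s) \<in> span {vector_derivative \<gamma> (at s)})"

text \<open>Seen from outside the sphere, the left-hand side of a unit tangent vector \<open>t\<close> at \<open>y\<close> is the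
  direction \<open>y \<times> t\<close>; the great circle leaving \<open>y\<close> in this direction must enter \<open>S\<close>.  This is
  the orientation of the boundary of \<open>S\<close> for which Stokes' theorem holds.\<close>

definition lies_left_of :: "(real^3) set \<Rightarrow> (real^3) set \<Rightarrow> (real^3 \<Rightarrow> real^3) \<Rightarrow> bool" where
  "lies_left_of S C t \<longleftrightarrow>
     (\<forall>y\<in>C. \<forall>\<^sub>F \<epsilon> in at_right 0. cos \<epsilon> *\<^sub>R y + sin \<epsilon> *\<^sub>R cross3 y (t y) \<in> S)"

definition arc_integral :: "(real \<Rightarrow> real^3) \<Rightarrow> (real^3 \<Rightarrow> real) \<Rightarrow> real" where
  "arc_integral \<gamma> f = integral {0..1} (\<lambda>s. f (\<gamma> s) * norm (vector_derivative \<gamma> (at s)))"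


section \<open>Layer potentials and boundary operators\<close>

definition Ustar :: "real^3 \<Rightarrow> real^3 \<Rightarrow> real" where
  "Ustar x y = - 1 / (4 * pi) * ln \<bar>1 - x \<bullet> y\<bar>"

text \<open>Off the curve this is the single layer potential, on the curve it is the (weakly singular)
  single layer boundary operator.\<close>

definition single_layer :: "(real \<Rightarrow> real^3) \<Rightarrow> (real^3 \<Rightarrow> real) \<Rightarrow> real^3 \<Rightarrow> real" where
  "single_layer \<gamma> \<sigma> x = arc_integral \<gamma> (\<lambda>y. Ustar x y * \<sigma> y)"

definition double_layer ::
    "(real \<Rightarrow> real^3) \<Rightarrow> (real^3 \<Rightarrow> real^3) \<Rightarrow> (real^3 \<Rightarrow> real) \<Rightarrow> real^3 \<Rightarrow> real" where
  "double_layer \<gamma> t \<mu> x = arc_integral \<gamma> (\<lambda>y. \<mu> y * (vector_curl (Ustar x) y \<bullet> t y))"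

definition double_layer_boundary ::
    "(real \<Rightarrow> real^3) \<Rightarrow> (real^3 \<Rightarrow> real^3) \<Rightarrow> (real^3 \<Rightarrow> real) \<Rightarrow> real^3 \<Rightarrow> real" where
  "double_layer_boundary \<gamma> t \<mu> x\<^sub>0 = Lim (at_right 0) (\<lambda>\<epsilon>. arc_integral \<gamma>
     (\<lambda>y. if norm (y - x\<^sub>0) \<ge> \<epsilon> then \<mu> y * (vector_curl (Ustar x\<^sub>0) y \<bullet> t y) else 0))"


section \<open>The Dirichlet problem\<close>

definition solves_dirichlet ::
    "(real^3) set \<Rightarrow> (real^3) set \<Rightarrow> (real^3 \<Rightarrow> real) \<Rightarrow> (real^3 \<Rightarrow> real) \<Rightarrow> bool" where
  "solves_dirichlet S C g u \<longleftrightarrow>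
     smooth_on S u \<and> (\<forall>x\<in>S. - laplace_beltrami u x = 0) \<and>
     (\<forall>x\<^sub>0\<in>C. (u \<longlongrightarrow> g x\<^sub>0) (at x\<^sub>0 within S))"

end

theory Submission
  imports Defs
begin

text \<open>For \<open>x\<close> on the sphere and off the curve, the kernel of the double layer potential is
  \<open>1 / (4\<pi>)\<close> times \<open>det(x, \<gamma>, \<gamma>') / (1 - x \<bullet> \<gamma>)\<close>, up to the sign of the orientation.  Both
  layer potentials are smooth near the sphere minus the curve, and the Laplacian
  \<open>tr D\<^sup>2F - D\<^sup>2F(x, x) - 2 DF(x)\<close> of the kernels is computed pointwise.

  The boundary values are obtained by dominated convergence along sequences \<open>x n \<longlonglongrightarrow> \<gamma> s\<^sub>0\<close>,
  with the integrals centred at a point \<open>\<gamma> (s n)\<close> of the curve nearest to \<open>x n\<close>: splitting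
  \<open>x n = \<gamma> (s n) + (x n - \<gamma> (s n))\<close> in the determinant separates a bounded part of the kernel from
  a part that concentrates at scale \<open>\<bar>x n - \<gamma> (s n)\<bar>\<close> and only sees the density at \<open>\<gamma> s\<^sub>0\<close>.  The
  jump therefore needs to be known for the constant density only.  Its potential has vanishing
  tangential gradient, since the differentiated kernel is exact in the curve parameter; hence it is
  constant on \<open>S2\<close>, and its value is found by approaching the curve along a normal.

  Uniqueness is the maximum principle with the barrier \<open>- ln (1 - x \<bullet> q)\<close>, \<open>q\<close> in the other
  component, whose Laplacian is 1.\<close>

text \<open>Orders of vanishing decide what happens near the curve. With the centre
  \<open>\<gamma> (s n)\<close> the denominator is at least
  \<open>c * ((d n)\<^sup>2 + \<tau>\<^sup>2)\<close>, and C^2 regularity makes the determinant of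
  \<open>\<gamma> (s n)\<close>, \<open>\<gamma> (s n + \<tau>)\<close>,
  \<open>\<gamma>' (s n + \<tau>)\<close> of order \<open>\<tau>\<^sup>2\<close>. So that part of
  the kernel is bounded uniformly in \<open>n\<close>, and on the curve itself the principal value
  is an ordinary integral. The obstacle is the other part: along a general sequence the directions
  \<open>(x n - \<gamma> (s n)) / d n\<close> need not converge, so its limit profile is unknown,
  except when the density vanishes at the limit point; then it is 0 for every direction. The kernels
  are harmonic for different reasons. On the closed sphere the Laplacian of
  \<open>ln (1 - x \<bullet> y)\<close> in \<open>x\<close> is the constant -1 away from
  \<open>y\<close>, so a single layer needs total charge 0. The dipole kernel is, up to sign, a
  tangential derivative of this function in \<open>y\<close>, which removes the constant. The factor
  1/2 of the jump is \<open>2 * pi\<close> times \<open>1 / (4 * pi)\<close>, where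
  \<open>2 * pi\<close> is the mass over the line of the profile
  \<open>2 * v / (1 + (v * w)\<^sup>2)\<close>, \<open>v\<close> being the speed of the
  curve.\<close>

unbundle no cross3_syntax
unbundle set_product_syntax

section \<open>The Laplace-Beltrami operator in terms of gradient and Hessian\<close>

text \<open>Gradient and Hessian are carried as explicit functions, so that the Laplacian is a
  pointwise expression in them. The Hessian is continuous in each fixed direction; this is what lets
  the poles be treated as limits.\<close>

definition twice_diff_on ::
    "(real^3) set \<Rightarrow> (real^3 \<Rightarrow> real) \<Rightarrow> (real^3 \<Rightarrow> real^3) \<Rightarrow> (real^3 \<Rightarrow> real^3 \<Rightarrow> real^3) \<Rightarrow> bool" where
  "twice_diff_on U F G H \<longleftrightarrow> open U \<and>
     (\<forall>y\<in>U. (F has_derivative (\<lambda>h. G y \<bullet> h)) (at y) \<and> (G has_derivative H y) (at y)) \<and>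
     (\<forall>v. continuous_on U (\<lambda>y. H y v))"

text \<open>A great circle through \<open>x\<close> has acceleration \<open>- x\<close>, so the
  second derivative along it is the Hessian term minus \<open>x \<bullet> G x\<close>. Adding this
  over two orthogonal great circles gives the trace without its radial entry, and the factor
  2.\<close>

definition sphere_laplacian :: "(real^3 \<Rightarrow> real^3) \<Rightarrow> (real^3 \<Rightarrow> real^3 \<Rightarrow> real^3) \<Rightarrow> real^3 \<Rightarrow> real" where
  "sphere_laplacian G H x = (\<Sum>i\<in>UNIV. axis i 1 \<bullet> H x (axis i 1)) - x \<bullet> H x x - 2 * (x \<bullet> G x)"

lemma twice_diff_on_subset:
  "twice_diff_on U F G H \<Longrightarrow> open V \<Longrightarrow> V \<subseteq> U \<Longrightarrow> twice_diff_on V F G H"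
  unfolding twice_diff_on_def by (meson continuous_on_subset subset_eq)

lemma DERIV_along_curve:
  assumes F: "twice_diff_on U F G H" and c: "(c has_vector_derivative c') (at s)" and U: "c s \<in> U"
  shows "((\<lambda>s. F (c s)) has_real_derivative G (c s) \<bullet> c') (at s)"
proof -
  have "(F has_derivative (\<lambda>h. G (c s) \<bullet> h)) (at (c s))"
    using F U by (auto simp: twice_diff_on_def)
  from has_derivative_compose[OF c[unfolded has_vector_derivative_def] this]
  show ?thesis
    unfolding has_field_derivative_def by (simp add: mult_commute_abs)
qed

lemma second_DERIV_along_curve:
  assumes F: "twice_diff_on U F G H" and c: "(c has_vector_derivative c' s) (at s)"
    and c': "(c' has_vector_derivative c'') (at s)" and U: "c s \<in> U"
  shows "((\<lambda>s. G (c s) \<bullet> c' s) has_real_derivative c' s \<bullet> H (c s) (c' s) + G (c s) \<bullet> c'') (at s)"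
proof -
  have G: "(G has_derivative H (c s)) (at (c s))"
    using F U by (auto simp: twice_diff_on_def)
  then interpret H: bounded_linear "H (c s)" by (rule has_derivative_bounded_linear)
  have "((\<lambda>s. G (c s)) has_derivative (\<lambda>h. H (c s) (h *\<^sub>R c' s))) (at s)"
    using has_derivative_compose[OF c[unfolded has_vector_derivative_def] G] by simp
  then have "((\<lambda>s. G (c s) \<bullet> c' s) has_derivative
      (\<lambda>h. G (c s) \<bullet> (h *\<^sub>R c'') + H (c s) (h *\<^sub>R c' s) \<bullet> c' s)) (at s)"
    using c'[unfolded has_vector_derivative_def] by (rule has_derivative_inner)
  then show ?thesis
    unfolding has_field_derivative_def
    by (rule has_derivative_eq_rhs) (auto simp: H.scaleR inner_commute algebra_simps)
qed

section \<open>The orthonormal frame of spherical coordinates\<close>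

definition e_phi :: "real \<Rightarrow> real^3" where
  "e_phi \<phi> = vector [- sin \<phi>, cos \<phi>, 0]"

definition e_theta :: "real \<Rightarrow> real \<Rightarrow> real^3" where
  "e_theta \<phi> \<theta> = vector [cos \<phi> * cos \<theta>, sin \<phi> * cos \<theta>, - sin \<theta>]"

lemma has_vector_derivative_vector3:
  assumes "(a has_real_derivative a') (at s)" "(b has_real_derivative b') (at s)"
    "(c has_real_derivative c') (at s)"
  shows "((\<lambda>s. vector [a s, b s, c s] :: real^3) has_vector_derivative vector [a', b', c']) (at s)"
proof -
  have v: "vector [x, y, z] = x *\<^sub>R axis 1 1 + y *\<^sub>R axis 2 1 + z *\<^sub>R (axis 3 1 :: real^3)" for x y z
    by (simp add: vec_eq_iff forall_3 axis_def)
  show ?thesis unfolding v using assms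
    by (auto intro!: derivative_eq_intros simp: has_real_derivative_iff_has_vector_derivative)
qed

lemma sph_deriv_phi: "((\<lambda>a. sph a \<theta>) has_vector_derivative sin \<theta> *\<^sub>R e_phi a) (at a)"
proof -
  have "((\<lambda>a. sph a \<theta>) has_vector_derivative vector [- sin a * sin \<theta>, cos a * sin \<theta>, 0]) (at a)"
    unfolding sph_def
    by (rule has_vector_derivative_vector3) (auto intro!: derivative_eq_intros)
  also have "vector [- sin a * sin \<theta>, cos a * sin \<theta>, 0] = sin \<theta> *\<^sub>R e_phi a"
    by (simp add: e_phi_def vec_eq_iff forall_3)
  finally show ?thesis .
qed

lemma sph_deriv_theta: "((\<lambda>a. sph \<phi> a) has_vector_derivative e_theta \<phi> a) (at a)"
  unfolding sph_def e_theta_def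
  by (rule has_vector_derivative_vector3) (auto intro!: derivative_eq_intros)

lemma e_phi_deriv: "((\<lambda>a. s *\<^sub>R e_phi a) has_vector_derivative s *\<^sub>R vector [- cos a, - sin a, 0]) (at a)"
proof -
  have "(e_phi has_vector_derivative vector [- cos a, - sin a, 0]) (at a)"
    unfolding e_phi_def
    by (rule has_vector_derivative_vector3) (auto intro!: derivative_eq_intros)
  then show ?thesis by (auto intro!: derivative_eq_intros)
qed

lemma e_theta_deriv: "((\<lambda>a. e_theta \<phi> a) has_vector_derivative - sph \<phi> a) (at a)"
proof -
  have "((\<lambda>a. e_theta \<phi> a) has_vector_derivative vector [- cos \<phi> * sin a, - sin \<phi> * sin a, - cos a]) (at a)"
    unfolding e_theta_def
    by (rule has_vector_derivative_vector3) (auto intro!: derivative_eq_intros)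
  also have "vector [- cos \<phi> * sin a, - sin \<phi> * sin a, - cos a] = - sph \<phi> a"
    by (simp add: sph_def vec_eq_iff forall_3)
  finally show ?thesis .
qed

lemma sph_in_sphere [simp]: "sph \<phi> \<theta> \<in> sphere 0 1"
proof -
  have "(cos \<phi> * sin \<theta>)\<^sup>2 + (sin \<phi> * sin \<theta>)\<^sup>2 + (cos \<theta>)\<^sup>2
      = (sin \<theta>)\<^sup>2 * ((cos \<phi>)\<^sup>2 + (sin \<phi>)\<^sup>2) + (cos \<theta>)\<^sup>2"
    by (simp only: power_mult_distrib algebra_simps)
  also have "\<dots> = 1" by simp
  finally have "sph \<phi> \<theta> \<bullet> sph \<phi> \<theta> = 1"
    by (simp add: sph_def inner_vec_def sum_3 flip: power2_eq_square)
  then show ?thesis by (simp add: norm_eq_1)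
qed

text \<open>The vectors \<open>e_phi\<close>, \<open>e_theta\<close>, \<open>sph\<close> form an
  orthonormal basis, and the trace of a linear map is the sum of its diagonal values in any such
  basis.\<close>

lemma frame_quadratic_form:
  fixes L :: "real^3 \<Rightarrow> real^3"
  assumes "bounded_linear L"
  shows "e_phi \<phi> \<bullet> L (e_phi \<phi>) + e_theta \<phi> \<theta> \<bullet> L (e_theta \<phi> \<theta>)
    = (\<Sum>i\<in>UNIV. axis i 1 \<bullet> L (axis i 1)) - sph \<phi> \<theta> \<bullet> L (sph \<phi> \<theta>)"
proof -
  interpret L: bounded_linear L by fact
  define m where "m i j = axis i 1 \<bullet> L (axis j 1)" for i j :: 3
  have q: "v \<bullet> L v = (\<Sum>i\<in>UNIV. \<Sum>j\<in>UNIV. v $ i * v $ j * m i j)" for v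
  proof -
    have v: "v = (\<Sum>i\<in>UNIV. (v $ i) *\<^sub>R axis i 1)"
      using basis_expansion[of v] by (simp add: scalar_mult_eq_scaleR)
    have "L v = (\<Sum>j\<in>UNIV. (v $ j) *\<^sub>R L (axis j 1))"
      by (subst v) (simp add: L.sum L.scaleR)
    then have "v \<bullet> L v = (\<Sum>i\<in>UNIV. (v $ i) *\<^sub>R axis i 1) \<bullet> (\<Sum>j\<in>UNIV. (v $ j) *\<^sub>R L (axis j 1))"
      using v by simp
    also have "\<dots> = (\<Sum>i\<in>UNIV. \<Sum>j\<in>UNIV. ((v $ i) *\<^sub>R axis i 1) \<bullet> ((v $ j) *\<^sub>R L (axis j 1)))"
      by (subst inner_sum_left) (simp only: inner_sum_right)
    finally show ?thesis by (simp add: m_def mult_ac)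
  qed
  have s1: "(cos \<phi>)\<^sup>2 + (sin \<phi>)\<^sup>2 = 1" and s2: "(cos \<theta>)\<^sup>2 + (sin \<theta>)\<^sup>2 = 1" by auto
  \<comment> \<open>Completeness of the frame: the rank-one projections onto the vectors of an
    orthonormal basis sum to the identity matrix.\<close>
  have coeff: "e_phi \<phi> $ i * e_phi \<phi> $ j + e_theta \<phi> \<theta> $ i * e_theta \<phi> \<theta> $ j
      + sph \<phi> \<theta> $ i * sph \<phi> \<theta> $ j = (if i = j then 1 else 0)" for i j
  proof -
    have "\<forall>i j. e_phi \<phi> $ i * e_phi \<phi> $ j + e_theta \<phi> \<theta> $ i * e_theta \<phi> \<theta> $ j
      + sph \<phi> \<theta> $ i * sph \<phi> \<theta> $ j = (if i = j then 1 else 0)"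
      unfolding forall_3 e_phi_def e_theta_def sph_def vector_3
      by (intro conjI; simp; (use s1 s2 in algebra))
    then show ?thesis by blast
  qed
  have "e_phi \<phi> \<bullet> L (e_phi \<phi>) + e_theta \<phi> \<theta> \<bullet> L (e_theta \<phi> \<theta>) + sph \<phi> \<theta> \<bullet> L (sph \<phi> \<theta>)
      = (\<Sum>i\<in>UNIV. \<Sum>j\<in>UNIV. (e_phi \<phi> $ i * e_phi \<phi> $ j + e_theta \<phi> \<theta> $ i * e_theta \<phi> \<theta> $ j
      + sph \<phi> \<theta> $ i * sph \<phi> \<theta> $ j) * m i j)"
    unfolding q by (simp add: sum.distrib algebra_simps)
  also have "\<dots> = (\<Sum>i\<in>UNIV. m i i)"
    unfolding coeff by (simp add: if_distrib[of "\<lambda>a. a * _"] cong: if_cong)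
  finally show ?thesis by (simp add: m_def)
qed

lemma laplace_beltrami_coord_eq:
  assumes F: "twice_diff_on U F G H" and u: "\<And>y. y \<in> sphere 0 1 \<inter> U \<Longrightarrow> u y = F y"
    and x: "sph \<phi> \<theta> \<in> U" and s: "sin \<theta> \<noteq> 0"
  shows "laplace_beltrami_coord u \<phi> \<theta> = sphere_laplacian G H (sph \<phi> \<theta>)"
proof -
  let ?x = "sph \<phi> \<theta>"
  have U: "open U" using F by (simp add: twice_diff_on_def)
  have ev: "\<forall>\<^sub>F a in nhds s. c a \<in> U" if "(c has_vector_derivative c') (at s)" "c s \<in> U"
    for c :: "real \<Rightarrow> real^3" and c' s
  proof -
    have "isCont c s" using that(1) has_vector_derivative_continuous by blast
    then have "(c \<longlongrightarrow> c s) (nhds s)"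
      by (simp add: continuous_at tendsto_nhds_iff)
    then show ?thesis using topological_tendstoD U that(2) by blast
  qed
  have d1: "deriv (\<lambda>b. u (c b)) a = G (c a) \<bullet> c'"
    if "(c has_vector_derivative c') (at a)" "c a \<in> U" "\<And>b. c b \<in> sphere 0 1" for c a c'
  proof -
    have "\<forall>\<^sub>F b in nhds a. u (c b) = F (c b)"
      using ev[OF that(1,2)] by eventually_elim (use that(3) u in auto)
    then have "deriv (\<lambda>b. u (c b)) a = deriv (\<lambda>b. F (c b)) a" by (rule deriv_cong_ev) simp
    then show ?thesis using DERIV_imp_deriv[OF DERIV_along_curve[OF F that(1,2)]] by simp
  qed
  have "\<forall>\<^sub>F a in nhds \<phi>. deriv (\<lambda>b. u (sph b \<theta>)) a = G (sph a \<theta>) \<bullet> (sin \<theta> *\<^sub>R e_phi a)"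
    using ev[OF sph_deriv_phi x]
    by eventually_elim (rule d1, auto intro: sph_deriv_phi simp del: mem_sphere mem_sphere_0)
  then have A: "deriv (\<lambda>a. deriv (\<lambda>b. u (sph b \<theta>)) a) \<phi>
     = (sin \<theta> *\<^sub>R e_phi \<phi>) \<bullet> H ?x (sin \<theta> *\<^sub>R e_phi \<phi>) + G ?x \<bullet> (sin \<theta> *\<^sub>R vector [- cos \<phi>, - sin \<phi>, 0])"
    by (subst deriv_cong_ev[OF _ refl], assumption)
       (auto intro!: DERIV_imp_deriv sph_deriv_phi e_phi_deriv x second_DERIV_along_curve[OF F,
           where c = "\<lambda>a. sph a \<theta>" and c' = "\<lambda>a. sin \<theta> *\<^sub>R e_phi a"]
          simp del: inner_scaleR_left inner_scaleR_right)
  have "\<forall>\<^sub>F a in nhds \<theta>. sin a * deriv (\<lambda>b. u (sph \<phi> b)) a = sin a * (G (sph \<phi> a) \<bullet> e_theta \<phi> a)"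
    using ev[OF sph_deriv_theta x]
    by eventually_elim (subst d1, auto intro: sph_deriv_theta simp del: mem_sphere mem_sphere_0)
  then have B: "deriv (\<lambda>a. sin a * deriv (\<lambda>b. u (sph \<phi> b)) a) \<theta>
     = cos \<theta> * (G ?x \<bullet> e_theta \<phi> \<theta>)
      + (e_theta \<phi> \<theta> \<bullet> H ?x (e_theta \<phi> \<theta>) + G ?x \<bullet> (- ?x)) * sin \<theta>"
    by (subst deriv_cong_ev[OF _ refl], assumption)
       (auto intro!: DERIV_imp_deriv DERIV_mult sph_deriv_theta e_theta_deriv x second_DERIV_along_curve[OF F,
           where c = "\<lambda>a. sph \<phi> a" and c' = "\<lambda>a. e_theta \<phi> a"] simp del: inner_minus_right)
  have "bounded_linear (H ?x)" using F x has_derivative_bounded_linear by (auto simp: twice_diff_on_def)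
  then interpret H: bounded_linear "H ?x" .
  \<comment> \<open>A circle of latitude is not a geodesic: its acceleration has a tangential part.
    The cotangent term of the coordinate formula cancels exactly that part, and the radial rest
    supplies the second copy of \<open>- (G ?x \<bullet> ?x)\<close>.\<close>
  have v: "vector [- cos \<phi>, - sin \<phi>, 0] + cos \<theta> *\<^sub>R e_theta \<phi> \<theta> = - (sin \<theta> *\<^sub>R ?x)"
  proof -
    have "(cos \<theta>)\<^sup>2 = 1 - (sin \<theta>)\<^sup>2" by (simp add: cos_squared_eq)
    then have "- c + cos \<theta> * (c * cos \<theta>) = - (sin \<theta> * (c * sin \<theta>))" for c by algebra
    then show ?thesis by (simp add: vec_eq_iff forall_3 e_theta_def sph_def)
  qed
  have "laplace_beltrami_coord u \<phi> \<theta> =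
     e_phi \<phi> \<bullet> H ?x (e_phi \<phi>) + e_theta \<phi> \<theta> \<bullet> H ?x (e_theta \<phi> \<theta>) - G ?x \<bullet> ?x
      + G ?x \<bullet> (vector [- cos \<phi>, - sin \<phi>, 0] + cos \<theta> *\<^sub>R e_theta \<phi> \<theta>) / sin \<theta>"
    unfolding laplace_beltrami_coord_def A B using s
    by (simp add: H.scaleR inner_add_right power2_eq_square field_simps)
  also have "\<dots> = e_phi \<phi> \<bullet> H ?x (e_phi \<phi>) + e_theta \<phi> \<theta> \<bullet> H ?x (e_theta \<phi> \<theta>) - 2 * (?x \<bullet> G ?x)"
    unfolding v using s by (simp add: inner_commute)
  finally show ?thesis
    unfolding frame_quadratic_form[OF H.bounded_linear_axioms] sphere_laplacian_def .
qed

lemma continuous_on_sphere_laplacian: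
  assumes F: "twice_diff_on U F G H"
  shows "continuous_on U (sphere_laplacian G H)"
proof -
  have G: "continuous_on U G"
    using F by (auto simp: twice_diff_on_def intro!: continuous_at_imp_continuous_on has_derivative_continuous)
  have H: "continuous_on U (\<lambda>y. H y v)" for v using F by (simp add: twice_diff_on_def)
  \<comment> \<open>Continuity of \<open>H\<close> is known in fixed directions only, so the term
    whose direction moves with \<open>x\<close> is expanded in the standard basis.\<close>
  have e: "x \<bullet> H x x = (\<Sum>j\<in>UNIV. x $ j * (x \<bullet> H x (axis j 1)))" if "x \<in> U" for x
  proof -
    have "bounded_linear (H x)" using F that has_derivative_bounded_linear by (auto simp: twice_diff_on_def)
    then interpret L: bounded_linear "H x" .
    have v: "x = (\<Sum>i\<in>UNIV. (x $ i) *\<^sub>R axis i 1)"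
      using basis_expansion[of x] by (simp add: scalar_mult_eq_scaleR)
    have "H x x = (\<Sum>j\<in>UNIV. (x $ j) *\<^sub>R H x (axis j 1))"
      by (subst (2) v) (simp add: L.sum L.scaleR)
    then show ?thesis by (simp add: inner_sum_right)
  qed
  show ?thesis unfolding sphere_laplacian_def
    by (simp add: e cong: continuous_on_cong) (intro continuous_intros H G)
qed

lemma laplace_beltrami_eq:
  assumes F: "twice_diff_on U F G H" and u: "\<And>y. y \<in> sphere 0 1 \<inter> U \<Longrightarrow> u y = F y"
    and x: "x \<in> sphere 0 1" "x \<in> U"
  shows "laplace_beltrami u x = sphere_laplacian G H x"
proof -
  have coord: "laplace_beltrami_coord u (longitude y) (colatitude y) = sphere_laplacian G H y"
    if y: "y \<in> sphere 0 1" "y \<in> U" "\<not> (y $ 1 = 0 \<and> y $ 2 = 0)" for y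
  proof -
    have e: "sph (longitude y) (colatitude y) = y" using y(1) by (rule sph_longitude_colatitude)
    have "sin (colatitude y) \<noteq> 0" using y(3) e by (metis mult_zero_right sph_def vector_3(1,2))
    then show ?thesis using laplace_beltrami_coord_eq[OF F u, of "longitude y" "colatitude y"] e y(2) by simp
  qed
  show ?thesis
  proof (cases "x $ 1 = 0 \<and> x $ 2 = 0")
    case False
    then show ?thesis using coord[OF x False] by (simp only: laplace_beltrami_def Let_def if_False)
  next
    case True
    have "sphere_laplacian G H \<midarrow>x\<rightarrow> sphere_laplacian G H x"
      using continuous_on_sphere_laplacian[OF F] F x
      by (simp add: twice_diff_on_def continuous_on_eq_continuous_at continuous_at)
    then have lim: "(sphere_laplacian G H \<longlongrightarrow> sphere_laplacian G H x) (at x within sphere 0 1)"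
      by (rule tendsto_within_subset) simp
    \<comment> \<open>Near a pole the third coordinate keeps its sign, and the only point of the
      sphere on the axis with that sign is the pole itself.\<close>
    have np: "\<forall>\<^sub>F y in at x within sphere 0 1. \<not> (y $ 1 = 0 \<and> y $ 2 = 0)"
    proof -
      have nz: "x $ 3 \<noteq> 0" using True x(1) by (auto simp: norm_vec_def L2_set_def sum_3)
      have "\<forall>\<^sub>F y in at x within sphere 0 1. y $ 3 * x $ 3 > 0"
        using nz by (intro order_tendstoD tendsto_eq_intros) (auto simp: zero_less_mult_iff)
      moreover have "\<forall>\<^sub>F y in at x within sphere 0 1. y \<in> sphere 0 1 \<and> y \<noteq> x"
        by (auto simp: eventually_at_filter)
      ultimately show ?thesis
      proof eventually_elim
        case (elim y)
        show ?case
        proof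
          assume y: "y $ 1 = 0 \<and> y $ 2 = 0"
          have "(x $ 3)\<^sup>2 = 1" "(y $ 3)\<^sup>2 = 1"
            using elim x(1) y True by (auto simp: norm_vec_def L2_set_def sum_3 power2_eq_1_iff abs_if split: if_splits)
          then have "x $ 3 = y $ 3" using elim(1) by (auto simp: power2_eq_1_iff)
          then have "x = y" using y True by (simp add: vec_eq_iff forall_3)
          then show False using elim by simp
        qed
      qed
    qed
    have "\<forall>\<^sub>F y in at x within sphere 0 1. y \<in> U"
      using F x(2) by (auto simp: twice_diff_on_def eventually_at_topological)
    moreover have "\<forall>\<^sub>F y in at x within sphere 0 1. y \<in> sphere 0 1"
      by (auto simp: eventually_at_filter)
    ultimately have ev: "\<forall>\<^sub>F y in at x within sphere 0 1.
        sphere_laplacian G H y = laplace_beltrami_coord u (longitude y) (colatitude y)"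
      using np by eventually_elim (use coord in auto)
    \<comment> \<open>\<open>Lim\<close> is determined only along a nontrivial filter. A connected
      set with more than one point has no isolated points.\<close>
    have nt: "at x within sphere 0 1 \<noteq> bot"
    proof -
      have "x islimpt sphere 0 1"
      proof (rule connected_imp_perfect)
        have "- x \<in> sphere 0 1" using x(1) by simp
        moreover have "- x \<noteq> x"
        proof
          assume "- x = x"
          then have "x \<bullet> x = - (x \<bullet> x)" by (metis inner_minus_left)
          then show False using x(1) by auto
        qed
        ultimately
        show "sphere 0 1 \<noteq> {a}" for a :: "real^3" using x(1) by (metis singletonD)
      qed (use x in \<open>auto intro!: connected_sphere\<close>)
      then show ?thesis by (simp add: trivial_limit_within)
    qed
    show ?thesis
      using tendsto_Lim[OF nt Lim_transform_eventually[OF lim ev]] True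
      by (simp only: laplace_beltrami_def Let_def if_True simp_thms)
  qed
qed

lemma Ck_on_imp_twice_diff_on:
  assumes U: "open U" and C: "Ck_on 2 U F"
  shows "\<exists>G H. twice_diff_on U F G H"
proof -
  let ?D = "\<lambda>i x. frechet_derivative F (at x) (axis i 1)"
  define G where "G x = (\<chi> i. ?D i x)" for x
  define H where "H x h = (\<chi> i. frechet_derivative (?D i) (at x) h)" for x h
  have 1: "F differentiable at x" and 2: "(?D i) differentiable at x" if "x \<in> U" for x i
    using C that by (auto simp: numeral_2_eq_2)
  have "(F has_derivative (\<lambda>h. G x \<bullet> h)) (at x)" if "x \<in> U" for x
  proof -
    have d: "(F has_derivative frechet_derivative F (at x)) (at x)"
      using 1[OF that] by (simp add: frechet_derivative_works)
    then interpret D: bounded_linear "frechet_derivative F (at x)" by (rule has_derivative_bounded_linear)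
    have "frechet_derivative F (at x) h = G x \<bullet> h" for h
    proof -
      have "h = (\<Sum>i\<in>UNIV. (h $ i) *\<^sub>R axis i 1)"
        using basis_expansion[of h] by (simp add: scalar_mult_eq_scaleR)
      then have "frechet_derivative F (at x) h = frechet_derivative F (at x) (\<Sum>i\<in>UNIV. (h $ i) *\<^sub>R axis i 1)"
        by (rule arg_cong)
      then show ?thesis by (simp add: D.sum D.scaleR G_def inner_vec_def mult.commute)
    qed
    then have "frechet_derivative F (at x) = (\<lambda>h. G x \<bullet> h)" by (rule ext)
    then show ?thesis using d by simp
  qed
  moreover have "(G has_derivative H x) (at x)" if "x \<in> U" for x
    unfolding G_def H_def using 2[OF that]
    by (subst has_derivative_componentwise_within)
       (auto simp: Basis_vec_def inner_axis frechet_derivative_works)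
  moreover have "continuous_on U (\<lambda>y. H y v)" for v
    unfolding H_def using C by (auto simp: numeral_2_eq_2 intro!: continuous_intros)
  ultimately show ?thesis using U unfolding twice_diff_on_def by blast
qed


section \<open>Smoothness and Laplacian of layer potentials\<close>

text \<open>On the unit sphere this is the complement of the curve (\<open>visible_iff\<close>). As
  a subset of space it is open and convex, so it serves both as the domain of differentiation under
  the integral and as one neighbourhood for the smooth extensions.\<close>

definition visible :: "(real \<Rightarrow> real^3) \<Rightarrow> (real^3) set" where
  "visible \<gamma> = {x. \<forall>s\<in>{0..1}. x \<bullet> \<gamma> s < 1}"

text \<open>The family \<open>pot \<gamma> a b m\<close> contains the double layer potentials (\<open>b = 0\<close>, \<open>m = 1\<close>) and is closed
  under differentiation.\<close>

definition pot :: "(real \<Rightarrow> real^3) \<Rightarrow> (real \<Rightarrow> real^3) \<Rightarrow> (real \<Rightarrow> real) \<Rightarrow> nat \<Rightarrow> real^3 \<Rightarrow> real" where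
  "pot \<gamma> a b m x = integral {0..1} (\<lambda>s. (x \<bullet> a s + b s) / (1 - x \<bullet> \<gamma> s) ^ m)"

text \<open>It has two roles: with \<open>r\<close> absorbing the speed and the factor
  \<open>- 1 / (4 * pi)\<close> it is the single layer potential, and for a constant curve it is the
  barrier of the maximum principle.\<close>

definition log_pot :: "(real \<Rightarrow> real^3) \<Rightarrow> (real \<Rightarrow> real) \<Rightarrow> real^3 \<Rightarrow> real" where
  "log_pot \<gamma> r x = integral {0..1} (\<lambda>s. r s * ln (1 - x \<bullet> \<gamma> s))"

lemma visibleD: "x \<in> visible \<gamma> \<Longrightarrow> s \<in> {0..1} \<Longrightarrow> x \<bullet> \<gamma> s < 1"
  by (simp add: visible_def)

lemma convex_visible: "convex (visible \<gamma>)"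
proof -
  have "visible \<gamma> = (\<Inter>s\<in>{0..1}. {x. \<gamma> s \<bullet> x < 1})"
    by (auto simp: visible_def inner_commute)
  then show ?thesis by (auto intro!: convex_INT convex_halfspace_lt)
qed

text \<open>The complement is the projection of a closed set along the compact parameter interval,
  hence closed.\<close>

lemma open_visible:
  assumes "continuous_on {0..1} \<gamma>"
  shows "open (visible \<gamma>)"
proof -
  let ?T = "{p. p \<in> {0..1} \<times> UNIV \<and> snd p \<bullet> \<gamma> (fst p) \<in> {1..}}"
  have "continuous_on ({0..1} \<times> UNIV) (\<lambda>p::real \<times> (real^3). snd p \<bullet> \<gamma> (fst p))"
    by (intro continuous_intros continuous_on_compose2[OF assms]) auto
  then have "closed ?T"
    using continuous_closed_preimage[of "{0..1} \<times> UNIV" "\<lambda>p::real \<times> (real^3). snd p \<bullet> \<gamma> (fst p)" "{1..}"]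
    by (auto simp: closed_Times vimage_def Int_def)
  then have "closed {y. \<exists>s. s \<in> {0..1} \<and> (s, y) \<in> ?T}"
    by (intro closed_compact_projection) auto
  moreover have "- visible \<gamma> = {y. \<exists>s. s \<in> {0..1} \<and> (s, y) \<in> ?T}"
    by (force simp: visible_def not_less)
  ultimately show ?thesis by (simp add: open_closed)
qed

text \<open>The Leibniz rule wants a continuous family of bounded linear maps. Through
  \<open>blinfun_inner_right\<close> it is enough that the gradient \<open>g\<close> is continuous,
  and evaluation at \<open>h\<close> commutes with the integral.\<close>

lemma has_derivative_integral_gradient:
  fixes f :: "real^3 \<Rightarrow> real \<Rightarrow> real" and g :: "real^3 \<Rightarrow> real \<Rightarrow> real^3"
  assumes U: "open U" "convex U" and x: "x \<in> U"
    and d: "\<And>x s. x \<in> U \<Longrightarrow> s \<in> {a..b} \<Longrightarrow> ((\<lambda>x. f x s) has_derivative (\<lambda>h. g x s \<bullet> h)) (at x)"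
    and f: "\<And>x. x \<in> U \<Longrightarrow> continuous_on {a..b} (f x)"
    and g: "continuous_on (U \<times> {a..b}) (\<lambda>(x, s). g x s)"
  shows "((\<lambda>x. integral {a..b} (f x)) has_derivative (\<lambda>h. integral {a..b} (\<lambda>s. g x s \<bullet> h))) (at x)"
proof -
  have ev: "\<And>x. blinfun_apply (blinfun_inner_right x) = (\<lambda>h. x \<bullet> h)"
    by (simp add: fun_eq_iff)
  have gc: "continuous_on {a..b} (\<lambda>s. blinfun_inner_right (g x s))"
  proof -
    have "continuous_on {a..b} (\<lambda>s. (x, s))" by (intro continuous_intros)
    then have "continuous_on {a..b} (\<lambda>s. (\<lambda>(x, s). g x s) (x, s))"
      by (rule continuous_on_compose2[OF g]) (use x in blast)
    then have "continuous_on {a..b} (\<lambda>s. g x s)" by (simp only: prod.case)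
    then show ?thesis
      by (rule bounded_linear.continuous_on[OF bounded_linear_blinfun_inner_right])
  qed
  have "((\<lambda>x. integral (cbox a b) (f x)) has_derivative
     integral (cbox a b) (\<lambda>s. blinfun_inner_right (g x s))) (at x within U)"
  proof (rule leibniz_rule[OF _ _ _ x U(2)])
    show "continuous_on (U \<times> cbox a b) (\<lambda>(x, s). blinfun_inner_right (g x s))"
      using bounded_linear.continuous_on[OF bounded_linear_blinfun_inner_right g]
      by (simp add: case_prod_unfold)
  qed (use d f in \<open>auto simp: ev intro: has_derivative_at_withinI integrable_continuous_real\<close>)
  then have "((\<lambda>x. integral {a..b} (f x)) has_derivative
     blinfun_apply (integral {a..b} (\<lambda>s. blinfun_inner_right (g x s)))) (at x)"
    by (simp only: at_within_open[OF x U(1)] box_real)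
  also have "blinfun_apply (integral {a..b} (\<lambda>s. blinfun_inner_right (g x s)))
     = (\<lambda>h. integral {a..b} (\<lambda>s. g x s \<bullet> h))"
  proof
    fix h
    have "integral {a..b} ((\<lambda>L. blinfun_apply L h) \<circ> (\<lambda>s. blinfun_inner_right (g x s)))
       = blinfun_apply (integral {a..b} (\<lambda>s. blinfun_inner_right (g x s))) h"
      by (rule integral_linear[OF integrable_continuous_real[OF gc]])
         (rule blinfun.bounded_linear_left)
    then show "blinfun_apply (integral {a..b} (\<lambda>s. blinfun_inner_right (g x s))) h
       = integral {a..b} (\<lambda>s. g x s \<bullet> h)"
      by (simp add: o_def)
  qed
  finally show ?thesis .
qed

text \<open>Over the common denominator \<open>(1 - x \<bullet> \<gamma> s) ^ Suc m\<close> the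
  differentiated numerator is \<open>(h \<bullet> a) * (1 - x \<bullet> \<gamma>) + m * (\<gamma>
  \<bullet> h) * (x \<bullet> a + b)\<close>. The products with \<open>x\<close> collect into a new
  \<open>a\<close>, the rest into a new \<open>b\<close>, so the result is affine in
  \<open>x\<close> again.\<close>

lemma has_derivative_pot:
  assumes \<gamma>: "continuous_on {0..1} \<gamma>" and a: "continuous_on {0..1} a" and b: "continuous_on {0..1} b"
    and x: "x \<in> visible \<gamma>"
  shows "(pot \<gamma> a b m has_derivative
     (\<lambda>h. pot \<gamma> (\<lambda>s. (m * (\<gamma> s \<bullet> h)) *\<^sub>R a s - (h \<bullet> a s) *\<^sub>R \<gamma> s)
        (\<lambda>s. h \<bullet> a s + m * (\<gamma> s \<bullet> h) * b s) (Suc m) x)) (at x)"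
proof -
  define g where "g x s = (1 / (1 - x \<bullet> \<gamma> s) ^ m) *\<^sub>R a s
      + (m * (x \<bullet> a s + b s) / (1 - x \<bullet> \<gamma> s) ^ Suc m) *\<^sub>R \<gamma> s" for x s
  have nz: "1 - x \<bullet> \<gamma> s \<noteq> 0" if "x \<in> visible \<gamma>" "s \<in> {0..1}" for x s
    using visibleD[OF that] by simp
  have eq: "g x s \<bullet> h = (x \<bullet> ((m * (\<gamma> s \<bullet> h)) *\<^sub>R a s - (h \<bullet> a s) *\<^sub>R \<gamma> s)
      + (h \<bullet> a s + m * (\<gamma> s \<bullet> h) * b s)) / (1 - x \<bullet> \<gamma> s) ^ Suc m"
    if "x \<in> visible \<gamma>" "s \<in> {0..1}" for x s h
    using nz[OF that] unfolding g_def
    by (simp add: inner_add_left inner_diff_right inner_commute[of h] field_simps)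
  have "((\<lambda>x. integral {0..1} (\<lambda>s. (x \<bullet> a s + b s) / (1 - x \<bullet> \<gamma> s) ^ m)) has_derivative
      (\<lambda>h. integral {0..1} (\<lambda>s. g x s \<bullet> h))) (at x)"
  proof (rule has_derivative_integral_gradient[OF open_visible[OF \<gamma>] convex_visible x])
    fix x s assume xs: "x \<in> visible \<gamma>" "s \<in> {0..1::real}"
    have nz0: "1 - x \<bullet> \<gamma> s \<noteq> 0" using nz[OF xs] .
    \<comment> \<open>The quotient rule produces the exponent \<open>m - 1\<close>; for
      \<open>m = 0\<close> the truncated subtraction is harmless, because its factor
      \<open>m\<close> vanishes.\<close>
    have alg: "(A * e ^ m - N * (of_nat m * (- B) * e ^ (m - 1))) / (e ^ m * e ^ m)
        = 1 / e ^ m * A + m * N / e ^ Suc m * B" if "e \<noteq> 0" for A N B e :: real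
      using that by (cases m) (simp_all add: divide_simps, simp add: algebra_simps)
    have "((\<lambda>x. (x \<bullet> a s + b s) / (1 - x \<bullet> \<gamma> s) ^ m) has_derivative
       (\<lambda>h. ((h \<bullet> a s) * (1 - x \<bullet> \<gamma> s) ^ m
          - (x \<bullet> a s + b s) * (of_nat m * (- (h \<bullet> \<gamma> s)) * (1 - x \<bullet> \<gamma> s) ^ (m - 1)))
          / ((1 - x \<bullet> \<gamma> s) ^ m * (1 - x \<bullet> \<gamma> s) ^ m))) (at x)"
      using nz0 by (auto intro!: derivative_eq_intros)
    moreover have "g x s \<bullet> h = 1 / (1 - x \<bullet> \<gamma> s) ^ m * (h \<bullet> a s)
        + m * (x \<bullet> a s + b s) / (1 - x \<bullet> \<gamma> s) ^ Suc m * (h \<bullet> \<gamma> s)" for h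
      by (simp only: g_def inner_add_left inner_scaleR_left inner_commute[of h])
    ultimately show "((\<lambda>x. (x \<bullet> a s + b s) / (1 - x \<bullet> \<gamma> s) ^ m) has_derivative (\<lambda>h. g x s \<bullet> h)) (at x)"
      by (simp only: alg[OF nz0])
  next
    fix x assume "x \<in> visible \<gamma>"
    then show "continuous_on {0..1} (\<lambda>s. (x \<bullet> a s + b s) / (1 - x \<bullet> \<gamma> s) ^ m)"
      using nz by (intro continuous_intros \<gamma> a b) auto
  next
    have c: "continuous_on (visible \<gamma> \<times> {0..1}) (\<lambda>p. f (snd p))" if "continuous_on {0..1} f"
      for f :: "real \<Rightarrow> 'b::topological_space"
      by (rule continuous_on_compose2[OF that]) (auto intro!: continuous_intros)
    show "continuous_on (visible \<gamma> \<times> {0..1}) (\<lambda>(x, s). g x s)"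
      unfolding g_def case_prod_unfold
      by (intro continuous_intros c \<gamma> a b) (use nz in \<open>auto simp del: power_Suc\<close>)
  qed
  also have "(\<lambda>h. integral {0..1} (\<lambda>s. g x s \<bullet> h)) = (\<lambda>h. pot \<gamma> (\<lambda>s. (m * (\<gamma> s \<bullet> h)) *\<^sub>R a s - (h \<bullet> a s) *\<^sub>R \<gamma> s)
        (\<lambda>s. h \<bullet> a s + m * (\<gamma> s \<bullet> h) * b s) (Suc m) x)"
    unfolding pot_def by (intro ext integral_cong) (rule eq[OF x])
  finally show ?thesis unfolding pot_def .
qed

lemma has_derivative_log_pot:
  assumes \<gamma>: "continuous_on {0..1} \<gamma>" and r: "continuous_on {0..1} r" and x: "x \<in> visible \<gamma>"
  shows "(log_pot \<gamma> r has_derivative (\<lambda>h. pot \<gamma> (\<lambda>s. 0) (\<lambda>s. - r s * (\<gamma> s \<bullet> h)) 1 x)) (at x)"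
proof -
  define g where "g x s = (- r s / (1 - x \<bullet> \<gamma> s)) *\<^sub>R \<gamma> s" for x s
  have pos: "1 - x \<bullet> \<gamma> s > 0" if "x \<in> visible \<gamma>" "s \<in> {0..1}" for x s
    using visibleD[OF that] by simp
  have "((\<lambda>x. integral {0..1} (\<lambda>s. r s * ln (1 - x \<bullet> \<gamma> s))) has_derivative
      (\<lambda>h. integral {0..1} (\<lambda>s. g x s \<bullet> h))) (at x)"
  proof (rule has_derivative_integral_gradient[OF open_visible[OF \<gamma>] convex_visible x])
    fix x s assume xs: "x \<in> visible \<gamma>" "s \<in> {0..1::real}"
    have "((\<lambda>x. r s * ln (1 - x \<bullet> \<gamma> s)) has_derivative
        (\<lambda>h. r s * (inverse (1 - x \<bullet> \<gamma> s) * (- (h \<bullet> \<gamma> s))))) (at x)"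
      using pos[OF xs] by (auto intro!: derivative_eq_intros)
    also have "(\<lambda>h. r s * (inverse (1 - x \<bullet> \<gamma> s) * (- (h \<bullet> \<gamma> s)))) = (\<lambda>h. g x s \<bullet> h)"
      by (simp add: g_def inner_commute divide_inverse mult.assoc)
    finally show "((\<lambda>x. r s * ln (1 - x \<bullet> \<gamma> s)) has_derivative (\<lambda>h. g x s \<bullet> h)) (at x)" .
  next
    fix x assume "x \<in> visible \<gamma>"
    then show "continuous_on {0..1} (\<lambda>s. r s * ln (1 - x \<bullet> \<gamma> s))"
      using pos by (intro continuous_intros \<gamma> r) force
  next
    have c: "continuous_on (visible \<gamma> \<times> {0..1}) (\<lambda>p. f (snd p))" if "continuous_on {0..1} f"
      for f :: "real \<Rightarrow> 'b::topological_space"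
      by (rule continuous_on_compose2[OF that]) (auto intro!: continuous_intros)
    show "continuous_on (visible \<gamma> \<times> {0..1}) (\<lambda>(x, s). g x s)"
      unfolding g_def case_prod_unfold
      by (intro continuous_intros c \<gamma> r) (use pos in force)
  qed
  also have "(\<lambda>h. integral {0..1} (\<lambda>s. g x s \<bullet> h)) = (\<lambda>h. pot \<gamma> (\<lambda>s. 0) (\<lambda>s. - r s * (\<gamma> s \<bullet> h)) 1 x)"
    unfolding pot_def g_def by simp
  finally show ?thesis unfolding log_pot_def .
qed

section \<open>Criteria for \<open>Ck_on\<close> and smoothness of the potentials\<close>

lemma Ck_on_cong:
  assumes "open U" "\<And>x. x \<in> U \<Longrightarrow> f x = g x"
  shows "Ck_on k U f \<longleftrightarrow> Ck_on k U g"
  using assms(2)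
proof (induction k arbitrary: f g)
  case 0
  then show ?case by (simp cong: continuous_on_cong)
next
  case (Suc k)
  have tr: "(g' has_derivative D) (at x)"
    if "(f' has_derivative D) (at x)" "\<And>x. x \<in> U \<Longrightarrow> f' x = g' x" "x \<in> U"
    for f' g' :: "real^3 \<Rightarrow> real" and x D
    using has_derivative_transform_within_open[OF that(1) assms(1) that(3)] that(2) by blast
  have imp: "g' differentiable at x"
    if "f' differentiable at x" "\<And>x. x \<in> U \<Longrightarrow> f' x = g' x" "x \<in> U"
    for f' g' :: "real^3 \<Rightarrow> real" and x
    using tr[of f' _ x g'] that unfolding differentiable_def by blast
  have fr: "frechet_derivative f' (at x) = frechet_derivative g' (at x)"
    if f': "f' differentiable at x" and eq: "\<And>x. x \<in> U \<Longrightarrow> f' x = g' x" "x \<in> U"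
    for f' g' :: "real^3 \<Rightarrow> real" and x
  proof -
    obtain D where D: "(f' has_derivative D) (at x)" using f' by (auto simp: differentiable_def)
    show ?thesis
      using frechet_derivative_at[OF D] frechet_derivative_at[OF tr[OF D eq]] by simp
  qed
  show ?case
  proof (cases "\<forall>x\<in>U. f differentiable at x")
    case True
    then have "\<forall>x\<in>U. g differentiable at x" using imp Suc.prems by blast
    moreover have "Ck_on k U (\<lambda>x. frechet_derivative f (at x) v) \<longleftrightarrow> Ck_on k U (\<lambda>x. frechet_derivative g (at x) v)" for v
      by (rule Suc.IH) (use fr[OF _ Suc.prems] True in auto)
    ultimately show ?thesis using True by simp
  next
    case False
    then have "\<not> (\<forall>x\<in>U. g differentiable at x)" using imp[of g _ f] Suc.prems by metis
    with False show ?thesis unfolding Ck_on.simps by blast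
  qed
qed

text \<open>The derivative may be supplied as a formula instead of
  \<open>frechet_derivative\<close>, so that an induction on \<open>k\<close> stays inside the
  family \<open>pot\<close>.\<close>

lemma Ck_on_SucI:
  assumes "open U" "\<And>x. x \<in> U \<Longrightarrow> (f has_derivative D x) (at x)" "\<And>v. Ck_on k U (\<lambda>x. D x v)"
  shows "Ck_on (Suc k) U f"
proof -
  have "Ck_on k U (\<lambda>x. frechet_derivative f (at x) v)" for v
    using Ck_on_cong[OF assms(1), of "\<lambda>x. frechet_derivative f (at x) v" "\<lambda>x. D x v" k]
      assms(2,3) frechet_derivative_at by metis
  then show ?thesis using assms(2) by (auto simp: differentiable_def)
qed

lemma Ck_on_pot:
  assumes "continuous_on {0..1} \<gamma>" "continuous_on {0..1} a" "continuous_on {0..1} b"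
  shows "Ck_on k (visible \<gamma>) (pot \<gamma> a b m)"
  using assms
proof (induction k arbitrary: a b m)
  case 0
  then show ?case
    by (auto intro!: continuous_at_imp_continuous_on has_derivative_continuous has_derivative_pot)
next
  case (Suc k)
  show ?case
    by (rule Ck_on_SucI[OF open_visible[OF Suc.prems(1)] has_derivative_pot[OF Suc.prems]], assumption)
       (intro Suc.IH continuous_intros Suc.prems)
qed

lemma Ck_on_log_pot:
  assumes \<gamma>: "continuous_on {0..1} \<gamma>" and r: "continuous_on {0..1} r"
  shows "Ck_on k (visible \<gamma>) (log_pot \<gamma> r)"
proof (cases k)
  case 0
  then show ?thesis using assms
    by (auto intro!: continuous_at_imp_continuous_on has_derivative_continuous has_derivative_log_pot)
next
  case (Suc k)
  show ?thesis unfolding Suc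
    by (rule Ck_on_SucI[OF open_visible[OF \<gamma>] has_derivative_log_pot[OF assms]], assumption)
       (intro Ck_on_pot continuous_intros assms)
qed

section \<open>Gradients, Hessians and Laplacians of the potentials\<close>

lemma twice_diff_on_gradient:
  assumes F: "twice_diff_on U F G H" and x: "x \<in> U" and D: "(F has_derivative D) (at x)"
  shows "G x \<bullet> v = D v"
  using has_derivative_unique[OF D, of "\<lambda>h. G x \<bullet> h"] F x by (simp add: twice_diff_on_def)

text \<open>Gradient and Hessian of a potential are obtained abstractly from its smoothness.
  Uniqueness of the derivative identifies them with the explicit formulas.\<close>

lemma twice_diff_on_hessian:
  assumes F: "twice_diff_on U F G H" and x: "x \<in> U"
    and D: "\<And>y. y \<in> U \<Longrightarrow> (F has_derivative D y) (at y)"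
    and E: "((\<lambda>y. D y v) has_derivative E) (at x)"
  shows "v \<bullet> H x w = E w"
proof -
  have "((\<lambda>y. v \<bullet> G y) has_derivative (\<lambda>w. v \<bullet> H x w)) (at x)"
    using F x by (auto simp: twice_diff_on_def intro!: derivative_intros)
  moreover have "open U" using F by (simp add: twice_diff_on_def)
  moreover have "v \<bullet> G y = D y v" if "y \<in> U" for y
    using twice_diff_on_gradient[OF F that D[OF that]] by (simp add: inner_commute)
  ultimately have "((\<lambda>y. D y v) has_derivative (\<lambda>w. v \<bullet> H x w)) (at x)"
    using has_derivative_transform_within_open[of "\<lambda>y. v \<bullet> G y" "\<lambda>w. v \<bullet> H x w" x UNIV U "\<lambda>y. D y v"] x by simp
  from has_derivative_unique[OF E this] show ?thesis by simp
qed

lemma integrable_pot: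
  assumes "continuous_on {0..1} \<gamma>" "continuous_on {0..1} a" "continuous_on {0..1} b" "x \<in> visible \<gamma>"
  shows "(\<lambda>s. (x \<bullet> a s + b s) / (1 - x \<bullet> \<gamma> s) ^ m) integrable_on {0..1}"
  by (intro integrable_continuous_real continuous_intros assms) (use visibleD[OF assms(4)] in force)

text \<open>With \<open>c = x \<bullet> \<gamma> s\<close> the integrand is
  \<open>r s * (- 1 + c\<^sup>2 + 2 * c * (1 - c)) / (1 - c)\<^sup>2\<close>, and its numerator is
  \<open>- r s * (1 - c)\<^sup>2\<close>. Every unit of charge thus contributes the constant -1, and
  only the total charge is left.\<close>

lemma sphere_laplacian_log_pot:
  assumes \<gamma>: "continuous_on {0..1} \<gamma>" and r: "continuous_on {0..1} r" and x: "x \<in> visible \<gamma>"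
    and n: "\<And>s. s \<in> {0..1} \<Longrightarrow> norm (\<gamma> s) = 1"
    and F: "twice_diff_on (visible \<gamma>) (log_pot \<gamma> r) G H"
  shows "sphere_laplacian G H x = - integral {0..1} r"
proof -
  have g: "x \<bullet> G x = pot \<gamma> (\<lambda>s. 0) (\<lambda>s. - r s * (\<gamma> s \<bullet> x)) 1 x"
    using twice_diff_on_gradient[OF F x has_derivative_log_pot[OF \<gamma> r x]] by (simp add: inner_commute)
  have h: "v \<bullet> H x v = pot \<gamma> (\<lambda>s. 0) (\<lambda>s. - r s * (\<gamma> s \<bullet> v)\<^sup>2) 2 x" for v
  proof -
    have "v \<bullet> H x v = pot \<gamma> (\<lambda>s. (real 1 * (\<gamma> s \<bullet> v)) *\<^sub>R 0 - (v \<bullet> 0) *\<^sub>R \<gamma> s)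
        (\<lambda>s. v \<bullet> 0 + real 1 * (\<gamma> s \<bullet> v) * (- r s * (\<gamma> s \<bullet> v))) (Suc 1) x"
      by (rule twice_diff_on_hessian[OF F x has_derivative_log_pot[OF \<gamma> r]], assumption,
           rule has_derivative_pot[OF \<gamma> _ _ x]) (intro continuous_intros \<gamma> r)+
    then show ?thesis by (simp add: pot_def power2_eq_square mult_ac)
  qed
  \<comment> \<open>The summand \<open>x \<bullet> 0\<close> keeps the integrands in the literal
    form of \<open>pot\<close> with \<open>a = 0\<close>.\<close>
  have i: "(\<lambda>s. (x \<bullet> 0 + - r s * f s) / (1 - x \<bullet> \<gamma> s) ^ m) integrable_on {0..1}"
    if "continuous_on {0..1} f" for m and f :: "real \<Rightarrow> real"
    by (rule integrable_pot[OF \<gamma> _ _ x]) (intro continuous_intros r that)+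
  have i1: "(\<lambda>s. (x \<bullet> 0 + - r s * (\<gamma> s \<bullet> v)\<^sup>2) / (1 - x \<bullet> \<gamma> s)\<^sup>2) integrable_on {0..1}" for v
    by (intro i continuous_intros \<gamma>)
  have i2: "(\<lambda>s. (x \<bullet> 0 + - r s * (\<gamma> s \<bullet> x)) / (1 - x \<bullet> \<gamma> s) ^ 1) integrable_on {0..1}"
    by (intro i continuous_intros \<gamma>)
  have "sphere_laplacian G H x = integral {0..1} (\<lambda>s.
      (\<Sum>i\<in>UNIV. (x \<bullet> 0 + - r s * (\<gamma> s \<bullet> axis i 1)\<^sup>2) / (1 - x \<bullet> \<gamma> s)\<^sup>2)
      - (x \<bullet> 0 + - r s * (\<gamma> s \<bullet> x)\<^sup>2) / (1 - x \<bullet> \<gamma> s)\<^sup>2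
      - 2 * ((x \<bullet> 0 + - r s * (\<gamma> s \<bullet> x)) / (1 - x \<bullet> \<gamma> s) ^ 1))"
    unfolding sphere_laplacian_def g h pot_def
    by (rule integral_unique[symmetric])
       (intro has_integral_diff has_integral_sum has_integral_mult_right integrable_integral finite i1 i2)
  also have "\<dots> = integral {0..1} (\<lambda>s. - r s)"
  proof (rule integral_cong)
    fix s :: real assume s: "s \<in> {0..1}"
    define c where "c = x \<bullet> \<gamma> s"
    have c: "1 - c \<noteq> 0" using visibleD[OF x s] by (simp add: c_def)
    have t: "(\<Sum>i\<in>UNIV. (\<gamma> s \<bullet> axis i 1)\<^sup>2) = 1"
      using n[OF s] by (simp only: inner_axis norm_eq_1) (simp add: inner_vec_def power2_eq_square)
    have t': "(\<Sum>i\<in>UNIV. (x \<bullet> 0 + - r s * (\<gamma> s \<bullet> axis i 1)\<^sup>2) / (1 - c)\<^sup>2) = - r s / (1 - c)\<^sup>2"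
      using t by (simp only: inner_zero_right add_0 sum_divide_distrib[symmetric] sum_distrib_left[symmetric] mult_1_right)
    show "(\<Sum>i\<in>UNIV. (x \<bullet> 0 + - r s * (\<gamma> s \<bullet> axis i 1)\<^sup>2) / (1 - x \<bullet> \<gamma> s)\<^sup>2)
      - (x \<bullet> 0 + - r s * (\<gamma> s \<bullet> x)\<^sup>2) / (1 - x \<bullet> \<gamma> s)\<^sup>2
      - 2 * ((x \<bullet> 0 + - r s * (\<gamma> s \<bullet> x)) / (1 - x \<bullet> \<gamma> s) ^ 1) = - r s"
      unfolding inner_commute[of _ x] c_def[symmetric] t' using c
      by (simp add: divide_simps) (simp add: algebra_simps power2_eq_square)
  qed
  finally show ?thesis by simp
qed

text \<open>The cancellation is pointwise in \<open>s\<close>. With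
  \<open>c = x \<bullet> \<gamma> s\<close> and \<open>\<alpha> = x \<bullet> a s\<close>, the trace
  minus the radial entry is \<open>2 * \<alpha> * (1 - c) / (1 - c) ^ 3\<close>, and the first order
  term is \<open>2 * \<alpha> / (1 - c)\<^sup>2\<close>. Orthogonality of \<open>a s\<close> and
  \<open>\<gamma> s\<close> removes the mixed term of the trace.\<close>

lemma sphere_laplacian_dipole:
  assumes \<gamma>: "continuous_on {0..1} \<gamma>" and a: "continuous_on {0..1} a" and x: "x \<in> visible \<gamma>"
    and n: "\<And>s. s \<in> {0..1} \<Longrightarrow> norm (\<gamma> s) = 1" and o: "\<And>s. s \<in> {0..1} \<Longrightarrow> \<gamma> s \<bullet> a s = 0"
    and F: "twice_diff_on (visible \<gamma>) (pot \<gamma> a (\<lambda>s. 0) 1) G H"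
  shows "sphere_laplacian G H x = 0"
proof -
  define A where "A v s = (\<gamma> s \<bullet> v) *\<^sub>R a s - (v \<bullet> a s) *\<^sub>R \<gamma> s" for v s
  define B where "B v s = v \<bullet> a s" for v s
  have Ac: "continuous_on {0..1} (A v)" and Bc: "continuous_on {0..1} (B v)" for v
    unfolding A_def B_def by (intro continuous_intros \<gamma> a)+
  have D: "(pot \<gamma> a (\<lambda>s. 0) 1 has_derivative (\<lambda>h. pot \<gamma> (A h) (B h) 2 y)) (at y)" if "y \<in> visible \<gamma>" for y
    using has_derivative_pot[OF \<gamma> a _ that, of "\<lambda>s. 0" 1]
    unfolding A_def[abs_def] B_def[abs_def] by (simp add: numeral_2_eq_2)
  have g: "x \<bullet> G x = pot \<gamma> (A x) (B x) 2 x"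
    using twice_diff_on_gradient[OF F x D[OF x]] by (simp add: inner_commute)
  define q where "q v s = (x \<bullet> ((2 * (\<gamma> s \<bullet> v)) *\<^sub>R A v s - (v \<bullet> A v s) *\<^sub>R \<gamma> s)
        + (v \<bullet> A v s + 2 * (\<gamma> s \<bullet> v) * B v s)) / (1 - x \<bullet> \<gamma> s) ^ 3" for v s
  define p where "p s = (x \<bullet> A x s + B x s) / (1 - x \<bullet> \<gamma> s)\<^sup>2" for s
  have h: "v \<bullet> H x v = integral {0..1} (q v)" for v
  proof -
    have "v \<bullet> H x v = pot \<gamma> (\<lambda>s. (real 2 * (\<gamma> s \<bullet> v)) *\<^sub>R A v s - (v \<bullet> A v s) *\<^sub>R \<gamma> s)
        (\<lambda>s. v \<bullet> A v s + real 2 * (\<gamma> s \<bullet> v) * B v s) (Suc 2) x"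
      by (rule twice_diff_on_hessian[OF F x D], assumption, rule has_derivative_pot[OF \<gamma> Ac Bc x])
    then show ?thesis by (simp add: pot_def q_def[abs_def] eval_nat_numeral)
  qed
  have i1: "q v integrable_on {0..1}" for v
    unfolding q_def[abs_def] by (rule integrable_pot[OF \<gamma> _ _ x]; intro continuous_intros \<gamma> Ac Bc)
  have i2: "p integrable_on {0..1}"
    unfolding p_def[abs_def] by (rule integrable_pot[OF \<gamma> Ac Bc x])
  have "sphere_laplacian G H x = integral {0..1} (\<lambda>s. (\<Sum>i\<in>UNIV. q (axis i 1) s) - q x s - 2 * p s)"
    unfolding sphere_laplacian_def g h pot_def p_def[symmetric]
    by (rule integral_unique[symmetric])
       (intro has_integral_diff has_integral_sum has_integral_mult_right integrable_integral finite i1 i2)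
  also have "\<dots> = integral {0..1} (\<lambda>s::real. 0)"
  proof (rule integral_cong)
    fix s :: real assume s: "s \<in> {0..1}"
    define c where "c = x \<bullet> \<gamma> s"
    define \<alpha> where "\<alpha> = x \<bullet> a s"
    have c: "1 - c \<noteq> 0" using visibleD[OF x s] by (simp add: c_def)
    have n1: "\<gamma> s \<bullet> \<gamma> s = 1" using n[OF s] by (simp add: norm_eq_1)
    have q': "q v s = (2 * (\<gamma> s \<bullet> v)\<^sup>2 * \<alpha> + 2 * (1 - c) * (\<gamma> s \<bullet> v) * (a s \<bullet> v)) / (1 - c) ^ 3" for v
      unfolding q_def A_def B_def c_def \<alpha>_def
      by (simp add: inner_diff_right inner_commute algebra_simps power2_eq_square)
    have "(\<Sum>i\<in>UNIV. q (axis i 1) s)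
       = (\<Sum>i\<in>UNIV. 2 * (\<gamma> s \<bullet> axis i 1)\<^sup>2 * \<alpha> + 2 * (1 - c) * (\<gamma> s \<bullet> axis i 1) * (a s \<bullet> axis i 1)) / (1 - c) ^ 3"
      unfolding q' by (simp only: sum_divide_distrib)
    also have "(\<Sum>i\<in>UNIV. 2 * (\<gamma> s \<bullet> axis i 1)\<^sup>2 * \<alpha> + 2 * (1 - c) * (\<gamma> s \<bullet> axis i 1) * (a s \<bullet> axis i 1))
       = 2 * (\<gamma> s \<bullet> \<gamma> s) * \<alpha> + 2 * (1 - c) * (\<gamma> s \<bullet> a s)"
      by (simp only: inner_axis) (simp add: inner_vec_def sum_3 power2_eq_square algebra_simps)
    finally have t: "(\<Sum>i\<in>UNIV. q (axis i 1) s) = 2 * \<alpha> / (1 - c) ^ 3" using n1 o[OF s] by simp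
    have qx: "q x s = (2 * c\<^sup>2 * \<alpha> + 2 * (1 - c) * c * \<alpha>) / (1 - c) ^ 3"
      unfolding q' by (simp add: c_def \<alpha>_def inner_commute)
    have px: "p s = \<alpha> / (1 - c)\<^sup>2"
      unfolding p_def A_def B_def c_def \<alpha>_def by (simp add: inner_diff_right inner_commute)
    show "(\<Sum>i\<in>UNIV. q (axis i 1) s) - q x s - 2 * p s = 0"
      unfolding t qx px using c
      by (simp add: divide_simps) (simp add: algebra_simps power2_eq_square power3_eq_cube)
  qed
  finally show ?thesis by simp
qed


section \<open>The potential of the constant density\<close>

text \<open>Four vectors of space are linearly dependent, with the four triple products as
  coefficients (Cramer's rule); this relation is paired with \<open>w\<close>.\<close>

lemma four_vector_identity:
  fixes a b c d w :: "real^3"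
  shows "(b \<bullet> cross3 c d) * (a \<bullet> w) - (a \<bullet> cross3 c d) * (b \<bullet> w)
    + (a \<bullet> cross3 b d) * (c \<bullet> w) - (a \<bullet> cross3 b c) * (d \<bullet> w) = 0"
  by (simp add: cross3_simps)

lemma has_vector_derivative_inner_cross:
  assumes "(c has_vector_derivative c') (at s within T)"
  shows "((\<lambda>s. x \<bullet> cross3 v (c s)) has_real_derivative x \<bullet> cross3 v c') (at s within T)"
proof -
  have "bounded_linear (\<lambda>y. x \<bullet> cross3 v y)"
    using bounded_linear_compose[OF bounded_linear_inner_right, of "cross3 v"]
      bilinear_cross bounded_bilinear.bounded_linear_right bilinear_conv_bounded_bilinear by blast
  from bounded_linear.has_vector_derivative[OF this assms] show ?thesis
    by (simp add: has_real_derivative_iff_has_vector_derivative)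
qed

lemma norm_cross3_le: "norm (cross3 a b) \<le> norm a * norm b"
proof (rule power2_le_imp_le)
  show "(norm (cross3 a b))\<^sup>2 \<le> (norm a * norm b)\<^sup>2"
    using norm_cross_dot[of a b] by (metis le_add_same_cancel1 zero_le_power2)
qed simp

lemma abs_triple_le: "\<bar>a \<bullet> cross3 b c\<bar> \<le> norm a * norm b * norm c"
proof -
  have "\<bar>a \<bullet> cross3 b c\<bar> \<le> norm a * norm (cross3 b c)" by (rule Cauchy_Schwarz_ineq2)
  also have "\<dots> \<le> norm a * (norm b * norm c)" by (intro mult_left_mono norm_cross3_le) simp
  finally show ?thesis by (simp add: mult.assoc)
qed

lemma sphere_curve_tangent:
  fixes \<gamma> :: "real \<Rightarrow> 'a::real_inner"
  assumes c: "\<And>s. (\<gamma> has_vector_derivative \<gamma>' s) (at s)" and n: "\<And>s. norm (\<gamma> s) = 1"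
  shows "\<gamma> s \<bullet> \<gamma>' s = 0"
proof -
  have "((\<lambda>h. \<gamma> s \<bullet> (h *\<^sub>R \<gamma>' s) + (h *\<^sub>R \<gamma>' s) \<bullet> \<gamma> s) = (\<lambda>h. 0))"
  proof (rule has_derivative_unique)
    show "((\<lambda>s. \<gamma> s \<bullet> \<gamma> s) has_derivative (\<lambda>h. \<gamma> s \<bullet> (h *\<^sub>R \<gamma>' s) + (h *\<^sub>R \<gamma>' s) \<bullet> \<gamma> s)) (at s)"
      by (rule has_derivative_inner[OF c[unfolded has_vector_derivative_def] c[unfolded has_vector_derivative_def]])
    have "(\<lambda>s. \<gamma> s \<bullet> \<gamma> s) = (\<lambda>s. 1)" using n by (simp add: norm_eq_1)
    then show "((\<lambda>s. \<gamma> s \<bullet> \<gamma> s) has_derivative (\<lambda>h. 0)) (at s)" by simp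
  qed
  from fun_cong[OF this, of 1] show ?thesis by (simp add: inner_commute)
qed

text \<open>For \<open>v\<close> orthogonal to \<open>x\<close> the differentiated kernel is the
  derivative in \<open>s\<close> of \<open>(x \<bullet> cross3 v (\<gamma> s)) / (1 - x \<bullet>
  \<gamma> s)\<close>, which takes equal values at both ends of a closed curve.\<close>

lemma solid_angle_tangential_derivative:
  assumes c: "\<And>s. (\<gamma> has_vector_derivative \<gamma>' s) (at s)"
    and c': "continuous_on {0..1} \<gamma>'"
    and n: "\<And>s. norm (\<gamma> s) = 1" and closed: "\<gamma> 1 = \<gamma> 0"
    and x: "x \<in> visible \<gamma>" "norm x = 1"
  shows "\<exists>L. (pot \<gamma> (\<lambda>s. cross3 (\<gamma> s) (\<gamma>' s)) (\<lambda>s. 0) 1 has_derivative L) (at x)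
     \<and> (\<forall>v. v \<bullet> x = 0 \<longrightarrow> L v = 0)"
proof (intro exI conjI allI impI)
  let ?a = "\<lambda>s. cross3 (\<gamma> s) (\<gamma>' s)"
  have \<gamma>: "continuous_on {0..1} \<gamma>"
    by (rule continuous_at_imp_continuous_on) (use c has_vector_derivative_continuous in blast)
  have a: "continuous_on {0..1} ?a"
    using bilinear_cross bilinear_conv_bounded_bilinear \<gamma> c' bounded_bilinear.continuous_on by blast
  show "(pot \<gamma> ?a (\<lambda>s. 0) 1 has_derivative
     (\<lambda>h. pot \<gamma> (\<lambda>s. (real 1 * (\<gamma> s \<bullet> h)) *\<^sub>R ?a s - (h \<bullet> ?a s) *\<^sub>R \<gamma> s)
        (\<lambda>s. h \<bullet> ?a s + real 1 * (\<gamma> s \<bullet> h) * 0) (Suc 1) x)) (at x)"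
    by (rule has_derivative_pot[OF \<gamma> a _ x(1)]) (rule continuous_on_const)
  fix v assume v: "v \<bullet> x = 0"
  define f where "f s = (x \<bullet> cross3 v (\<gamma> s)) / (1 - x \<bullet> \<gamma> s)" for s
  define f' where "f' s = (x \<bullet> ((real 1 * (\<gamma> s \<bullet> v)) *\<^sub>R ?a s - (v \<bullet> ?a s) *\<^sub>R \<gamma> s)
      + (v \<bullet> ?a s + real 1 * (\<gamma> s \<bullet> v) * 0)) / (1 - x \<bullet> \<gamma> s) ^ Suc 1" for s
  have "(f' has_integral (f 1 - f 0)) {0..1}"
  proof (rule fundamental_theorem_of_calculus)
    fix s :: real assume s: "s \<in> {0..1}"
    let ?y = "\<gamma> s" and ?z = "\<gamma>' s"
    have nz: "1 - x \<bullet> ?y \<noteq> 0" using visibleD[OF x(1) s] by simp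
    have yy: "?y \<bullet> ?y = 1" using n[of s] by (simp add: norm_eq_1)
    have zy: "?z \<bullet> ?y = 0" using sphere_curve_tangent[OF c n] by (simp add: inner_commute)
    have d: "(f has_real_derivative
        ((x \<bullet> cross3 v ?z) * (1 - x \<bullet> ?y) - (x \<bullet> cross3 v ?y) * (- (x \<bullet> ?z))) / ((1 - x \<bullet> ?y) * (1 - x \<bullet> ?y)))
        (at s)"
    proof -
      have "((\<lambda>s. x \<bullet> \<gamma> s) has_real_derivative x \<bullet> ?z) (at s)"
        unfolding has_real_derivative_iff_has_vector_derivative
        by (rule bounded_linear.has_vector_derivative[OF bounded_linear_inner_right c])
      then have "((\<lambda>s. 1 - x \<bullet> \<gamma> s) has_real_derivative - (x \<bullet> ?z)) (at s)"
        by (auto intro!: derivative_eq_intros)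
      from DERIV_divide[OF has_vector_derivative_inner_cross[OF c] this nz]
      show ?thesis unfolding f_def[abs_def] .
    qed
    \<comment> \<open>The dependency relation of \<open>x\<close>, \<open>v\<close>,
      \<open>?y\<close>, \<open>?z\<close> is paired once with \<open>?y\<close> and once with
      \<open>x\<close>; unit lengths, tangency and \<open>v \<bullet> x = 0\<close> simplify the two
      results.\<close>
    have "(v \<bullet> cross3 ?y ?z) * (x \<bullet> ?y) - (x \<bullet> cross3 ?y ?z) * (v \<bullet> ?y) + (x \<bullet> cross3 v ?z) = 0"
      using four_vector_identity[of v ?y ?z x ?y] yy zy by simp
    moreover have "(v \<bullet> cross3 ?y ?z) + (x \<bullet> cross3 v ?z) * (x \<bullet> ?y) - (x \<bullet> cross3 v ?y) * (x \<bullet> ?z) = 0"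
      using four_vector_identity[of v ?y ?z x x] x(2) v by (simp add: norm_eq_1 inner_commute)
    ultimately have "(x \<bullet> cross3 v ?z) * (1 - x \<bullet> ?y) - (x \<bullet> cross3 v ?y) * (- (x \<bullet> ?z))
      = (?y \<bullet> v) * (x \<bullet> ?a s) - (v \<bullet> ?a s) * (x \<bullet> ?y) + v \<bullet> ?a s"
      by (simp add: inner_commute algebra_simps)
    then have "(f has_vector_derivative f' s) (at s)"
      using d by (simp add: f'_def has_real_derivative_iff_has_vector_derivative inner_diff_right)
    then show "(f has_vector_derivative f' s) (at s within {0..1})"
      by (rule has_vector_derivative_at_within)
  qed simp
  moreover have "f 1 = f 0" by (simp add: f_def closed)
  ultimately show "pot \<gamma> (\<lambda>s. (real 1 * (\<gamma> s \<bullet> v)) *\<^sub>R ?a s - (v \<bullet> ?a s) *\<^sub>R \<gamma> s)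
        (\<lambda>s. v \<bullet> ?a s + real 1 * (\<gamma> s \<bullet> v) * 0) (Suc 1) x = 0"
    unfolding pot_def f'_def[abs_def] by (simp add: integral_unique)
qed

text \<open>Composition with the radial projection turns a vanishing tangential derivative into a
  vanishing derivative on a ball of space, because the derivative of the projection takes tangential
  values. So \<open>f\<close> is locally constant on \<open>S\<close>, and connectedness does the
  rest.\<close>

lemma constant_on_sphere_component:
  fixes f :: "real^3 \<Rightarrow> real"
  assumes U: "open U" and d: "\<And>x. x \<in> U \<Longrightarrow> norm x = 1 \<Longrightarrow>
      \<exists>L. (f has_derivative L) (at x) \<and> (\<forall>v. v \<bullet> x = 0 \<longrightarrow> L v = 0)"
    and S: "connected S" "S \<subseteq> sphere 0 1 \<inter> U"
  shows "f constant_on S"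
proof (rule locally_constant_imp_constant[OF S(1)])
  fix a assume a: "a \<in> S"
  then have na: "norm a = 1" "a \<in> U" using S by auto
  define p :: "real^3 \<Rightarrow> real^3" where "p x = inverse (norm x) *\<^sub>R x" for x
  have p: "norm (p x) = 1" if "x \<noteq> 0" for x using that by (simp add: p_def)
  have pc: "isCont p a" unfolding p_def using na by (intro continuous_intros) auto
  have pa: "p a = a" using na by (simp add: p_def)
  have "\<forall>\<^sub>F x in at a. p x \<in> U"
    using pc U na pa by (metis isCont_def topological_tendstoD)
  then have "\<forall>\<^sub>F x in nhds a. p x \<in> U"
    using na(2) pa by (simp add: eventually_nhds_conv_at)
  moreover have "\<forall>\<^sub>F x in nhds a. x \<noteq> 0"
    using na by (intro t1_space_nhds) auto
  ultimately have "\<forall>\<^sub>F x in nhds a. p x \<in> U \<and> x \<noteq> 0" by (rule eventually_conj)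
  then obtain e where e: "e > 0" "\<And>x. dist x a < e \<Longrightarrow> p x \<in> U \<and> x \<noteq> 0"
    unfolding eventually_nhds_metric by blast
  have "((\<lambda>x. f (p x)) has_derivative (\<lambda>h. 0)) (at x within ball a e)" if x: "x \<in> ball a e" for x
  proof -
    have px: "p x \<in> U" "x \<noteq> 0" using e(2)[of x] x by (auto simp: dist_commute)
    have ip: "((\<lambda>x. inverse (norm x) *\<^sub>R x) has_derivative
       (\<lambda>h. inverse (norm x) *\<^sub>R h + (- (inverse (norm x) * (h \<bullet> sgn x) * inverse (norm x))) *\<^sub>R x)) (at x)"
      using px(2) by (auto intro!: derivative_eq_intros has_derivative_norm)
    define P where "P h = inverse (norm x) *\<^sub>R h + (- (inverse (norm x) * (h \<bullet> sgn x) * inverse (norm x))) *\<^sub>R x" for h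
    have dp: "(p has_derivative P) (at x)" using ip unfolding p_def[abs_def] P_def[abs_def] .
    have orth: "P h \<bullet> p x = 0" for h
    proof -
      have "x \<bullet> x = (norm x)\<^sup>2" by (simp add: power2_norm_eq_inner)
      then show ?thesis using px(2)
        by (simp add: P_def p_def sgn_div_norm inner_diff_left power2_eq_square) (simp add: field_simps)
    qed
    obtain L where L: "(f has_derivative L) (at (p x))" "\<And>v. v \<bullet> p x = 0 \<Longrightarrow> L v = 0"
      using d[OF px(1) p[OF px(2)]] by blast
    have "((\<lambda>x. f (p x)) has_derivative (\<lambda>h. L (P h))) (at x)"
      by (rule has_derivative_compose[OF dp L(1)])
    then show ?thesis using L(2)[OF orth] by (simp add: has_derivative_at_withinI)
  qed
  then have "\<exists>c. \<forall>x\<in>ball a e. f (p x) = c"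
    by (rule has_derivative_zero_constant[OF convex_ball])
  then obtain c where c: "\<And>x. x \<in> ball a e \<Longrightarrow> f (p x) = c" by blast
  have fa: "f x = f a" if "x \<in> S \<inter> ball a e" for x
  proof -
    have "norm x = 1" using that S by auto
    then have "p x = x" by (simp add: p_def)
    then show ?thesis using c[of x] c[of a] that e(1) pa by simp
  qed
  show "\<exists>T. openin (top_of_set S) T \<and> a \<in> T \<and> (\<forall>x\<in>T. f x = f a)"
  proof (intro exI[of _ "S \<inter> ball a e"] conjI ballI)
    show "openin (top_of_set S) (S \<inter> ball a e)" by (rule openin_open_Int) simp
    show "a \<in> S \<inter> ball a e" using a e(1) by simp
  qed (rule fa)
qed

section \<open>Functions of period 1 and their integrals\<close>

lemma periodic_of_int:
  fixes f :: "real \<Rightarrow> 'a"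
  assumes "\<And>s. f (s + 1) = f s"
  shows "f (s + of_int k) = f s"
proof (induction k rule: int_induct[where k = 0])
  case base
  then show ?case by simp
next
  case (step1 i)
  then show ?case using assms[of "s + of_int i"] by (simp add: algebra_simps)
next
  case (step2 i)
  then show ?case using assms[of "s + of_int i - 1"] by (simp add: algebra_simps)
qed

lemma periodic_frac:
  fixes f :: "real \<Rightarrow> 'a"
  assumes "\<And>s. f (s + 1) = f s"
  shows "f (frac s) = f s"
  using periodic_of_int[where f=f, OF assms, of "frac s" "\<lfloor>s\<rfloor>"] by (simp add: frac_def)

lemma periodic_bounded:
  fixes f :: "real \<Rightarrow> 'a::real_normed_vector"
  assumes p: "\<And>s. f (s + 1) = f s" and c: "continuous_on UNIV f"
  obtains B where "B > 0" "\<And>s. norm (f s) \<le> B"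
proof -
  have "compact (f ` {0..1})"
    by (intro compact_continuous_image continuous_on_subset[OF c]) auto
  then obtain B where B: "B > 0" "\<And>x. x \<in> f ` {0..1} \<Longrightarrow> norm x \<le> B"
    using bounded_pos compact_imp_bounded by metis
  have "norm (f s) \<le> B" for s
    using B(2)[OF imageI, of "frac s"] frac_lt_1[of s] frac_ge_0[of s] periodic_frac[where f=f, OF p, of s]
    by simp
  with B(1) show ?thesis by (rule that)
qed

text \<open>The window \<open>{b..b + 1}\<close> with \<open>b = a - 1/2\<close> is cut at the
  integer \<open>k + 1\<close>; its right part is a translate of \<open>{k..b}\<close> by one
  period. The later limits use windows whose centre moves with the approaching point.\<close>

lemma has_integral_periodic:
  fixes f :: "real \<Rightarrow> real"
  assumes p: "\<And>s. f (s + 1) = f s" and I: "(f has_integral I) {0..1}"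
  shows "((\<lambda>t. f (a + t)) has_integral I) {-1/2..1/2}"
proof -
  define b where "b = a - 1/2"
  define k where "k = \<lfloor>b\<rfloor>"
  have shift: "(f has_integral J) {u + of_int j..v + of_int j} \<longleftrightarrow> (f has_integral J) {u..v}" for J u v j
  proof -
    have "f \<circ> (+) (of_int j) = f"
      using periodic_of_int[where f=f, OF p] by (simp add: fun_eq_iff add.commute[of "of_int j"])
    then show ?thesis using has_integral_shift_Icc_real[of f "of_int j" J u v] by simp
  qed
  have kb: "of_int k \<le> b" "b \<le> of_int k + 1"
    unfolding k_def by linarith+
  have K: "(f has_integral I) {of_int k..of_int k + 1}"
    using shift[of I 0 k 1] I by (simp add: add.commute)
  then have "f integrable_on {of_int k..of_int k + 1}" by (rule has_integral_integrable)
  from integrable_on_subinterval[OF this]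
  have i1: "f integrable_on {of_int k..b}" and i2: "f integrable_on {b..of_int k + 1}"
    using kb by simp_all
  have "(f has_integral integral {of_int k..b} f + integral {b..of_int k + 1} f) {of_int k..of_int k + 1}"
    by (rule has_integral_combine[OF kb]) (use i1 i2 in auto)
  then have I': "I = integral {of_int k..b} f + integral {b..of_int k + 1} f"
    using K has_integral_unique by blast
  have "(f has_integral integral {of_int k..b} f) {of_int k + of_int 1..b + of_int 1}"
    unfolding shift using i1 by blast
  then have "(f has_integral integral {b..of_int k + 1} f + integral {of_int k..b} f) {b..b + 1}"
    by (intro has_integral_combine[of b "of_int k + 1" "b + 1"]) (use i2 kb in auto)
  then have "(f has_integral I) {-1/2 + a..1/2 + a}"
    unfolding I' b_def by (simp add: algebra_simps)
  then show ?thesis using has_integral_shift_Icc_real[of f a I "-1/2" "1/2"] by (simp add: o_def)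
qed


section \<open>Geometry of the curve\<close>

lemma has_vector_derivative_shift:
  assumes "(f has_vector_derivative D) (at (s + c))"
  shows "((\<lambda>x. f (x + c)) has_vector_derivative D) (at (s::real))"
proof -
  have "((\<lambda>s. s + c) has_vector_derivative 1) (at s)" by (auto intro!: derivative_eq_intros)
  from vector_diff_chain_at[OF this assms] show ?thesis by (simp add: o_def)
qed

text \<open>Parameters range over the whole line, so the point where the curve closes up is not
  special; simplicity becomes injectivity modulo the period.\<close>

locale sphere_curve =
  fixes \<gamma> \<gamma>' \<gamma>'' :: "real \<Rightarrow> real^3"
  assumes periodic: "\<gamma> (s + 1) = \<gamma> s"
    and deriv: "(\<gamma> has_vector_derivative \<gamma>' s) (at s)"
    and deriv2: "(\<gamma>' has_vector_derivative \<gamma>'' s) (at s)"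
    and cont2: "continuous_on UNIV \<gamma>''"
    and on_sphere: "norm (\<gamma> s) = 1"
    and regular: "\<gamma>' s \<noteq> 0"
    and simple: "\<gamma> s = \<gamma> s' \<Longrightarrow> \<exists>k. s - s' = of_int k"
begin

lemma inner_self [simp]: "\<gamma> s \<bullet> \<gamma> s = 1"
  using on_sphere[of s] by (simp add: norm_eq_1)

lemma continuous_curve: "continuous_on A \<gamma>"
  by (rule continuous_at_imp_continuous_on) (use deriv has_vector_derivative_continuous in blast)

lemma continuous_deriv: "continuous_on A \<gamma>'"
  by (rule continuous_at_imp_continuous_on) (use deriv2 has_vector_derivative_continuous in blast)

lemma continuous_curve_compose [continuous_intros]:
  "continuous_on A f \<Longrightarrow> continuous_on A (\<lambda>x. \<gamma> (f x))"
  by (rule continuous_on_compose2[OF continuous_curve[of UNIV]]) auto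

lemma continuous_deriv_compose [continuous_intros]:
  "continuous_on A f \<Longrightarrow> continuous_on A (\<lambda>x. \<gamma>' (f x))"
  by (rule continuous_on_compose2[OF continuous_deriv[of UNIV]]) auto

lemma tendsto_curve [tendsto_intros]: "(f \<longlongrightarrow> l) F \<Longrightarrow> ((\<lambda>x. \<gamma> (f x)) \<longlongrightarrow> \<gamma> l) F"
  using continuous_curve[of UNIV] by (simp add: continuous_on_def tendsto_compose)

lemma tendsto_deriv [tendsto_intros]: "(f \<longlongrightarrow> l) F \<Longrightarrow> ((\<lambda>x. \<gamma>' (f x)) \<longlongrightarrow> \<gamma>' l) F"
  using continuous_deriv[of UNIV] by (simp add: continuous_on_def tendsto_compose)

lemma periodic_deriv: "\<gamma>' (s + 1) = \<gamma>' s"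
proof -
  have "((\<lambda>s. \<gamma> (s + 1)) has_vector_derivative 1 *\<^sub>R \<gamma>' (s + 1)) (at s)"
    using has_vector_derivative_shift[OF deriv] by simp
  then have "(\<gamma> has_vector_derivative \<gamma>' (s + 1)) (at s)" by (simp add: periodic)
  from vector_derivative_unique_at[OF this deriv] show ?thesis .
qed

lemma periodic_deriv2: "\<gamma>'' (s + 1) = \<gamma>'' s"
proof -
  have "((\<lambda>s. \<gamma>' (s + 1)) has_vector_derivative 1 *\<^sub>R \<gamma>'' (s + 1)) (at s)"
    using has_vector_derivative_shift[OF deriv2] by simp
  then have "(\<gamma>' has_vector_derivative \<gamma>'' (s + 1)) (at s)" by (simp add: periodic_deriv)
  from vector_derivative_unique_at[OF this deriv2] show ?thesis .
qed

lemma tangent: "\<gamma> s \<bullet> \<gamma>' s = 0"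
  using sphere_curve_tangent[OF deriv on_sphere] .

lemma deriv_bounded: obtains B where "B > 0" "\<And>s. norm (\<gamma>' s) \<le> B"
  using periodic_bounded[of \<gamma>', OF periodic_deriv continuous_deriv] by blast

lemma lipschitz_deriv:
  obtains M where "M > 0" "\<And>s h. norm (\<gamma>' (s + h) - \<gamma>' s) \<le> M * \<bar>h\<bar>"
proof -
  obtain M where M: "M > 0" "\<And>s. norm (\<gamma>'' s) \<le> M"
    using periodic_bounded[of \<gamma>'', OF periodic_deriv2 cont2] by blast
  have "norm (\<gamma>' (s + h) - \<gamma>' s) \<le> M * norm (s + h - s)" for s h
  proof (rule differentiable_bound[of UNIV \<gamma>' "\<lambda>s h. h *\<^sub>R \<gamma>'' s"])
    show "onorm (\<lambda>h. h *\<^sub>R \<gamma>'' x) \<le> M" for x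
      by (rule onorm_le) (use M(2)[of x] in \<open>simp add: mult.commute[of M] mult_left_mono\<close>)
  qed (use deriv2 in \<open>auto simp: has_vector_derivative_def\<close>)
  then show ?thesis using M(1) by (intro that[of M]) auto
qed

lemma taylor:
  obtains M where "M > 0" "\<And>s h. norm (\<gamma> (s + h) - \<gamma> s - h *\<^sub>R \<gamma>' s) \<le> M * h\<^sup>2"
proof -
  obtain M where M: "M > 0" "\<And>s h. norm (\<gamma>' (s + h) - \<gamma>' s) \<le> M * \<bar>h\<bar>"
    using lipschitz_deriv by blast
  have "norm (\<gamma> (s + h) - \<gamma> s - h *\<^sub>R \<gamma>' s) \<le> M * h\<^sup>2" for s h
  proof -
    let ?f = "\<lambda>x. \<gamma> (s + x) - x *\<^sub>R \<gamma>' s"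
    have "norm (?f h - ?f 0) \<le> (M * \<bar>h\<bar>) * norm (h - 0)"
    proof (rule differentiable_bound[of "closed_segment 0 h" ?f "\<lambda>x u. u *\<^sub>R (\<gamma>' (s + x) - \<gamma>' s)"])
      fix x assume x: "x \<in> closed_segment 0 h"
      have "((\<lambda>x. \<gamma> (s + x)) has_vector_derivative 1 *\<^sub>R \<gamma>' (s + x)) (at x)"
        using has_vector_derivative_shift[OF deriv, of s x] by (simp add: add.commute)
      then have "(?f has_vector_derivative (1 *\<^sub>R \<gamma>' (s + x) - \<gamma>' s)) (at x)"
        by (auto intro!: derivative_eq_intros)
      then show "(?f has_derivative (\<lambda>u. u *\<^sub>R (\<gamma>' (s + x) - \<gamma>' s))) (at x within closed_segment 0 h)"
        by (simp add: has_vector_derivative_def has_derivative_at_withinI)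
      have "\<bar>x\<bar> \<le> \<bar>h\<bar>" using x by (auto simp: closed_segment_eq_real_ivl split: if_splits)
      then have "norm (\<gamma>' (s + x) - \<gamma>' s) \<le> M * \<bar>h\<bar>"
        using M(2)[of s x] M(1) by (meson mult_left_mono order_trans less_imp_le)
      then show "onorm (\<lambda>u. u *\<^sub>R (\<gamma>' (s + x) - \<gamma>' s)) \<le> M * \<bar>h\<bar>"
        by (intro onorm_le) (simp add: mult.commute mult_left_mono)
    qed auto
    then show ?thesis by (simp add: power2_eq_square algebra_simps)
  qed
  with M(1) show ?thesis by (rule that)
qed

text \<open>For small \<open>h\<close> the linear Taylor term dominates; for the remaining
  \<open>h\<close> the distance is continuous and positive on a compact set, by simplicity of the
  curve.\<close>

lemma bilipschitz:
  obtains m where "m > 0" "\<And>s h. \<bar>h\<bar> \<le> 1/2 \<Longrightarrow> m * \<bar>h\<bar> \<le> norm (\<gamma> (s + h) - \<gamma> s)"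
proof -
  obtain M where M: "M > 0" "\<And>s h. norm (\<gamma> (s + h) - \<gamma> s - h *\<^sub>R \<gamma>' s) \<le> M * h\<^sup>2"
    using taylor by blast
  have "continuous_on UNIV (\<lambda>s. inverse (norm (\<gamma>' s)))"
    by (intro continuous_intros continuous_deriv) (use regular in auto)
  then obtain b where b: "b > 0" "\<And>s. norm (inverse (norm (\<gamma>' s))) \<le> b"
    using periodic_bounded[of "\<lambda>s. inverse (norm (\<gamma>' s))"] periodic_deriv by metis
  define v where "v = inverse b"
  have v: "v > 0" "\<And>s. v \<le> norm (\<gamma>' s)"
  proof -
    show "v > 0" using b(1) by (simp add: v_def)
    show "v \<le> norm (\<gamma>' s)" for s
      using b(2)[of s] b(1) regular[of s] by (simp add: v_def field_simps)
  qed
  \<comment> \<open>Below \<open>\<delta>\<close> the Taylor remainder \<open>M * h\<^sup>2\<close>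
    is at most half of \<open>v * \<bar>h\<bar>\<close>, where \<open>v\<close> is a lower bound for
    the speed.\<close>
  define \<delta> where "\<delta> = min (1/2) (v / (2 * M))"
  have \<delta>: "0 < \<delta>" "\<delta> \<le> 1/2" "\<delta> * (2 * M) \<le> v"
    using v(1) M(1) by (auto simp: \<delta>_def min_def field_simps)
  let ?K = "{0..1::real} \<times> ({-1/2..-\<delta>} \<union> {\<delta>..1/2})"
  let ?q = "\<lambda>p. norm (\<gamma> (fst p + snd p) - \<gamma> (fst p))"
  have "compact ?K" by (intro compact_Times compact_Un) auto
  moreover have "(0, \<delta>) \<in> ?K" using \<delta> by auto
  moreover have "continuous_on ?K ?q" by (intro continuous_intros)
  ultimately obtain p where p: "p \<in> ?K" "\<And>r. r \<in> ?K \<Longrightarrow> ?q p \<le> ?q r"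
    using continuous_attains_inf[of ?K ?q] by blast
  have qp: "?q p > 0"
  proof (rule ccontr)
    assume "\<not> ?q p > 0"
    then have "\<gamma> (fst p + snd p) = \<gamma> (fst p)" by simp
    then obtain k where "snd p = of_int k" using simple by force
    moreover have "0 < \<bar>snd p\<bar>" "\<bar>snd p\<bar> < 1" using p(1) \<delta> by auto
    ultimately have "0 < \<bar>k\<bar>" "\<bar>k\<bar> < 1" by (metis of_int_0_less_iff of_int_abs, metis of_int_abs of_int_less_1_iff)
    then show False by simp
  qed
  \<comment> \<open>Since \<open>\<bar>h\<bar> \<le> 1/2\<close>, the minimum \<open>?q p\<close> is
    at least \<open>2 * ?q p * \<bar>h\<bar>\<close>.\<close>
  define m where "m = min (v / 2) (2 * ?q p)"
  have m: "m > 0" using v(1) qp by (simp add: m_def)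
  have "m * \<bar>h\<bar> \<le> norm (\<gamma> (s + h) - \<gamma> s)" if h: "\<bar>h\<bar> \<le> 1/2" for s h
  proof (cases "\<bar>h\<bar> < \<delta>")
    case True
    have "\<bar>h\<bar> * norm (\<gamma>' s) - norm (\<gamma> (s + h) - \<gamma> s) \<le> norm (\<gamma> (s + h) - \<gamma> s - h *\<^sub>R \<gamma>' s)"
      by (metis norm_minus_commute norm_scaleR norm_triangle_ineq2)
    also have "\<dots> \<le> M * \<bar>h\<bar> * \<bar>h\<bar>" using M(2)[of s h] by (simp add: power2_eq_square mult.assoc)
    also have "\<dots> \<le> v / 2 * \<bar>h\<bar>"
    proof (rule mult_right_mono)
      have "M * \<bar>h\<bar> \<le> M * \<delta>" using True M(1) by (intro mult_left_mono) auto
      moreover have "2 * (M * \<delta>) \<le> v" using \<delta>(3) by (simp add: mult_ac)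
      ultimately show "M * \<bar>h\<bar> \<le> v / 2" by linarith
    qed simp
    finally have "\<bar>h\<bar> * norm (\<gamma>' s) - v / 2 * \<bar>h\<bar> \<le> norm (\<gamma> (s + h) - \<gamma> s)" by simp
    moreover have "v * \<bar>h\<bar> \<le> \<bar>h\<bar> * norm (\<gamma>' s)"
      using v(2)[of s] by (simp add: mult.commute[of v] mult_left_mono)
    moreover have "m * \<bar>h\<bar> \<le> v / 2 * \<bar>h\<bar>" unfolding m_def by (intro mult_right_mono) auto
    ultimately show ?thesis by simp
  next
    case False
    define s' where "s' = frac s"
    have "\<gamma> (s + h) = \<gamma> (s' + h)" "\<gamma> s = \<gamma> s'"
      using periodic_of_int[where f = \<gamma>, OF periodic, of "s' + h" "\<lfloor>s\<rfloor>"]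
        periodic_of_int[where f = \<gamma>, OF periodic, of "s'" "\<lfloor>s\<rfloor>"]
      by (simp_all add: s'_def frac_def algebra_simps)
    moreover have "(s', h) \<in> ?K"
      using False h frac_lt_1[of s] by (auto simp: s'_def abs_if split: if_splits)
    ultimately have "?q p \<le> norm (\<gamma> (s + h) - \<gamma> s)" using p(2)[of "(s', h)"] by simp
    moreover have "m * \<bar>h\<bar> \<le> 2 * ?q p * (1/2)"
      using h qp m by (intro mult_mono) (auto simp: m_def)
    ultimately show ?thesis by simp
  qed
  with m show ?thesis by (rule that)
qed

text \<open>The vectors \<open>\<gamma> (s + h)\<close> and \<open>\<gamma>' (s + h)\<close> are
  both orthogonal to their cross product, so \<open>\<gamma> s\<close> may be replaced by its first
  order Taylor remainder at \<open>s + h\<close>. The order of vanishing matches that of the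
  denominator.\<close>

lemma triple_quadratic:
  obtains K where "K > 0"
    "\<And>s h. \<bar>\<gamma> s \<bullet> cross3 (\<gamma> (s + h)) (\<gamma>' (s + h))\<bar> \<le> K * h\<^sup>2"
proof -
  obtain M where M: "M > 0" "\<And>s h. norm (\<gamma> (s + h) - \<gamma> s - h *\<^sub>R \<gamma>' s) \<le> M * h\<^sup>2"
    using taylor by blast
  obtain B where B: "B > 0" "\<And>s. norm (\<gamma>' s) \<le> B" using deriv_bounded by blast
  have "\<bar>\<gamma> s \<bullet> cross3 (\<gamma> (s + h)) (\<gamma>' (s + h))\<bar> \<le> (M * B) * h\<^sup>2" for s h
  proof -
    let ?r = "\<gamma> (s + h + - h) - \<gamma> (s + h) - (- h) *\<^sub>R \<gamma>' (s + h)"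
    have "\<gamma> s \<bullet> cross3 (\<gamma> (s + h)) (\<gamma>' (s + h)) = ?r \<bullet> cross3 (\<gamma> (s + h)) (\<gamma>' (s + h))"
      by (simp add: inner_add_left inner_diff_left dot_cross_self)
    also have "\<bar>\<dots>\<bar> \<le> norm ?r * norm (\<gamma> (s + h)) * norm (\<gamma>' (s + h))" by (rule abs_triple_le)
    also have "\<dots> \<le> (M * h\<^sup>2) * 1 * B"
      using M(2)[of "s + h" "- h"] B M(1) by (intro mult_mono) (auto simp: on_sphere)
    finally show ?thesis by (simp add: mult_ac)
  qed
  with M B show ?thesis by (intro that[of "M * B"]) auto
qed

lemma distance_eq:
  assumes "norm x = 1"
  shows "1 - x \<bullet> \<gamma> s = (norm (x - \<gamma> s))\<^sup>2 / 2"
  using assms dot_norm_neg[of x "\<gamma> s"] by (simp add: on_sphere field_simps)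

end


section \<open>Limits of singular integrals\<close>

text \<open>Used with \<open>v\<close> the speed of the curve, for the mass of the limit profile,
  and with \<open>v = 1\<close>, for an integrable majorant.\<close>

lemma has_integral_arctan_kernel:
  assumes v: "v > 0"
  shows "((\<lambda>w. 1 / (1 + (v * w)\<^sup>2)) has_integral pi / v) UNIV"
proof -
  define F where "F w = arctan (v * w) / v" for w
  have d: "(F has_real_derivative 1 / (1 + (v * w)\<^sup>2)) (at w)" for w
  proof -
    have "1 + (v * w)\<^sup>2 \<noteq> 0" by (metis add_less_same_cancel1 less_irrefl not_less_iff_gr_or_eq power2_less_0 zero_less_one add_pos_nonneg zero_le_power2)
    then show ?thesis using v unfolding F_def
      by (auto intro!: derivative_eq_intros simp: divide_inverse)
  qed
  have lim: "((F \<circ> real_of_ereal) \<longlongrightarrow> - (pi / 2) / v) (at_right (-\<infinity>))"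
    "((F \<circ> real_of_ereal) \<longlongrightarrow> (pi / 2) / v) (at_left \<infinity>)"
  proof -
    have "(F \<longlongrightarrow> - (pi / 2) / v) at_bot"
      unfolding F_def[abs_def] using v by (intro tendsto_divide tendsto_const filterlim_compose[OF tendsto_arctan_at_bot]
          filterlim_tendsto_pos_mult_at_bot[OF tendsto_const] filterlim_ident) auto
    then show "((F \<circ> real_of_ereal) \<longlongrightarrow> - (pi / 2) / v) (at_right (-\<infinity>))"
      by (simp only: ereal_tendsto_simps1)
    have "(F \<longlongrightarrow> (pi / 2) / v) at_top"
      unfolding F_def[abs_def] using v by (intro tendsto_divide tendsto_const filterlim_compose[OF tendsto_arctan_at_top]
          filterlim_tendsto_pos_mult_at_top[OF tendsto_const] filterlim_ident) auto
    then show "((F \<circ> real_of_ereal) \<longlongrightarrow> (pi / 2) / v) (at_left \<infinity>)"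
      by (simp only: ereal_tendsto_simps1)
  qed
  have c: "isCont (\<lambda>w. 1 / (1 + (v * w)\<^sup>2)) w" for w
    by (intro continuous_intros) (metis add_pos_nonneg less_irrefl zero_le_power2 zero_less_one)
  have n: "AE x in lborel. - \<infinity> < ereal x \<longrightarrow> ereal x < \<infinity> \<longrightarrow> 0 \<le> 1 / (1 + (v * x)\<^sup>2)"
    by auto
  have *: "set_integrable lborel (einterval (-\<infinity>) \<infinity>) (\<lambda>w. 1 / (1 + (v * w)\<^sup>2))"
    "(LBINT w=-\<infinity>..\<infinity>. 1 / (1 + (v * w)\<^sup>2)) = (pi / 2) / v - - (pi / 2) / v"
    by (rule interval_integral_FTC_nonneg[OF _ d c n lim]; simp)+
  have e: "einterval (-\<infinity>) \<infinity> = UNIV" by (auto simp: einterval_def)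
  have i: "(\<lambda>w. 1 / (1 + (v * w)\<^sup>2)) integrable_on UNIV"
    using set_borel_integral_eq_integral(1)[OF *(1)] by (simp add: e)
  have "integral UNIV (\<lambda>w. 1 / (1 + (v * w)\<^sup>2)) = pi / v"
    using set_borel_integral_eq_integral(2)[OF *(1)] *(2)
    by (simp add: e interval_lebesgue_integral_def)
  with i show ?thesis by (simp add: has_integral_integrable_integral)
qed

lemma tendsto_cross3:
  "(f \<longlongrightarrow> a) F \<Longrightarrow> (g \<longlongrightarrow> b) F \<Longrightarrow> ((\<lambda>x. cross3 (f x) (g x)) \<longlongrightarrow> cross3 a b) F"
  using bilinear_cross bilinear_conv_bounded_bilinear bounded_bilinear.tendsto by blast

text \<open>At the centre of the window the kernels have neither a uniform bound nor the right
  limit; this one point is removed by setting all functions to 0 there.\<close>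

lemma dominated_convergence_punctured:
  fixes f :: "nat \<Rightarrow> real \<Rightarrow> real"
  assumes f: "\<And>n. f n integrable_on S" and h: "h integrable_on S"
    and le: "\<And>n t. t \<in> S \<Longrightarrow> t \<noteq> 0 \<Longrightarrow> \<bar>f n t\<bar> \<le> h t"
    and lim: "\<And>t. t \<in> S \<Longrightarrow> t \<noteq> 0 \<Longrightarrow> (\<lambda>n. f n t) \<longlonglongrightarrow> g t"
  shows "g integrable_on S" "(\<lambda>n. integral S (f n)) \<longlonglongrightarrow> integral S g"
proof -
  let ?p = "\<lambda>f t. if t = 0 then 0 else f t :: real"
  have p: "?p f integrable_on S \<longleftrightarrow> f integrable_on S" for f
    by (rule integrable_spike_finite_eq[of "{0}"]) auto
  have i: "integral S (?p f) = integral S f" for f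
    by (rule integral_spike[of "{0}"]) auto
  have "(?p g) integrable_on S" "(\<lambda>n. integral S (?p (f n))) \<longlonglongrightarrow> integral S (?p g)"
    using dominated_convergence[of "\<lambda>n. ?p (f n)" S "?p h" "?p g"] f h le lim unfolding p by auto
  then show "g integrable_on S" "(\<lambda>n. integral S (f n)) \<longlonglongrightarrow> integral S g"
    unfolding p i by auto
qed

text \<open>Majorant for a logarithmic singularity: \<open>ln u \<le> u\<close> at
  \<open>u = \<bar>t\<bar> powr (-1/2)\<close> bounds \<open>- ln \<bar>t\<bar>\<close> by twice
  this power.\<close>

lemma integrable_abs_powr_neg_half: "(\<lambda>t. \<bar>t\<bar> powr (-1/2)) integrable_on {-1/2..1/2::real}"
proof -
  have i: "(\<lambda>t. t powr (-1/2)) integrable_on {0..1/2::real}"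
    using has_integral_powr_from_0[of "-1/2" "1/2"] by (auto simp: integrable_on_def)
  then have 1: "(\<lambda>t. \<bar>t\<bar> powr (-1/2)) integrable_on {0..1/2::real}"
    by (rule integrable_spike_finite[of "{}", rotated 2]) auto
  have "(\<lambda>t. \<bar>- t\<bar> powr (-1/2)) integrable_on {-(1/2)..-0::real}"
    by (rule Henstock_Kurzweil_Integration.integrable_reflect_real[THEN iffD2, OF 1])
  then have 2: "(\<lambda>t. \<bar>t\<bar> powr (-1/2)) integrable_on {-1/2..0::real}" by simp
  show ?thesis
    by (rule Henstock_Kurzweil_Integration.integrable_combine[OF _ _ 2 1]) auto
qed

text \<open>Covers two kinds of approach: a general sequence, where \<open>\<gamma> (s n)\<close> is
  a nearest point and \<open>d n\<close> its distance (\<open>nearest_approach\<close>), and a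
  sequence on a normal great circle, where \<open>s n\<close> is fixed and \<open>d n\<close> is the
  angle (\<open>normal_approach\<close>). The same scale \<open>d n\<close> bounds the offset from
  above and, through \<open>separation\<close>, the denominator from below.\<close>

locale curve_approach = sphere_curve +
  fixes s\<^sub>0 :: real and s d :: "nat \<Rightarrow> real" and x :: "nat \<Rightarrow> real^3" and c :: real
  assumes s_lim: "s \<longlonglongrightarrow> s\<^sub>0" and d_lim: "d \<longlonglongrightarrow> 0" and d_pos: "d n > 0" and c_pos: "c > 0"
    and x_sphere: "norm (x n) = 1" and x_close: "norm (x n - \<gamma> (s n)) \<le> d n"
    and separation: "\<bar>\<tau>\<bar> \<le> 1/2 \<Longrightarrow> 1 - x n \<bullet> \<gamma> (s n + \<tau>) \<ge> c * ((d n)\<^sup>2 + \<tau>\<^sup>2)"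
begin

lemma x_lim: "x \<longlonglongrightarrow> \<gamma> s\<^sub>0"
proof -
  have "(\<lambda>n. norm (x n - \<gamma> (s n))) \<longlonglongrightarrow> 0"
    by (rule tendsto_sandwich[OF _ _ tendsto_const d_lim]) (use x_close in auto)
  then have "(\<lambda>n. x n - \<gamma> (s n)) \<longlonglongrightarrow> 0" by (simp add: tendsto_norm_zero_iff)
  from tendsto_add[OF this tendsto_curve[OF s_lim]] show ?thesis by simp
qed

lemma denominator_lim: "(\<lambda>n. 1 - x n \<bullet> \<gamma> (s n + \<tau>)) \<longlonglongrightarrow> 1 - \<gamma> s\<^sub>0 \<bullet> \<gamma> (s\<^sub>0 + \<tau>)"
  by (intro tendsto_intros x_lim s_lim)

lemma denominator_ge: "\<bar>\<tau>\<bar> \<le> 1/2 \<Longrightarrow> c * \<tau>\<^sup>2 \<le> 1 - x n \<bullet> \<gamma> (s n + \<tau>)"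
proof -
  assume "\<bar>\<tau>\<bar> \<le> 1/2"
  from separation[OF this, of n] have "c * ((d n)\<^sup>2 + \<tau>\<^sup>2) \<le> 1 - x n \<bullet> \<gamma> (s n + \<tau>)" .
  moreover have "c * \<tau>\<^sup>2 \<le> c * ((d n)\<^sup>2 + \<tau>\<^sup>2)" using c_pos by (intro mult_left_mono) auto
  ultimately show ?thesis by linarith
qed

lemma denominator_pos: "\<bar>\<tau>\<bar> \<le> 1/2 \<Longrightarrow> 0 < 1 - x n \<bullet> \<gamma> (s n + \<tau>)"
proof -
  assume "\<bar>\<tau>\<bar> \<le> 1/2"
  moreover have "0 < c * ((d n)\<^sup>2 + \<tau>\<^sup>2)" using c_pos d_pos[of n] by (simp add: add_pos_nonneg)
  ultimately show ?thesis using separation[of \<tau> n] by linarith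
qed

lemma denominator_nonzero: "\<tau> \<in> {-1/2..1/2} \<Longrightarrow> 1 - x n \<bullet> \<gamma> (s n + \<tau>) \<noteq> 0"
proof -
  assume "\<tau> \<in> {-1/2..1/2}"
  then have "\<bar>\<tau>\<bar> \<le> 1/2" by auto
  from denominator_pos[OF this, of n] show ?thesis by simp
qed

lemma denominator_le: "1 - x n \<bullet> \<gamma> (s n + \<tau>) \<le> 2"
  using Cauchy_Schwarz_ineq2[of "x n" "\<gamma> (s n + \<tau>)"] by (simp add: x_sphere on_sphere)

lemma denominator_lim_pos:
  assumes "\<bar>\<tau>\<bar> \<le> 1/2" "\<tau> \<noteq> 0"
  shows "0 < 1 - \<gamma> s\<^sub>0 \<bullet> \<gamma> (s\<^sub>0 + \<tau>)"
proof -
  have "c * \<tau>\<^sup>2 \<le> 1 - \<gamma> s\<^sub>0 \<bullet> \<gamma> (s\<^sub>0 + \<tau>)"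
    by (rule tendsto_lowerbound[OF denominator_lim]) (use denominator_ge[OF assms(1)] in auto)
  moreover have "0 < c * \<tau>\<^sup>2" using c_pos assms(2) by simp
  ultimately show ?thesis by linarith
qed

lemma log_integral_lim:
  assumes r: "continuous_on UNIV r" and R: "\<And>t. \<bar>r t\<bar> \<le> R"
  defines "g \<equiv> \<lambda>\<tau>. r (s\<^sub>0 + \<tau>) * ln (1 - \<gamma> s\<^sub>0 \<bullet> \<gamma> (s\<^sub>0 + \<tau>))"
  shows "g integrable_on {-1/2..1/2}"
    and "(\<lambda>n. integral {-1/2..1/2} (\<lambda>\<tau>. r (s n + \<tau>) * ln (1 - x n \<bullet> \<gamma> (s n + \<tau>))))
      \<longlonglongrightarrow> integral {-1/2..1/2} g"
proof -
  let ?f = "\<lambda>n \<tau>. r (s n + \<tau>) * ln (1 - x n \<bullet> \<gamma> (s n + \<tau>))"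
  \<comment> \<open>The logarithm lies between \<open>ln c + 2 * ln \<bar>\<tau>\<bar>\<close> and
    1, and \<open>- ln \<bar>\<tau>\<bar> \<le> 2 * \<bar>\<tau>\<bar> powr (-1/2)\<close>; hence
    the factor 4.\<close>
  let ?h = "\<lambda>\<tau>::real. R * (1 + \<bar>ln c\<bar>) + (R * 4) * \<bar>\<tau>\<bar> powr (-1/2)"
  have R0: "0 \<le> R" using R[of 0] by linarith
  have rc: "continuous_on A (\<lambda>\<tau>. r (a + \<tau>))" for A a
    by (rule continuous_on_compose2[OF r]) (auto intro!: continuous_intros)
  have rl: "(\<lambda>n. r (s n + \<tau>)) \<longlonglongrightarrow> r (s\<^sub>0 + \<tau>)" for \<tau>
  proof (rule isCont_tendsto_compose[where g = r and l = "s\<^sub>0 + \<tau>"])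
    show "isCont r (s\<^sub>0 + \<tau>)" using r by (simp add: continuous_on_eq_continuous_at)
  qed (intro tendsto_intros s_lim)
  have fi: "?f n integrable_on {-1/2..1/2}" for n
    by (intro integrable_continuous_real continuous_intros rc) (use denominator_nonzero in blast)
  have hi: "?h integrable_on {-1/2..1/2}"
    by (intro integrable_add integrable_on_mult_right integrable_abs_powr_neg_half integrable_const_ivl)
  have le: "\<bar>?f n \<tau>\<bar> \<le> ?h \<tau>" if t: "\<tau> \<in> {-1/2..1/2}" "\<tau> \<noteq> 0" for n \<tau>
  proof -
    let ?z = "1 - x n \<bullet> \<gamma> (s n + \<tau>)"
    have t': "\<bar>\<tau>\<bar> \<le> 1/2" using t by auto
    have z: "0 < ?z" "?z \<le> 2" using denominator_pos[OF t'] denominator_le by auto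
    have "ln ?z \<le> ?z - 1" using z(1) by (rule ln_le_minus_one)
    then have u: "ln ?z \<le> 1" using z(2) by linarith
    have "ln (c * \<tau>\<^sup>2) \<le> ln ?z"
      using denominator_ge[OF t', of n] c_pos t(2) z(1) by simp
    also have "ln (c * \<tau>\<^sup>2) = ln c + 2 * ln \<bar>\<tau>\<bar>"
      using c_pos t(2) ln_mult[of c "\<tau>\<^sup>2"] ln_realpow[of "\<bar>\<tau>\<bar>" 2] by simp
    finally have l1: "ln c + 2 * ln \<bar>\<tau>\<bar> \<le> ln ?z" .
    have "ln (\<bar>\<tau>\<bar> powr (-1/2)) \<le> \<bar>\<tau>\<bar> powr (-1/2)"
      using t(2) ln_bound[of "\<bar>\<tau>\<bar> powr (-1/2)"] by simp
    then have "- (1/2) * ln \<bar>\<tau>\<bar> \<le> \<bar>\<tau>\<bar> powr (-1/2)" using t(2) by (simp add: ln_powr)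
    then have "\<bar>ln ?z\<bar> \<le> 1 + \<bar>ln c\<bar> + 4 * \<bar>\<tau>\<bar> powr (-1/2)"
      using l1 u powr_ge_zero[of "\<bar>\<tau>\<bar>" "-1/2"] abs_ge_self[of "ln c"] abs_ge_minus_self[of "ln c"]
      by (intro abs_leI) linarith+
    then have "\<bar>?f n \<tau>\<bar> \<le> R * (1 + \<bar>ln c\<bar> + 4 * \<bar>\<tau>\<bar> powr (-1/2))"
      unfolding abs_mult using R R0 by (intro mult_mono) auto
    then show ?thesis by (simp add: algebra_simps)
  qed
  have lim: "(\<lambda>n. ?f n \<tau>) \<longlonglongrightarrow> g \<tau>" if "\<tau> \<in> {-1/2..1/2}" "\<tau> \<noteq> 0" for \<tau>
  proof -
    have "\<bar>\<tau>\<bar> \<le> 1/2" using that(1) by auto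
    from denominator_lim_pos[OF this that(2)] show ?thesis
      unfolding g_def by (intro tendsto_mult rl tendsto_ln denominator_lim) auto
  qed
  show "g integrable_on {-1/2..1/2}" "(\<lambda>n. integral {-1/2..1/2} (?f n)) \<longlonglongrightarrow> integral {-1/2..1/2} g"
    using dominated_convergence_punctured[OF fi hi le lim] by auto
qed

text \<open>Centring at \<open>\<gamma> (s n)\<close> pays off here: by
  \<open>triple_quadratic\<close> the numerator is at most \<open>R * K * \<tau>\<^sup>2\<close>,
  the denominator at least \<open>c * \<tau>\<^sup>2\<close>, so a constant majorizes all
  integrands.\<close>

lemma regular_part_lim:
  assumes r: "continuous_on UNIV r" and R: "\<And>t. \<bar>r t\<bar> \<le> R"
  defines "g \<equiv> \<lambda>\<tau>. r (s\<^sub>0 + \<tau>) * (\<gamma> s\<^sub>0 \<bullet> cross3 (\<gamma> (s\<^sub>0 + \<tau>)) (\<gamma>' (s\<^sub>0 + \<tau>))) / (1 - \<gamma> s\<^sub>0 \<bullet> \<gamma> (s\<^sub>0 + \<tau>))"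
  shows "g integrable_on {-1/2..1/2}"
    and "(\<lambda>n. integral {-1/2..1/2} (\<lambda>\<tau>. r (s n + \<tau>) *
        (\<gamma> (s n) \<bullet> cross3 (\<gamma> (s n + \<tau>)) (\<gamma>' (s n + \<tau>))) / (1 - x n \<bullet> \<gamma> (s n + \<tau>))))
      \<longlonglongrightarrow> integral {-1/2..1/2} g"
proof -
  let ?f = "\<lambda>n \<tau>. r (s n + \<tau>) *
        (\<gamma> (s n) \<bullet> cross3 (\<gamma> (s n + \<tau>)) (\<gamma>' (s n + \<tau>))) / (1 - x n \<bullet> \<gamma> (s n + \<tau>))"
  obtain K where K: "K > 0" "\<And>s h. \<bar>\<gamma> s \<bullet> cross3 (\<gamma> (s + h)) (\<gamma>' (s + h))\<bar> \<le> K * h\<^sup>2"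
    using triple_quadratic by blast
  have R0: "0 \<le> R" using R[of 0] by linarith
  have rc: "continuous_on A (\<lambda>\<tau>. r (a + \<tau>))" for A a
    by (rule continuous_on_compose2[OF r]) (auto intro!: continuous_intros)
  have rl: "(\<lambda>n. r (s n + \<tau>)) \<longlonglongrightarrow> r (s\<^sub>0 + \<tau>)" for \<tau>
  proof (rule isCont_tendsto_compose[where g = r and l = "s\<^sub>0 + \<tau>"])
    show "isCont r (s\<^sub>0 + \<tau>)" using r by (simp add: continuous_on_eq_continuous_at)
  qed (intro tendsto_intros s_lim)
  have fi: "?f n integrable_on {-1/2..1/2}" for n
    by (intro integrable_continuous_real continuous_intros continuous_on_cross rc) (use denominator_nonzero in blast)
  have hi: "(\<lambda>\<tau>. R * K / c) integrable_on {-1/2..1/2::real}" by (rule integrable_const_ivl)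
  have le: "\<bar>?f n \<tau>\<bar> \<le> R * K / c" if t: "\<tau> \<in> {-1/2..1/2}" "\<tau> \<noteq> 0" for n \<tau>
  proof -
    have t': "\<bar>\<tau>\<bar> \<le> 1/2" using t by auto
    have "\<bar>?f n \<tau>\<bar> \<le> R * (K * \<tau>\<^sup>2) / (c * \<tau>\<^sup>2)"
      unfolding abs_divide abs_mult
      using denominator_ge[OF t', of n] denominator_pos[OF t', of n] c_pos t(2) K R R0
      by (intro frac_le mult_mono) auto
    then show ?thesis using t(2) by simp
  qed
  have lim: "(\<lambda>n. ?f n \<tau>) \<longlonglongrightarrow> g \<tau>" if "\<tau> \<in> {-1/2..1/2}" "\<tau> \<noteq> 0" for \<tau>
  proof -
    have "\<bar>\<tau>\<bar> \<le> 1/2" using that(1) by auto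
    from denominator_lim_pos[OF this that(2)] show ?thesis
      unfolding g_def
      by (intro tendsto_mult tendsto_divide rl denominator_lim tendsto_cross3 tendsto_intros s_lim) auto
  qed
  show "g integrable_on {-1/2..1/2}" "(\<lambda>n. integral {-1/2..1/2} (?f n)) \<longlonglongrightarrow> integral {-1/2..1/2} g"
    using dominated_convergence_punctured[OF fi hi le lim] by auto
qed

text \<open>The remaining part of the kernel concentrates at scale \<open>d n\<close>, hence the substitution
  \<open>\<tau> = d n * w\<close>.\<close>

lemma concentrated_part_lim:
  assumes r: "continuous_on UNIV r" and R: "\<And>t. \<bar>r t\<bar> \<le> R"
  defines "f \<equiv> \<lambda>n \<tau>. r (s n + \<tau>) *
        ((x n - \<gamma> (s n)) \<bullet> cross3 (\<gamma> (s n + \<tau>)) (\<gamma>' (s n + \<tau>))) / (1 - x n \<bullet> \<gamma> (s n + \<tau>))"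
  assumes L: "\<And>w. (\<lambda>n. d n * f n (d n * w)) \<longlonglongrightarrow> L w"
  shows "(\<lambda>n. integral {-1/2..1/2} (f n)) \<longlonglongrightarrow> integral UNIV L"
proof -
  obtain B where B: "B > 0" "\<And>s. norm (\<gamma>' s) \<le> B" using deriv_bounded by blast
  have R0: "0 \<le> R" using R[of 0] by linarith
  let ?J = "\<lambda>n. {-1/2 / d n..1/2 / d n}"
  \<comment> \<open>Extension by 0 outside the stretched window puts all integrals on the whole
    line, where a single majorant serves every \<open>n\<close>.\<close>
  let ?g = "\<lambda>n w. if w \<in> ?J n then d n * f n (d n * w) else 0"
  have rc: "continuous_on A (\<lambda>\<tau>. r (a + \<tau>))" for A a
    by (rule continuous_on_compose2[OF r]) (auto intro!: continuous_intros)
  have fi: "f n integrable_on {-1/2..1/2}" for n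
    unfolding f_def
    by (intro integrable_continuous_real continuous_intros continuous_on_cross rc) (use denominator_nonzero in blast)
  have gi: "(?g n has_integral integral {-1/2..1/2} (f n)) UNIV" for n
  proof -
    have "((\<lambda>w. f n (d n *\<^sub>R w + 0)) has_integral (integral {-1/2..1/2} (f n) /\<^sub>R d n ^ DIM(real)))
        (cbox ((-1/2 - 0) /\<^sub>R d n) ((1/2 - 0) /\<^sub>R d n))"
      by (rule has_integral_affinity'[OF _ d_pos]) (use fi[of n] in \<open>auto simp: has_integral_integral\<close>)
    then have "((\<lambda>w. f n (d n * w)) has_integral (integral {-1/2..1/2} (f n) / d n)) (?J n)"
      by (simp only: real_scaleR_def add_0_right diff_0_right DIM_real power_one_right box_real
          divide_inverse_commute[symmetric])
    then have "((\<lambda>w. d n * f n (d n * w)) has_integral (d n * (integral {-1/2..1/2} (f n) / d n))) (?J n)"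
      by (rule has_integral_mult_right)
    moreover have "d n * (integral {-1/2..1/2} (f n) / d n) = integral {-1/2..1/2} (f n)"
      using d_pos[of n] by simp
    ultimately show ?thesis by (simp only: has_integral_restrict_UNIV)
  qed
  \<comment> \<open>The numerator is at most \<open>R * (d n * B)\<close> and the denominator at
    least \<open>c * (d n)\<^sup>2 * (1 + w\<^sup>2)\<close>; with the factor \<open>d n\<close> of
    the substitution all powers of \<open>d n\<close> cancel.\<close>
  have bound: "\<bar>?g n w\<bar> \<le> R * B / c * (1 / (1 + (1 * w)\<^sup>2))" for n w
  proof (cases "w \<in> ?J n")
    case True
    let ?t = "d n * w"
    have t: "\<bar>?t\<bar> \<le> 1/2" using True d_pos[of n] by (auto simp: abs_le_iff field_simps)
    have num: "\<bar>(x n - \<gamma> (s n)) \<bullet> cross3 (\<gamma> (s n + ?t)) (\<gamma>' (s n + ?t))\<bar> \<le> d n * B"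
    proof -
      have "\<bar>(x n - \<gamma> (s n)) \<bullet> cross3 (\<gamma> (s n + ?t)) (\<gamma>' (s n + ?t))\<bar>
        \<le> norm (x n - \<gamma> (s n)) * norm (\<gamma> (s n + ?t)) * norm (\<gamma>' (s n + ?t))" by (rule abs_triple_le)
      also have "\<dots> \<le> d n * 1 * B"
        using x_close[of n] B d_pos[of n] by (intro mult_mono) (auto simp: on_sphere)
      finally show ?thesis by simp
    qed
    have "\<bar>f n ?t\<bar> \<le> R * (d n * B) / (c * ((d n)\<^sup>2 + ?t\<^sup>2))"
      unfolding f_def abs_divide abs_mult
      using separation[OF t, of n] denominator_pos[OF t, of n] c_pos d_pos[of n] num R R0 B(1)
      by (intro frac_le mult_mono) (auto simp: add_pos_nonneg)
    then have "d n * \<bar>f n ?t\<bar> \<le> d n * (R * (d n * B) / (c * ((d n)\<^sup>2 + ?t\<^sup>2)))"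
      using d_pos[of n] by (intro mult_left_mono) auto
    also have "(d n)\<^sup>2 + ?t\<^sup>2 = (d n)\<^sup>2 * (1 + w\<^sup>2)" by (simp add: power_mult_distrib algebra_simps)
    also have "d n * (R * (d n * B) / (c * ((d n)\<^sup>2 * (1 + w\<^sup>2)))) = R * B / c * (1 / (1 + (1 * w)\<^sup>2))"
      using d_pos[of n] by (simp add: power2_eq_square)
    finally show ?thesis using True d_pos[of n] by (simp add: abs_mult)
  next
    case False
    have "0 \<le> R * B / c * (1 / (1 + (1 * w)\<^sup>2))" using R0 B(1) c_pos by simp
    then show ?thesis using False by (simp only: if_False abs_zero)
  qed
  have lim: "(\<lambda>n. ?g n w) \<longlonglongrightarrow> L w" for w
  proof (rule Lim_transform_eventually[OF L])
    have "(\<lambda>n. d n * \<bar>w\<bar>) \<longlonglongrightarrow> 0 * \<bar>w\<bar>" by (intro tendsto_intros d_lim)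
    then have "\<forall>\<^sub>F n in sequentially. d n * \<bar>w\<bar> < 1/2" by (rule order_tendstoD) simp
    then show "\<forall>\<^sub>F n in sequentially. d n * f n (d n * w) = ?g n w"
    proof eventually_elim
      case (elim n)
      then have "\<bar>w\<bar> < 1/2 / d n" using d_pos[of n] by (simp add: field_simps)
      moreover have "-1/2 / d n = - (1/2 / d n)" by simp
      ultimately have "w \<in> ?J n" unfolding atLeastAtMost_iff by linarith
      then show ?case by simp
    qed
  qed
  have "(\<lambda>n. integral UNIV (?g n)) \<longlonglongrightarrow> integral UNIV L"
  proof (rule dominated_convergence(2)[where f = ?g])
    show "(\<lambda>w. R * B / c * (1 / (1 + (1 * w)\<^sup>2))) integrable_on UNIV"
      using has_integral_arctan_kernel[of 1] by (intro integrable_on_mult_right) (auto simp: integrable_on_def)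
  qed (use gi bound lim in \<open>auto simp only: real_norm_def has_integral_integrable\<close>)
  then show ?thesis by (simp only: integral_unique[OF gi])
qed

end


section \<open>Approaching the curve\<close>

lemma has_integral_periodic_iff:
  fixes f :: "real \<Rightarrow> real"
  assumes p: "\<And>s. f (s + 1) = f s"
  shows "((\<lambda>t. f (a + t)) has_integral I) {-1/2..1/2} \<longleftrightarrow> (f has_integral I) {0..1}"
proof
  define g where "g t = f (a - 1/2 + t)" for t
  have g: "g (t + 1) = g t" for t using p[of "a - 1/2 + t"] by (simp add: g_def add.assoc)
  assume "((\<lambda>t. f (a + t)) has_integral I) {-1/2..1/2}"
  then have "(g has_integral I) {0..1}"
    using has_integral_shift_Icc_real[of g "1/2" I "-1/2" "1/2"] by (simp add: o_def g_def)
  \<comment> \<open>The offset \<open>1 - a\<close> turns \<open>g\<close> into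
    \<open>f (1/2 + t)\<close>, which is \<open>f\<close> on \<open>{0..1}\<close>.\<close>
  from has_integral_periodic[where f = g, OF g this, of "1 - a"]
  show "(f has_integral I) {0..1}"
    using has_integral_shift_Icc_real[of f "1/2" I "-1/2" "1/2"] by (simp add: o_def g_def)
qed (rule has_integral_periodic[where f = f, OF p])

text \<open>No integrability has to be assumed: it holds on both windows or on neither, and in the
  second case both integrals have the default value 0.\<close>

lemma integral_periodic:
  fixes f :: "real \<Rightarrow> real"
  assumes p: "\<And>s. f (s + 1) = f s"
  shows "integral {0..1} f = integral {-1/2..1/2} (\<lambda>t. f (a + t))"
proof (cases "f integrable_on {0..1}")
  case True
  then have "(f has_integral integral {0..1} f) {0..1}" by blast
  then have "((\<lambda>t. f (a + t)) has_integral integral {0..1} f) {-1/2..1/2}"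
    using has_integral_periodic_iff[where f = f, OF p] by blast
  then show ?thesis by (simp only: integral_unique)
next
  case False
  then have "\<not> (\<lambda>t. f (a + t)) integrable_on {-1/2..1/2}"
    using has_integral_periodic_iff[where f = f, OF p] unfolding integrable_on_def by blast
  with False show ?thesis by (metis not_integrable_integral)
qed

section \<open>Bounds for sine and cosine near 0\<close>

lemma half_le_cos:
  fixes x :: real
  assumes "0 \<le> x" "x \<le> 1"
  shows "1 / 2 \<le> cos x"
proof -
  have "cos (pi / 3) \<le> cos x"
    using assms pi_gt3 by (intro cos_monotone_0_pi_le) auto
  then show ?thesis by (simp add: cos_60)
qed

lemma half_le_sin:
  fixes x :: real
  assumes "0 \<le> x" "x \<le> 1"
  shows "x / 2 \<le> sin x"
proof -
  have "sin 0 - 0 / 2 \<le> sin x - x / 2"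
  proof (rule DERIV_nonneg_imp_nondecreasing[OF assms(1)])
    fix y assume "0 \<le> y" "y \<le> x"
    then show "\<exists>d. ((\<lambda>x. sin x - x / 2) has_real_derivative d) (at y) \<and> 0 \<le> d"
      using half_le_cos[of y] assms
      by (intro exI[of _ "cos y - 1/2"]) (auto intro!: derivative_eq_intros)
  qed
  then show ?thesis by simp
qed

lemma one_minus_cos_bounds:
  fixes x :: real
  assumes "0 \<le> x" "x \<le> 1"
  shows "x\<^sup>2 / 8 \<le> 1 - cos x" "1 - cos x \<le> x\<^sup>2 / 2"
proof -
  have c: "1 - cos x = 2 * (sin (x / 2))\<^sup>2" using cos_double_sin[of "x / 2"] by simp
  have "(x / 4)\<^sup>2 \<le> (sin (x / 2))\<^sup>2" using half_le_sin[of "x / 2"] assms by (intro power_mono) auto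
  then show "x\<^sup>2 / 8 \<le> 1 - cos x" unfolding c by (simp add: power_divide)
  have "(sin (x / 2))\<^sup>2 \<le> (x / 2)\<^sup>2"
    using sin_x_le_x[of "x / 2"] half_le_sin[of "x / 2"] assms by (intro power_mono) auto
  then show "1 - cos x \<le> x\<^sup>2 / 2" unfolding c by (simp add: power_divide)
qed

context sphere_curve
begin

text \<open>Up to a constant factor in \<open>r\<close>, this is the double layer potential off the
  curve and its boundary operator on the curve. On the curve the integrand at the singular parameter
  is 0 / 0, that is, 0.\<close>

definition dipole :: "(real \<Rightarrow> real) \<Rightarrow> real^3 \<Rightarrow> real" where
  "dipole r = pot \<gamma> (\<lambda>s. r s *\<^sub>R cross3 (\<gamma> s) (\<gamma>' s)) (\<lambda>s. 0) 1"

lemma dipole_eq: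
  "dipole r x = integral {0..1} (\<lambda>s. r s * (x \<bullet> cross3 (\<gamma> s) (\<gamma>' s)) / (1 - x \<bullet> \<gamma> s))"
  by (simp add: dipole_def pot_def)

lemma dipole_shift:
  assumes "\<And>s. r (s + 1) = r s"
  shows "dipole r x = integral {-1/2..1/2} (\<lambda>\<tau>. r (a + \<tau>) *
      (x \<bullet> cross3 (\<gamma> (a + \<tau>)) (\<gamma>' (a + \<tau>))) / (1 - x \<bullet> \<gamma> (a + \<tau>)))"
  unfolding dipole_eq by (rule integral_periodic) (simp add: assms periodic periodic_deriv)

lemma log_pot_shift:
  assumes "\<And>s. r (s + 1) = r s"
  shows "log_pot \<gamma> r x = integral {-1/2..1/2} (\<lambda>\<tau>. r (a + \<tau>) * ln (1 - x \<bullet> \<gamma> (a + \<tau>)))"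
  unfolding log_pot_def by (rule integral_periodic) (simp add: assms periodic)

lemma range_curve: "range \<gamma> = \<gamma> ` {0..1}"
proof
  show "range \<gamma> \<subseteq> \<gamma> ` {0..1}"
  proof
    fix y assume "y \<in> range \<gamma>"
    then obtain s where "y = \<gamma> (frac s)" using periodic_frac[where f = \<gamma>, OF periodic] by auto
    then show "y \<in> \<gamma> ` {0..1}" using frac_lt_1[of s] by (auto intro!: imageI less_imp_le)
  qed
qed auto

lemma visible_iff:
  assumes "norm x = 1"
  shows "x \<in> visible \<gamma> \<longleftrightarrow> x \<notin> range \<gamma>"
proof -
  have "x \<bullet> \<gamma> s < 1 \<longleftrightarrow> x \<noteq> \<gamma> s" for s
  proof -
    have "x \<bullet> \<gamma> s < 1 \<longleftrightarrow> 0 < (norm (x - \<gamma> s))\<^sup>2" using distance_eq[OF assms, of s] by linarith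
    then show ?thesis by simp
  qed
  then show ?thesis unfolding range_curve by (auto simp: visible_def)
qed

lemma continuous_dipole_density:
  "continuous_on A r \<Longrightarrow> continuous_on A (\<lambda>s. r s *\<^sub>R cross3 (\<gamma> s) (\<gamma>' s))"
  by (intro continuous_intros continuous_on_cross continuous_curve continuous_deriv)

lemma dipole_diff:
  assumes "continuous_on {0..1} r" "continuous_on {0..1} q" "x \<in> visible \<gamma>"
  shows "dipole (\<lambda>s. r s - q s) x = dipole r x - dipole q x"
proof -
  have i: "(\<lambda>s. r s * (x \<bullet> cross3 (\<gamma> s) (\<gamma>' s)) / (1 - x \<bullet> \<gamma> s)) integrable_on {0..1}"
    if "continuous_on {0..1} r" for r
    using integrable_pot[OF continuous_curve continuous_dipole_density[OF that] continuous_on_const assms(3), of 0 1]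
    by simp
  show ?thesis unfolding dipole_eq
    by (subst Henstock_Kurzweil_Integration.integral_diff[symmetric]) (use i assms in \<open>auto simp: left_diff_distrib diff_divide_distrib\<close>)
qed

lemma dipole_cmult: "dipole (\<lambda>s. k * r s) x = k * dipole r x"
  unfolding dipole_eq by (simp flip: integral_mult_right add: mult.assoc)

text \<open>Let \<open>e\<close> be the distance of \<open>x n\<close> from
  \<open>\<gamma> (s n + \<tau>)\<close>. Minimality gives \<open>d n \<le> e\<close>, and with the
  triangle inequality the two points of the curve are at most \<open>2 * e\<close> apart, so
  \<open>m * \<bar>\<tau>\<bar> \<le> 2 * e\<close>. The denominator is
  \<open>e\<^sup>2 / 2\<close>.\<close>

lemma nearest_approach:
  assumes x: "\<And>n. norm (x n) = 1" "\<And>n. x n \<notin> range \<gamma>" and lim: "x \<longlonglongrightarrow> \<gamma> s\<^sub>0"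
  shows "\<exists>s d c. curve_approach \<gamma> \<gamma>' \<gamma>'' s\<^sub>0 s d x c"
proof -
  obtain m where m: "m > 0" "\<And>s h. \<bar>h\<bar> \<le> 1/2 \<Longrightarrow> m * \<bar>h\<bar> \<le> norm (\<gamma> (s + h) - \<gamma> s)"
    using bilipschitz by blast
  have "\<exists>t. \<bar>t - s\<^sub>0\<bar> \<le> 1/2 \<and> (\<forall>q. norm (x n - \<gamma> t) \<le> norm (x n - \<gamma> q))" for n
  proof -
    have "continuous_on {0..1} (\<lambda>q. norm (x n - \<gamma> q))"
      by (intro continuous_intros continuous_curve)
    then obtain t where t: "t \<in> {0..1::real}" "\<And>q. q \<in> {0..1} \<Longrightarrow> norm (x n - \<gamma> t) \<le> norm (x n - \<gamma> q)"
      using continuous_attains_inf[of "{0..1::real}" "\<lambda>q. norm (x n - \<gamma> q)"] by auto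
    have t': "norm (x n - \<gamma> t) \<le> norm (x n - \<gamma> q)" for q
    proof -
      have "\<gamma> q \<in> \<gamma> ` {0..1}" using range_curve by auto
      then show ?thesis using t(2) by auto
    qed
    \<comment> \<open>A nearest parameter is defined up to the period; shifted to within 1/2 of
      \<open>s\<^sub>0\<close> it is in the range of \<open>bilipschitz\<close>, which then yields
      its convergence.\<close>
    define k where "k = \<lfloor>s\<^sub>0 - t + 1/2\<rfloor>"
    have "\<bar>t + of_int k - s\<^sub>0\<bar> \<le> 1/2" unfolding k_def by linarith
    moreover have "\<gamma> (t + of_int k) = \<gamma> t" by (rule periodic_of_int[where f = \<gamma>, OF periodic])
    ultimately show ?thesis using t' by (intro exI[of _ "t + of_int k"]) simp
  qed
  then obtain s where s: "\<And>n. \<bar>s n - s\<^sub>0\<bar> \<le> 1/2" "\<And>n q. norm (x n - \<gamma> (s n)) \<le> norm (x n - \<gamma> q)"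
    by metis
  define d where "d n = norm (x n - \<gamma> (s n))" for n
  have xl: "(\<lambda>n. norm (x n - \<gamma> s\<^sub>0)) \<longlonglongrightarrow> 0"
    using lim by (simp add: LIM_zero_iff tendsto_norm_zero)
  \<comment> \<open>Each of \<open>(d n)\<^sup>2 / 4\<close> and
    \<open>m\<^sup>2 * \<tau>\<^sup>2 / 16\<close> is at most half of the denominator.\<close>
  have "curve_approach \<gamma> \<gamma>' \<gamma>'' s\<^sub>0 s d x (min (1/4) (m\<^sup>2 / 16))"
  proof
    have "m * \<bar>s n - s\<^sub>0\<bar> \<le> 2 * norm (x n - \<gamma> s\<^sub>0)" for n
    proof -
      have "m * \<bar>s n - s\<^sub>0\<bar> \<le> norm (\<gamma> (s n) - \<gamma> s\<^sub>0)" using m(2)[OF s(1), of n s\<^sub>0] by simp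
      also have "\<dots> \<le> norm (x n - \<gamma> (s n)) + norm (x n - \<gamma> s\<^sub>0)"
        using norm_triangle_ineq4[of "x n - \<gamma> s\<^sub>0" "x n - \<gamma> (s n)"] by simp
      also have "\<dots> \<le> 2 * norm (x n - \<gamma> s\<^sub>0)" using s(2)[of n s\<^sub>0] by simp
      finally show ?thesis .
    qed
    then have "\<bar>s n - s\<^sub>0\<bar> \<le> 2 / m * norm (x n - \<gamma> s\<^sub>0)" for n
      using m(1) by (simp add: field_simps)
    moreover have "(\<lambda>n. 2 / m * norm (x n - \<gamma> s\<^sub>0)) \<longlonglongrightarrow> 2 / m * 0" by (intro tendsto_intros xl)
    ultimately have "(\<lambda>n. s n - s\<^sub>0) \<longlonglongrightarrow> 0"
      by (intro Lim_null_comparison[of "\<lambda>n. s n - s\<^sub>0" "\<lambda>n. 2 / m * norm (x n - \<gamma> s\<^sub>0)"]) auto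
    then show "s \<longlonglongrightarrow> s\<^sub>0" by (simp add: LIM_zero_iff)
    show "d \<longlonglongrightarrow> 0"
      unfolding d_def by (rule tendsto_sandwich[OF _ _ tendsto_const xl]) (use s(2) in auto)
    show "d n > 0" for n using x(2)[of n] by (auto simp: d_def)
    show "min (1/4) (m\<^sup>2 / 16) > 0" using m(1) by simp
    show "norm (x n) = 1" for n by (rule x(1))
    show "norm (x n - \<gamma> (s n)) \<le> d n" for n by (simp add: d_def)
    show "min (1/4) (m\<^sup>2 / 16) * ((d n)\<^sup>2 + \<tau>\<^sup>2) \<le> 1 - x n \<bullet> \<gamma> (s n + \<tau>)"
      if t: "\<bar>\<tau>\<bar> \<le> 1/2" for \<tau> n
    proof -
      let ?e = "norm (x n - \<gamma> (s n + \<tau>))"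
      have 1: "(d n)\<^sup>2 \<le> ?e\<^sup>2" using s(2)[of n] by (intro power_mono) (auto simp: d_def)
      have "m * \<bar>\<tau>\<bar> \<le> norm (\<gamma> (s n + \<tau>) - \<gamma> (s n))" using m(2)[OF t] .
      also have "\<dots> \<le> norm (x n - \<gamma> (s n)) + ?e"
        using norm_triangle_ineq4[of "x n - \<gamma> (s n)" "x n - \<gamma> (s n + \<tau>)"] by simp
      also have "\<dots> \<le> 2 * ?e" using s(2)[of n "s n + \<tau>"] by simp
      finally have "(m * \<bar>\<tau>\<bar>)\<^sup>2 \<le> (2 * ?e)\<^sup>2" using m(1) by (intro power_mono) auto
      then have 2: "m\<^sup>2 * \<tau>\<^sup>2 \<le> 4 * ?e\<^sup>2" by (simp add: power_mult_distrib)
      have "min (1/4) (m\<^sup>2 / 16) * ((d n)\<^sup>2 + \<tau>\<^sup>2) \<le> 1/4 * (d n)\<^sup>2 + m\<^sup>2 / 16 * \<tau>\<^sup>2"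
        unfolding distrib_left by (intro add_mono mult_right_mono) auto
      also have "\<dots> \<le> ?e\<^sup>2 / 2"
      proof -
        have "m\<^sup>2 / 16 * \<tau>\<^sup>2 = (m\<^sup>2 * \<tau>\<^sup>2) / 16" by simp
        then show ?thesis using 1 2 by linarith
      qed
      finally show ?thesis by (simp only: distance_eq[OF x(1)])
    qed
  qed
  then show ?thesis by blast
qed

text \<open>With \<open>y = \<gamma> (s\<^sub>0 + \<tau>)\<close> the denominator is \<open>(1 - cos
  \<epsilon>) + cos \<epsilon> * (1 - \<gamma> s\<^sub>0 \<bullet> y) - sin \<epsilon> * (n\<^sub>0
  \<bullet> y)\<close>. The first two terms give the orders \<open>\<epsilon>\<^sup>2\<close> and
  \<open>\<tau>\<^sup>2\<close>. As the normal is orthogonal to position and velocity,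
  \<open>n\<^sub>0 \<bullet> y\<close> is of order \<open>\<tau>\<^sup>2\<close> and is absorbed for
  small \<open>\<epsilon>\<close>. Both \<open>b\<close> and \<open>c\<close> are fixed before the
  sequence.\<close>

lemma normal_approach:
  assumes n: "norm n\<^sub>0 = 1" "n\<^sub>0 \<bullet> \<gamma> s\<^sub>0 = 0" "n\<^sub>0 \<bullet> \<gamma>' s\<^sub>0 = 0"
  shows "\<exists>b c. b > 0 \<and> (\<forall>\<epsilon>. (\<forall>n. 0 < \<epsilon> n \<and> \<epsilon> n < b) \<and> \<epsilon> \<longlonglongrightarrow> 0 \<longrightarrow>
    curve_approach \<gamma> \<gamma>' \<gamma>'' s\<^sub>0 (\<lambda>_. s\<^sub>0) \<epsilon> (\<lambda>n. cos (\<epsilon> n) *\<^sub>R \<gamma> s\<^sub>0 + sin (\<epsilon> n) *\<^sub>R n\<^sub>0) c)"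
proof -
  obtain m where m: "m > 0" "\<And>s h. \<bar>h\<bar> \<le> 1/2 \<Longrightarrow> m * \<bar>h\<bar> \<le> norm (\<gamma> (s + h) - \<gamma> s)"
    using bilipschitz by blast
  obtain M where M: "M > 0" "\<And>s h. norm (\<gamma> (s + h) - \<gamma> s - h *\<^sub>R \<gamma>' s) \<le> M * h\<^sup>2"
    using taylor by blast
  \<comment> \<open>The bound 1 serves the estimates of sine and cosine;
    \<open>b * M \<le> m\<^sup>2 / 8\<close> limits the loss to half of the available
    \<open>m\<^sup>2 * \<tau>\<^sup>2 / 4\<close>, which leaves the \<open>m\<^sup>2 / 8\<close> of
    \<open>c\<close>.\<close>
  define b where "b = min 1 (m\<^sup>2 / (8 * M))"
  define c where "c = min (1/8) (m\<^sup>2 / 8)"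
  have b: "b > 0" "b \<le> 1" "b * M \<le> m\<^sup>2 / 8"
    using m(1) M(1) by (auto simp: b_def min_def field_simps)
  have "curve_approach \<gamma> \<gamma>' \<gamma>'' s\<^sub>0 (\<lambda>_. s\<^sub>0) \<epsilon> (\<lambda>n. cos (\<epsilon> n) *\<^sub>R \<gamma> s\<^sub>0 + sin (\<epsilon> n) *\<^sub>R n\<^sub>0) c"
    if e: "\<And>n. 0 < \<epsilon> n" "\<And>n. \<epsilon> n < b" "\<epsilon> \<longlonglongrightarrow> 0" for \<epsilon>
  proof
    let ?x = "\<lambda>n. cos (\<epsilon> n) *\<^sub>R \<gamma> s\<^sub>0 + sin (\<epsilon> n) *\<^sub>R n\<^sub>0"
    have nn: "n\<^sub>0 \<bullet> n\<^sub>0 = 1" using n(1) by (simp add: norm_eq_1)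
    have e1: "0 \<le> \<epsilon> n" "\<epsilon> n \<le> 1" for n using e(1,2)[of n] b(2) by auto
    show "(\<lambda>_. s\<^sub>0) \<longlonglongrightarrow> s\<^sub>0" by simp
    show "\<epsilon> \<longlonglongrightarrow> 0" "\<epsilon> n > 0" for n using e by auto
    show "c > 0" using m(1) by (simp add: c_def)
    show x1: "norm (?x n) = 1" for n
      using n(2) nn by (simp add: norm_eq_1 inner_add_left inner_add_right inner_commute[of "\<gamma> s\<^sub>0" n\<^sub>0] flip: power2_eq_square)
    show "norm (?x n - \<gamma> s\<^sub>0) \<le> \<epsilon> n" for n
    proof (rule power2_le_imp_le[OF _ e1(1)])
      have "?x n \<bullet> \<gamma> s\<^sub>0 = cos (\<epsilon> n)" using n(2) by (simp add: inner_add_left)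
      then have "(norm (?x n - \<gamma> s\<^sub>0))\<^sup>2 = 2 * (1 - cos (\<epsilon> n))" using distance_eq[OF x1, of n s\<^sub>0] by simp
      then show "(norm (?x n - \<gamma> s\<^sub>0))\<^sup>2 \<le> (\<epsilon> n)\<^sup>2" using one_minus_cos_bounds(2)[OF e1, of n] by simp
    qed
    show "c * ((\<epsilon> n)\<^sup>2 + \<tau>\<^sup>2) \<le> 1 - ?x n \<bullet> \<gamma> (s\<^sub>0 + \<tau>)" if t: "\<bar>\<tau>\<bar> \<le> 1/2" for \<tau> n
    proof -
      let ?y = "\<gamma> (s\<^sub>0 + \<tau>)" and ?e = "\<epsilon> n"
      have "(m * \<bar>\<tau>\<bar>)\<^sup>2 \<le> (norm (?y - \<gamma> s\<^sub>0))\<^sup>2" using m(2)[OF t] m(1) by (intro power_mono) auto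
      then have r: "m\<^sup>2 * \<tau>\<^sup>2 / 2 \<le> 1 - \<gamma> s\<^sub>0 \<bullet> ?y"
        using distance_eq[OF on_sphere[of s\<^sub>0], of "s\<^sub>0 + \<tau>"] by (simp add: power_mult_distrib norm_minus_commute)
      have "n\<^sub>0 \<bullet> ?y = n\<^sub>0 \<bullet> (?y - \<gamma> s\<^sub>0 - \<tau> *\<^sub>R \<gamma>' s\<^sub>0)" using n by (simp add: inner_diff_right)
      also have "\<dots> \<le> norm n\<^sub>0 * norm (?y - \<gamma> s\<^sub>0 - \<tau> *\<^sub>R \<gamma>' s\<^sub>0)" by (rule norm_cauchy_schwarz)
      also have "\<dots> \<le> M * \<tau>\<^sup>2" using n(1) M(2) by simp
      finally have q: "n\<^sub>0 \<bullet> ?y \<le> M * \<tau>\<^sup>2" .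
      have "sin ?e * (n\<^sub>0 \<bullet> ?y) \<le> sin ?e * (M * \<tau>\<^sup>2)"
        using half_le_sin[OF e1, of n] e1(1)[of n] q by (intro mult_left_mono) auto
      also have "\<dots> \<le> b * (M * \<tau>\<^sup>2)"
        using sin_x_le_x[OF e1(1), of n] e(2)[of n] M(1) by (intro mult_right_mono) auto
      also have "\<dots> = (b * M) * \<tau>\<^sup>2" by simp
      also have "\<dots> \<le> m\<^sup>2 / 8 * \<tau>\<^sup>2" using b(3) by (intro mult_right_mono) auto
      finally have 1: "sin ?e * (n\<^sub>0 \<bullet> ?y) \<le> m\<^sup>2 / 8 * \<tau>\<^sup>2" .
      have "1/2 * (m\<^sup>2 * \<tau>\<^sup>2 / 2) \<le> cos ?e * (1 - \<gamma> s\<^sub>0 \<bullet> ?y)"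
        using half_le_cos[OF e1, of n] r by (intro mult_mono) auto
      moreover have "?e\<^sup>2 / 8 \<le> 1 - cos ?e" by (rule one_minus_cos_bounds(1)[OF e1])
      moreover have "1 - ?x n \<bullet> ?y = (1 - cos ?e) + cos ?e * (1 - \<gamma> s\<^sub>0 \<bullet> ?y) - sin ?e * (n\<^sub>0 \<bullet> ?y)"
        by (simp add: inner_add_left algebra_simps)
      moreover have "c * (?e\<^sup>2 + \<tau>\<^sup>2) \<le> 1/8 * ?e\<^sup>2 + m\<^sup>2 / 8 * \<tau>\<^sup>2"
        unfolding distrib_left c_def by (intro add_mono mult_right_mono) auto
      ultimately show ?thesis using 1 by (simp add: field_simps)
    qed
  qed
  with b(1) show ?thesis by blast
qed

end

context curve_approach
begin

lemma log_pot_lim: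
  assumes r: "continuous_on UNIV r" "\<And>s. r (s + 1) = r s"
  shows "(\<lambda>n. log_pot \<gamma> r (x n)) \<longlonglongrightarrow> log_pot \<gamma> r (\<gamma> s\<^sub>0)"
proof -
  obtain R where R: "\<And>t. \<bar>r t\<bar> \<le> R" using periodic_bounded[of r, OF r(2,1)] by auto
  show ?thesis
    using log_integral_lim(2)[OF r(1) R] log_pot_shift[where r = r, OF r(2), of "x _" "s _"]
      log_pot_shift[where r = r, OF r(2), of "\<gamma> s\<^sub>0" s\<^sub>0] by simp
qed

lemma dipole_split:
  assumes r: "continuous_on UNIV r" "\<And>s. r (s + 1) = r s"
  shows "dipole r (x n) = integral {-1/2..1/2} (\<lambda>\<tau>. r (s n + \<tau>) *
        (\<gamma> (s n) \<bullet> cross3 (\<gamma> (s n + \<tau>)) (\<gamma>' (s n + \<tau>))) / (1 - x n \<bullet> \<gamma> (s n + \<tau>)))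
    + integral {-1/2..1/2} (\<lambda>\<tau>. r (s n + \<tau>) *
        ((x n - \<gamma> (s n)) \<bullet> cross3 (\<gamma> (s n + \<tau>)) (\<gamma>' (s n + \<tau>))) / (1 - x n \<bullet> \<gamma> (s n + \<tau>)))"
proof -
  have rc: "continuous_on A (\<lambda>\<tau>. r (a + \<tau>))" for A a
    by (rule continuous_on_compose2[OF r(1)]) (auto intro!: continuous_intros)
  have i: "(\<lambda>\<tau>. r (s n + \<tau>) * (v \<bullet> cross3 (\<gamma> (s n + \<tau>)) (\<gamma>' (s n + \<tau>))) / (1 - x n \<bullet> \<gamma> (s n + \<tau>)))
      integrable_on {-1/2..1/2}" for v
    by (intro integrable_continuous_real continuous_intros continuous_on_cross rc) (use denominator_nonzero in blast)
  show ?thesis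
    unfolding dipole_shift[where r = r, OF r(2), of "x n" "s n"]
    by (subst Henstock_Kurzweil_Integration.integral_add[symmetric, OF i i])
       (simp add: inner_diff_left algebra_simps flip: add_divide_distrib diff_divide_distrib)
qed

text \<open>At every fixed \<open>w\<close> the rescaled kernel stays bounded while the density
  tends to \<open>r s\<^sub>0 = 0\<close>. So the concentrated part contributes nothing, from
  whatever direction the sequence comes.\<close>

lemma dipole_lim_zero:
  assumes r: "continuous_on UNIV r" "\<And>s. r (s + 1) = r s" and r0: "r s\<^sub>0 = 0"
  shows "(\<lambda>n. dipole r (x n)) \<longlonglongrightarrow> dipole r (\<gamma> s\<^sub>0)"
proof -
  obtain R where R: "\<And>t. \<bar>r t\<bar> \<le> R" using periodic_bounded[of r, OF r(2,1)] by auto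
  obtain B where B: "B > 0" "\<And>s. norm (\<gamma>' s) \<le> B" using deriv_bounded by blast
  have L: "(\<lambda>n. d n * (r (s n + d n * w) *
        ((x n - \<gamma> (s n)) \<bullet> cross3 (\<gamma> (s n + d n * w)) (\<gamma>' (s n + d n * w))) / (1 - x n \<bullet> \<gamma> (s n + d n * w))))
      \<longlonglongrightarrow> 0" for w
  proof (rule Lim_null_comparison)
    have sl: "(\<lambda>n. s n + d n * w) \<longlonglongrightarrow> s\<^sub>0 + 0 * w" by (intro tendsto_intros s_lim d_lim)
    have "isCont r (s\<^sub>0 + 0 * w)" using r(1) by (simp add: continuous_on_eq_continuous_at)
    from isCont_tendsto_compose[OF this sl] have "(\<lambda>n. r (s n + d n * w)) \<longlonglongrightarrow> 0" using r0 by simp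
    then have "(\<lambda>n. \<bar>r (s n + d n * w)\<bar> * (B / c)) \<longlonglongrightarrow> \<bar>0\<bar> * (B / c)" by (intro tendsto_intros)
    then show "(\<lambda>n. \<bar>r (s n + d n * w)\<bar> * (B / c)) \<longlonglongrightarrow> 0" by simp
    have "(\<lambda>n. \<bar>d n * w\<bar>) \<longlonglongrightarrow> \<bar>0 * w\<bar>" by (intro tendsto_intros d_lim)
    then have "\<forall>\<^sub>F n in sequentially. \<bar>d n * w\<bar> < 1/2" by (rule order_tendstoD) simp
    then show "\<forall>\<^sub>F n in sequentially. norm (d n * (r (s n + d n * w) *
        ((x n - \<gamma> (s n)) \<bullet> cross3 (\<gamma> (s n + d n * w)) (\<gamma>' (s n + d n * w))) / (1 - x n \<bullet> \<gamma> (s n + d n * w))))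
      \<le> \<bar>r (s n + d n * w)\<bar> * (B / c)"
    proof eventually_elim
      case (elim n)
      let ?t = "d n * w" let ?D = "1 - x n \<bullet> \<gamma> (s n + ?t)"
      have t: "\<bar>?t\<bar> \<le> 1/2" using elim by simp
      have "c * (d n)\<^sup>2 \<le> c * ((d n)\<^sup>2 + ?t\<^sup>2)" using c_pos by (intro mult_left_mono) auto
      then have D: "c * (d n)\<^sup>2 \<le> ?D" using separation[OF t, of n] by linarith
      have "\<bar>(x n - \<gamma> (s n)) \<bullet> cross3 (\<gamma> (s n + ?t)) (\<gamma>' (s n + ?t))\<bar>
        \<le> norm (x n - \<gamma> (s n)) * norm (\<gamma> (s n + ?t)) * norm (\<gamma>' (s n + ?t))" by (rule abs_triple_le)
      also have "\<dots> \<le> d n * 1 * B"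
        using x_close[of n] B d_pos[of n] by (intro mult_mono) (auto simp: on_sphere)
      finally have "d n * (\<bar>r (s n + ?t)\<bar> * \<bar>(x n - \<gamma> (s n)) \<bullet> cross3 (\<gamma> (s n + ?t)) (\<gamma>' (s n + ?t))\<bar> / ?D)
        \<le> d n * (\<bar>r (s n + ?t)\<bar> * (d n * B) / (c * (d n)\<^sup>2))"
        using d_pos[of n] c_pos B(1) D by (intro mult_left_mono frac_le) auto
      also have "\<dots> = \<bar>r (s n + ?t)\<bar> * (B / c)" using d_pos[of n] by (simp add: power2_eq_square)
      finally show ?case using denominator_pos[OF t, of n] d_pos[of n] by (simp add: abs_mult)
    qed
  qed
  have "(\<lambda>n. dipole r (x n)) \<longlonglongrightarrow> dipole r (\<gamma> s\<^sub>0) + integral UNIV (\<lambda>w::real. 0)"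
    unfolding dipole_split[OF r] dipole_shift[where r = r, OF r(2), of "\<gamma> s\<^sub>0" s\<^sub>0]
    by (intro tendsto_add regular_part_lim(2)[OF r(1) R] concentrated_part_lim[OF r(1) R L])
  then show ?thesis by simp
qed

text \<open>Divided by \<open>(d n)\<^sup>2\<close>, the denominator is half the squared distance of
  the two rescaled points, which tend to \<open>n\<^sub>0\<close> and
  \<open>w *\<^sub>R \<gamma>' s\<^sub>0\<close>. These are orthogonal, so the limit is
  \<open>(1 + (norm (\<gamma>' s\<^sub>0) * w)\<^sup>2) / 2\<close> and the profile integrates to an
  arctangent.\<close>

lemma dipole_one_lim_normal:
  assumes s: "\<And>n. s n = s\<^sub>0" and z: "(\<lambda>n. (x n - \<gamma> s\<^sub>0) /\<^sub>R d n) \<longlonglongrightarrow> n\<^sub>0"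
    and n: "norm n\<^sub>0 = 1" "n\<^sub>0 \<bullet> \<gamma>' s\<^sub>0 = 0"
  shows "(\<lambda>n. dipole (\<lambda>s. 1) (x n)) \<longlonglongrightarrow>
     dipole (\<lambda>s. 1) (\<gamma> s\<^sub>0) + 2 * pi * (n\<^sub>0 \<bullet> cross3 (\<gamma> s\<^sub>0) (\<gamma>' s\<^sub>0)) / norm (\<gamma>' s\<^sub>0)"
proof -
  let ?v = "norm (\<gamma>' s\<^sub>0)" and ?N = "n\<^sub>0 \<bullet> cross3 (\<gamma> s\<^sub>0) (\<gamma>' s\<^sub>0)"
  have v: "?v > 0" using regular by simp
  have r: "continuous_on UNIV (\<lambda>s::real. 1::real)" "\<And>t::real. \<bar>1::real\<bar> \<le> 1" by auto
  have L: "(\<lambda>n. d n * (1 * ((x n - \<gamma> (s n)) \<bullet> cross3 (\<gamma> (s n + d n * w)) (\<gamma>' (s n + d n * w)))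
      / (1 - x n \<bullet> \<gamma> (s n + d n * w)))) \<longlonglongrightarrow> (2 * ?N) * (1 / (1 + (?v * w)\<^sup>2))" for w
  proof -
    let ?z = "\<lambda>n. (x n - \<gamma> s\<^sub>0) /\<^sub>R d n" and ?y = "\<lambda>n. \<gamma> (s\<^sub>0 + d n * w)"
    have sl: "(\<lambda>n. s\<^sub>0 + d n * w) \<longlonglongrightarrow> s\<^sub>0"
      using tendsto_add[OF tendsto_const tendsto_mult[OF d_lim tendsto_const], of s\<^sub>0 w] by simp
    have num: "(\<lambda>n. ?z n \<bullet> cross3 (?y n) (\<gamma>' (s\<^sub>0 + d n * w))) \<longlonglongrightarrow> ?N"
      by (intro tendsto_intros tendsto_cross3 z sl)
    have q: "(\<lambda>n. (?y n - \<gamma> s\<^sub>0) /\<^sub>R d n) \<longlonglongrightarrow> w *\<^sub>R \<gamma>' s\<^sub>0"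
    proof -
      obtain M where M: "M > 0" "\<And>s h. norm (\<gamma> (s + h) - \<gamma> s - h *\<^sub>R \<gamma>' s) \<le> M * h\<^sup>2"
        using taylor by blast
      have le: "norm ((?y n - \<gamma> s\<^sub>0) /\<^sub>R d n - w *\<^sub>R \<gamma>' s\<^sub>0) \<le> d n * (M * w\<^sup>2)" for n
      proof -
        have "(?y n - \<gamma> s\<^sub>0) /\<^sub>R d n - w *\<^sub>R \<gamma>' s\<^sub>0 = (?y n - \<gamma> s\<^sub>0 - (d n * w) *\<^sub>R \<gamma>' s\<^sub>0) /\<^sub>R d n"
          using d_pos[of n] by (simp add: scaleR_diff_right)
        also have "norm \<dots> \<le> M * (d n * w)\<^sup>2 / d n"
          using M(2)[of s\<^sub>0 "d n * w"] d_pos[of n] by (simp add: divide_inverse_commute mult_left_mono)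
        also have "\<dots> = d n * (M * w\<^sup>2)" using d_pos[of n] by (simp add: power2_eq_square)
        finally show ?thesis .
      qed
      have "(\<lambda>n. d n * (M * w\<^sup>2)) \<longlonglongrightarrow> 0"
        using tendsto_mult[OF d_lim tendsto_const, of "M * w\<^sup>2"] by simp
      from Lim_null_comparison[OF always_eventually[OF allI[OF le]] this]
      show ?thesis by (rule LIM_zero_cancel)
    qed
    have "(\<lambda>n. (norm (?z n - (?y n - \<gamma> s\<^sub>0) /\<^sub>R d n))\<^sup>2 / 2) \<longlonglongrightarrow> (norm (n\<^sub>0 - w *\<^sub>R \<gamma>' s\<^sub>0))\<^sup>2 / 2"
      by (intro tendsto_intros z q) simp
    also have "(norm (n\<^sub>0 - w *\<^sub>R \<gamma>' s\<^sub>0))\<^sup>2 = 1 + (?v * w)\<^sup>2"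
      using n by (simp add: power2_norm_eq_inner inner_diff_left inner_diff_right inner_commute[of "\<gamma>' s\<^sub>0" n\<^sub>0]
          norm_eq_1 power_mult_distrib) (simp add: power2_eq_square)
    also have "(\<lambda>n. (norm (?z n - (?y n - \<gamma> s\<^sub>0) /\<^sub>R d n))\<^sup>2 / 2) = (\<lambda>n. (1 - x n \<bullet> ?y n) / (d n)\<^sup>2)"
    proof
      fix n
      have "?z n - (?y n - \<gamma> s\<^sub>0) /\<^sub>R d n = (x n - ?y n) /\<^sub>R d n"
        by (simp add: scaleR_diff_right[symmetric])
      then have e: "norm (?z n - (?y n - \<gamma> s\<^sub>0) /\<^sub>R d n) = norm (x n - ?y n) / d n"
        using d_pos[of n] by (simp add: divide_inverse_commute)
      show "(norm (?z n - (?y n - \<gamma> s\<^sub>0) /\<^sub>R d n))\<^sup>2 / 2 = (1 - x n \<bullet> ?y n) / (d n)\<^sup>2"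
        unfolding e distance_eq[OF x_sphere] by (simp add: power_divide)
    qed
    finally have den: "(\<lambda>n. (1 - x n \<bullet> ?y n) / (d n)\<^sup>2) \<longlonglongrightarrow> (1 + (?v * w)\<^sup>2) / 2" .
    have pos: "(1 + (?v * w)\<^sup>2) / 2 \<noteq> 0"
      by (metis add_pos_nonneg divide_eq_0_iff less_irrefl zero_le_power2 zero_less_one zero_neq_numeral)
    have "(\<lambda>n. (?z n \<bullet> cross3 (?y n) (\<gamma>' (s\<^sub>0 + d n * w))) / ((1 - x n \<bullet> ?y n) / (d n)\<^sup>2))
        \<longlonglongrightarrow> ?N / ((1 + (?v * w)\<^sup>2) / 2)"
      by (rule tendsto_divide[OF num den pos])
    moreover have "(?z n \<bullet> cross3 (?y n) (\<gamma>' (s\<^sub>0 + d n * w))) / ((1 - x n \<bullet> ?y n) / (d n)\<^sup>2)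
      = d n * (1 * ((x n - \<gamma> (s n)) \<bullet> cross3 (\<gamma> (s n + d n * w)) (\<gamma>' (s n + d n * w)))
      / (1 - x n \<bullet> \<gamma> (s n + d n * w)))" for n
      unfolding s using d_pos[of n] by (simp add: power2_eq_square)
    ultimately show ?thesis by (simp add: mult.commute)
  qed
  have "integral UNIV (\<lambda>w. (2 * ?N) * (1 / (1 + (?v * w)\<^sup>2))) = 2 * ?N * (pi / ?v)"
    by (intro integral_unique has_integral_mult_right has_integral_arctan_kernel v)
  moreover have "(\<lambda>n. dipole (\<lambda>s. 1) (x n)) \<longlonglongrightarrow> dipole (\<lambda>s. 1) (\<gamma> s\<^sub>0)
      + integral UNIV (\<lambda>w. (2 * ?N) * (1 / (1 + (?v * w)\<^sup>2)))"
    unfolding dipole_split[OF r(1) refl] dipole_shift[where r = "\<lambda>s. 1", OF refl, of "\<gamma> s\<^sub>0" s\<^sub>0]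
    by (intro tendsto_add regular_part_lim(2)[OF r] concentrated_part_lim[OF r L])
  ultimately show ?thesis by (simp add: mult_ac)
qed

end


section \<open>The maximum principle\<close>

text \<open>If \<open>l\<close> were positive, \<open>p\<close> would vanish at 0 and be positive
  just to its right, and the mean value theorem would lift \<open>f\<close> above its
  maximum.\<close>

lemma second_derivative_local_max:
  fixes f p :: "real \<Rightarrow> real"
  assumes max: "\<forall>\<^sub>F t in nhds 0. f t \<le> f 0"
    and f: "\<forall>\<^sub>F t in nhds 0. (f has_real_derivative p t) (at t)"
    and p: "(p has_real_derivative l) (at 0)"
  shows "l \<le> 0"
proof (rule ccontr)
  assume "\<not> l \<le> 0"
  then have l: "l > 0" by simp
  obtain e where e: "e > 0" "\<And>t. \<bar>t\<bar> < e \<Longrightarrow> f t \<le> f 0 \<and> (f has_real_derivative p t) (at t)"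
    using eventually_conj[OF max f] unfolding eventually_nhds_metric by (auto simp: dist_real_def)
  have p0: "p 0 = 0"
    by (rule DERIV_local_max[of f "p 0" 0 e]) (use e in auto)
  obtain d where d: "d > 0" "\<And>h. 0 < h \<Longrightarrow> h < d \<Longrightarrow> p 0 < p (0 + h)"
    using DERIV_pos_inc_right[OF p l] by blast
  define h where "h = min d e / 2"
  have h: "0 < h" "h < d" "h < e" using d e by (auto simp: h_def)
  obtain z where z: "0 < z" "z < h" "f h - f 0 = (h - 0) * p z"
    using MVT2[of 0 h f p] h e by force
  have "p z > 0" using d(2)[of z] z h p0 by simp
  then have "f h - f 0 > 0" using z h by simp
  then show False using e(2)[of h] h by simp
qed

lemma frame_orthonormal:
  "norm (e_phi \<phi>) = 1" "norm (e_theta \<phi> \<theta>) = 1"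
  "sph \<phi> \<theta> \<bullet> e_phi \<phi> = 0" "sph \<phi> \<theta> \<bullet> e_theta \<phi> \<theta> = 0"
proof -
  have s: "(cos \<phi>)\<^sup>2 + (sin \<phi>)\<^sup>2 = 1" "(cos \<theta>)\<^sup>2 + (sin \<theta>)\<^sup>2 = 1" by auto
  have "e_phi \<phi> \<bullet> e_phi \<phi> = 1" "e_theta \<phi> \<theta> \<bullet> e_theta \<phi> \<theta> = 1"
    unfolding inner_vec_def sum_3 e_phi_def e_theta_def sph_def vector_3 inner_real_def
    using s by algebra+
  moreover have "sph \<phi> \<theta> \<bullet> e_phi \<phi> = 0"
    by (simp add: inner_vec_def sum_3 e_phi_def sph_def)
  moreover have "sph \<phi> \<theta> \<bullet> e_theta \<phi> \<theta>
      = ((cos \<phi>)\<^sup>2 + (sin \<phi>)\<^sup>2 - 1) * (sin \<theta> * cos \<theta>)"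
    unfolding inner_vec_def sum_3 e_theta_def sph_def vector_3 inner_real_def
    by (simp only: algebra_simps power2_eq_square)
  ultimately show "norm (e_phi \<phi>) = 1" "norm (e_theta \<phi> \<theta>) = 1"
  "sph \<phi> \<theta> \<bullet> e_phi \<phi> = 0" "sph \<phi> \<theta> \<bullet> e_theta \<phi> \<theta> = 0"
    by (simp_all add: norm_eq_1 s)
qed

lemma great_circle_in_sphere:
  assumes "norm x = 1" "norm e = 1" "x \<bullet> e = 0"
  shows "cos t *\<^sub>R x + sin t *\<^sub>R e \<in> sphere 0 1"
proof -
  have "(cos t *\<^sub>R x + sin t *\<^sub>R e) \<bullet> (cos t *\<^sub>R x + sin t *\<^sub>R e) = 1"
    using assms by (simp add: norm_eq_1 inner_add_left inner_add_right inner_commute[of e x] flip: power2_eq_square)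
  then show ?thesis by (simp add: norm_eq_1)
qed

text \<open>The maximum is one along every great circle through \<open>x\<close>, so each second
  derivative \<open>e \<bullet> H x e - G x \<bullet> x\<close> is at most 0; the two directions of
  the frame add up to the Laplacian.\<close>

lemma sphere_laplacian_local_max:
  assumes F: "twice_diff_on U F G H" and x: "x \<in> sphere 0 1" "x \<in> U"
    and max: "\<And>y. y \<in> sphere 0 1 \<inter> U \<Longrightarrow> F y \<le> F x"
  shows "sphere_laplacian G H x \<le> 0"
proof -
  define \<phi> \<theta> where "\<phi> = longitude x" and "\<theta> = colatitude x"
  have xs: "sph \<phi> \<theta> = x" unfolding \<phi>_def \<theta>_def by (rule sph_longitude_colatitude[OF x(1)])
  have *: "e \<bullet> H x e - G x \<bullet> x \<le> 0" if e: "norm e = 1" "x \<bullet> e = 0" for e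
  proof -
    define c where "c t = cos t *\<^sub>R x + sin t *\<^sub>R e" for t
    define c' where "c' t = - sin t *\<^sub>R x + cos t *\<^sub>R e" for t
    have c: "(c has_vector_derivative c' t) (at t)" for t
      unfolding c_def[abs_def] c'_def by (auto intro!: derivative_eq_intros)
    have c2: "(c' has_vector_derivative - x) (at 0)"
      unfolding c'_def[abs_def] by (auto intro!: derivative_eq_intros)
    have c0: "c 0 = x" "c' 0 = e" by (simp_all add: c_def c'_def)
    have "(c \<longlongrightarrow> c 0) (nhds 0)"
      using has_vector_derivative_continuous[OF c[of 0]] by (simp add: continuous_at tendsto_nhds_iff)
    then have U: "\<forall>\<^sub>F t in nhds 0. c t \<in> U"
      by (rule topological_tendstoD) (use F x c0 in \<open>auto simp: twice_diff_on_def\<close>)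
    have s: "c t \<in> sphere 0 1" for t
      unfolding c_def using x(1) e by (intro great_circle_in_sphere) auto
    have "e \<bullet> H x e + G x \<bullet> (- x) \<le> 0"
    proof (rule second_derivative_local_max[of "\<lambda>t. F (c t)" "\<lambda>t. G (c t) \<bullet> c' t"])
      show "\<forall>\<^sub>F t in nhds 0. F (c t) \<le> F (c 0)"
        using U by eventually_elim (use max s c0 in auto)
      show "\<forall>\<^sub>F t in nhds 0. ((\<lambda>t. F (c t)) has_real_derivative G (c t) \<bullet> c' t) (at t)"
        using U by eventually_elim (rule DERIV_along_curve[OF F c])
      show "((\<lambda>t. G (c t) \<bullet> c' t) has_real_derivative e \<bullet> H x e + G x \<bullet> - x) (at 0)"
        using second_DERIV_along_curve[OF F c c2] x(2) by (simp only: c0)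
    qed
    then show ?thesis by simp
  qed
  have "bounded_linear (H x)" using F x has_derivative_bounded_linear by (auto simp: twice_diff_on_def)
  from frame_quadratic_form[OF this, of \<phi> \<theta>] show ?thesis
    using *[OF frame_orthonormal(1), of \<phi>] *[OF frame_orthonormal(2), of \<phi> \<theta>]
      frame_orthonormal(3,4)[of \<phi> \<theta>]
    unfolding xs by (simp add: sphere_laplacian_def inner_commute)
qed

lemma twice_diff_on_combination:
  assumes "twice_diff_on U F1 G1 H1" "twice_diff_on U F2 G2 H2" "twice_diff_on U F3 G3 H3"
  shows "twice_diff_on U (\<lambda>x. F1 x - F2 x + e * F3 x) (\<lambda>x. G1 x - G2 x + e *\<^sub>R G3 x)
    (\<lambda>x h. H1 x h - H2 x h + e *\<^sub>R H3 x h)"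
  using assms unfolding twice_diff_on_def
  by (auto intro!: derivative_eq_intros continuous_intros simp: inner_add_left inner_diff_left)

lemma sphere_laplacian_combination:
  "sphere_laplacian (\<lambda>x. G1 x - G2 x + e *\<^sub>R G3 x) (\<lambda>x h. H1 x h - H2 x h + e *\<^sub>R H3 x h) x
   = sphere_laplacian G1 H1 x - sphere_laplacian G2 H2 x + e * sphere_laplacian G3 H3 x"
  by (simp add: sphere_laplacian_def inner_add_right inner_diff_right sum.distrib sum_subtractf
      sum_distrib_left algebra_simps)

text \<open>Smoothness on \<open>S\<close> gives an extension that agrees with \<open>u\<close> on
  \<open>S\<close> only. Intersecting with the open set \<open>T\<close> that cuts \<open>S\<close>
  out of the sphere turns this into agreement on the whole sphere near \<open>x\<close>.\<close>

lemma smooth_on_sphere_laplacian: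
  assumes u: "smooth_on S u" and x: "x \<in> S" and T: "open T" "S = sphere 0 1 \<inter> T"
  obtains U F G H where "x \<in> U" "U \<subseteq> T" "twice_diff_on U F G H"
    "\<And>y. y \<in> sphere 0 1 \<inter> U \<Longrightarrow> u y = F y" "laplace_beltrami u x = sphere_laplacian G H x"
proof -
  have "\<exists>U F. open U \<and> x \<in> U \<and> (\<forall>k. Ck_on k U F) \<and> (\<forall>y\<in>S \<inter> U. u y = F y)"
    using u[unfolded smooth_on_def] x by (rule bspec)
  then obtain U F where U: "open U" "x \<in> U" "Ck_on 2 U F" "\<And>y. y \<in> S \<inter> U \<Longrightarrow> u y = F y"
    by (elim exE conjE) (erule allE[of _ 2], blast)
  obtain G H where GH: "twice_diff_on U F G H"
    using Ck_on_imp_twice_diff_on[OF U(1,3)] by blast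
  have V: "twice_diff_on (U \<inter> T) F G H"
    by (rule twice_diff_on_subset[OF GH]) (use U T in auto)
  have eq: "u y = F y" if "y \<in> sphere 0 1 \<inter> (U \<inter> T)" for y using U(4) T(2) that by auto
  show ?thesis
    by (rule that[of "U \<inter> T" F G H]) (use x U(2) T V eq laplace_beltrami_eq[OF V eq] in auto)
qed

lemma smooth_on_continuous_on:
  assumes "smooth_on S u" shows "continuous_on S u"
  unfolding continuous_on_def
proof
  fix x assume x: "x \<in> S"
  have "\<exists>U F. open U \<and> x \<in> U \<and> (\<forall>k. Ck_on k U F) \<and> (\<forall>y\<in>S \<inter> U. u y = F y)"
    using assms[unfolded smooth_on_def] x by (rule bspec)
  then obtain U F where U: "open U" "x \<in> U" "Ck_on 0 U F" "\<And>y. y \<in> S \<inter> U \<Longrightarrow> u y = F y"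
    by (elim exE conjE) (erule allE[of _ 0], blast)
  have "(F \<longlongrightarrow> F x) (at x)"
    using U by (simp add: continuous_on_eq_continuous_at continuous_at)
  then have "(F \<longlongrightarrow> F x) (at x within S)" by (rule tendsto_within_subset) simp
  moreover have "\<forall>\<^sub>F y in at x within S. y \<in> S \<inter> U"
    using U(1,2) by (auto simp: eventually_at_topological)
  then have "\<forall>\<^sub>F y in at x within S. F y = u y" by eventually_elim (use U(4) in auto)
  ultimately show "(u \<longlongrightarrow> u x) (at x within S)"
    using Lim_transform_eventually U(4)[of x] U(2) x by simp
qed

text \<open>An interior maximum of \<open>u - v\<close> is no contradiction by itself, since its
  Laplacian 0 is allowed there. A small multiple of the barrier makes the Laplacian positive; as
  \<open>q\<close> lies outside the compact set \<open>S \<union> C\<close>, the barrier is bounded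
  on it.\<close>

lemma solves_dirichlet_le:
  assumes S: "openin (top_of_set (sphere 0 1)) S" "closure S \<subseteq> S \<union> C" "S \<inter> C = {}"
    and C: "compact C" "C \<subseteq> sphere 0 1"
    and q: "q \<in> sphere 0 1" "q \<notin> S" "q \<notin> C"
    and u: "solves_dirichlet S C g u" "solves_dirichlet S C g v"
    and p: "p \<in> S"
  shows "u p \<le> v p"
proof (rule ccontr)
  assume "\<not> u p \<le> v p"
  then have pos: "0 < u p - v p" by simp
  let ?K = "S \<union> C"
  obtain T where T: "open T" "S = sphere 0 1 \<inter> T" using S(1) by (auto simp: openin_open)
  have Ks: "?K \<subseteq> sphere 0 1" using C(2) T by auto
  have "closure ?K \<subseteq> ?K"
    using S(2) by (simp add: closure_Un closure_closed compact_imp_closed[OF C(1)])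
  then have "closed ?K" by (simp only: closure_subset_eq)
  moreover have "bounded ?K" using Ks by (rule bounded_subset[OF bounded_sphere])
  ultimately have K: "compact ?K" by (simp only: compact_eq_bounded_closed)
  \<comment> \<open>Equal boundary values make the extension of \<open>u - v\<close> by 0 continuous
    on a compact set, so the maximum is attained.\<close>
  define w where "w x = (if x \<in> S then u x - v x else 0)" for x
  have w: "continuous_on ?K w"
    unfolding continuous_on_def
  proof
    fix x assume x: "x \<in> ?K"
    have "(w \<longlongrightarrow> w x) (at x within S)"
    proof -
      have "((\<lambda>y. u y - v y) \<longlongrightarrow> w x) (at x within S)"
      proof (cases "x \<in> S")
        case True
        have "continuous_on S u" "continuous_on S v"
          using u smooth_on_continuous_on by (auto simp: solves_dirichlet_def)
        then have "((\<lambda>y. u y - v y) \<longlongrightarrow> u x - v x) (at x within S)"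
          using True by (auto simp: continuous_on_def intro!: tendsto_diff)
        then show ?thesis using True by (simp add: w_def)
      next
        case False
        then have "x \<in> C" using x by simp
        then have "((\<lambda>y. u y - v y) \<longlongrightarrow> g x - g x) (at x within S)"
          using u by (intro tendsto_diff) (auto simp: solves_dirichlet_def)
        then show ?thesis using False by (simp add: w_def)
      qed
      moreover have "\<forall>\<^sub>F y in at x within S. u y - v y = w y"
        by (auto simp: eventually_at_filter w_def)
      ultimately show ?thesis by (rule Lim_transform_eventually)
    qed
    moreover have "(w \<longlongrightarrow> w x) (at x within C)"
    proof (cases "x \<in> C")
      case True
      have "\<forall>\<^sub>F y in at x within C. y \<in> C" by (simp add: eventually_at_filter)
      then have "\<forall>\<^sub>F y in at x within C. 0 = w y"
        by eventually_elim (use S(3) in \<open>auto simp: w_def\<close>)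
      moreover have "w x = 0" using S(3) True by (auto simp: w_def)
      ultimately show ?thesis
        using Lim_transform_eventually[OF tendsto_const, of 0 w "at x within C"] by simp
    next
      case False
      then have "\<not> x islimpt C" using C(1) compact_imp_closed closed_limpt by blast
      then have "at x within C = bot" by (simp add: trivial_limit_within)
      then show ?thesis by simp
    qed
    ultimately show "(w \<longlongrightarrow> w x) (at x within ?K)" by (simp add: Lim_within_Un)
  qed
  \<comment> \<open>The barrier is a logarithmic potential of the curve resting at \<open>q\<close>.
    Density -1 on the unit interval gives total charge -1, hence Laplacian 1.\<close>
  let ?c = "\<lambda>s::real. q" and ?r = "\<lambda>s::real. - 1 :: real"
  have cq: "continuous_on {0..1} ?c" "continuous_on {0..1} ?r" by auto
  have vis: "x \<in> visible ?c" if "x \<in> ?K" for x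
  proof -
    have n: "norm x = 1" "norm q = 1" "x \<noteq> q" using that Ks q by auto
    then have "x \<bullet> q < norm x * norm q"
      using norm_cauchy_schwarz[of x q] norm_cauchy_schwarz_eq[of x q] by (auto simp: less_le)
    then show ?thesis using n by (simp add: visible_def)
  qed
  define \<psi> where "\<psi> = log_pot ?c ?r"
  have \<psi>: "continuous_on ?K \<psi>"
    using Ck_on_log_pot[OF cq, of 0] vis by (auto simp: \<psi>_def intro: continuous_on_subset)
  then have "bounded (\<psi> ` ?K)" using K compact_continuous_image compact_imp_bounded by blast
  then obtain B where B: "B > 0" "\<And>x. x \<in> ?K \<Longrightarrow> \<bar>\<psi> x\<bar> \<le> B"
    unfolding bounded_pos by auto
  \<comment> \<open>The perturbation is at most a quarter of \<open>u p - v p\<close> in size: the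
    perturbed value at \<open>p\<close> is at least \<open>3 * \<epsilon> * B\<close>, on
    \<open>C\<close> at most \<open>\<epsilon> * B\<close>, so the maximum cannot lie on
    \<open>C\<close>.\<close>
  define \<epsilon> where "\<epsilon> = (u p - v p) / (4 * B)"
  have e: "\<epsilon> > 0" "4 * (\<epsilon> * B) = u p - v p" using B pos by (auto simp: \<epsilon>_def)
  have "continuous_on ?K (\<lambda>x. w x + \<epsilon> * \<psi> x)" by (intro continuous_intros w \<psi>)
  then obtain z where z: "z \<in> ?K" "\<And>y. y \<in> ?K \<Longrightarrow> w y + \<epsilon> * \<psi> y \<le> w z + \<epsilon> * \<psi> z"
    using continuous_attains_sup[OF K] p by blast
  have eB: "\<bar>\<epsilon> * \<psi> x\<bar> \<le> \<epsilon> * B" if "x \<in> ?K" for x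
    using B(2)[OF that] e(1) by (simp add: abs_mult)
  have zS: "z \<in> S"
  proof (rule ccontr)
    assume "z \<notin> S"
    then have "w z + \<epsilon> * \<psi> z \<le> \<epsilon> * B" using eB[OF z(1)] by (simp add: w_def)
    moreover have "w p + \<epsilon> * \<psi> p \<ge> 3 * (\<epsilon> * B)" using eB[of p] p e(2) by (simp add: w_def)
    moreover have "\<epsilon> * B > 0" using e(1) B(1) by simp
    ultimately show False using z(2)[of p] p by simp
  qed
  obtain U1 F1 G1 H1 where 1: "z \<in> U1" "U1 \<subseteq> T" "twice_diff_on U1 F1 G1 H1"
    "\<And>y. y \<in> sphere 0 1 \<inter> U1 \<Longrightarrow> u y = F1 y" "laplace_beltrami u z = sphere_laplacian G1 H1 z"
    using smooth_on_sphere_laplacian[OF _ zS T] u by (auto simp: solves_dirichlet_def) metis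
  obtain U2 F2 G2 H2 where 2: "z \<in> U2" "U2 \<subseteq> T" "twice_diff_on U2 F2 G2 H2"
    "\<And>y. y \<in> sphere 0 1 \<inter> U2 \<Longrightarrow> v y = F2 y" "laplace_beltrami v z = sphere_laplacian G2 H2 z"
    using smooth_on_sphere_laplacian[OF _ zS T] u by (auto simp: solves_dirichlet_def) metis
  obtain G3 H3 where 3: "twice_diff_on (visible ?c) \<psi> G3 H3"
    using Ck_on_imp_twice_diff_on[OF open_visible[OF cq(1)] Ck_on_log_pot[OF cq]] unfolding \<psi>_def by blast
  let ?U = "U1 \<inter> U2 \<inter> visible ?c"
  have oU: "open ?U" using 1(3) 2(3) 3 by (auto simp: twice_diff_on_def)
  have zs: "z \<in> sphere 0 1" "z \<in> ?U" using zS T vis 1(1) 2(1) by auto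
  have "sphere_laplacian (\<lambda>x. G1 x - G2 x + \<epsilon> *\<^sub>R G3 x) (\<lambda>x h. H1 x h - H2 x h + \<epsilon> *\<^sub>R H3 x h) z \<le> 0"
  proof (rule sphere_laplacian_local_max[OF _ zs])
    show "twice_diff_on ?U (\<lambda>x. F1 x - F2 x + \<epsilon> * \<psi> x) (\<lambda>x. G1 x - G2 x + \<epsilon> *\<^sub>R G3 x)
        (\<lambda>x h. H1 x h - H2 x h + \<epsilon> *\<^sub>R H3 x h)"
      by (intro twice_diff_on_combination twice_diff_on_subset[OF 1(3) oU] twice_diff_on_subset[OF 2(3) oU]
          twice_diff_on_subset[OF 3 oU]) auto
    have eq: "F1 y - F2 y + \<epsilon> * \<psi> y = w y + \<epsilon> * \<psi> y" "y \<in> ?K" if "y \<in> sphere 0 1 \<inter> ?U" for y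
      using that 1(4)[of y] 2(4)[of y] 1(2) T by (auto simp: w_def)
    show "F1 y - F2 y + \<epsilon> * \<psi> y \<le> F1 z - F2 z + \<epsilon> * \<psi> z" if "y \<in> sphere 0 1 \<inter> ?U" for y
      using eq[OF that] eq(1)[of z] zs z(2) by simp
  qed
  moreover have "sphere_laplacian G3 H3 z = 1"
    using sphere_laplacian_log_pot[OF cq, of z G3 H3] zs q 3 by (simp add: \<psi>_def)
  moreover have "sphere_laplacian G1 H1 z = 0" "sphere_laplacian G2 H2 z = 0"
    using u zS 1(5) 2(5) by (auto simp: solves_dirichlet_def)
  ultimately show False using e(1) unfolding sphere_laplacian_combination by simp
qed

section \<open>Surface gradient and curl of the fundamental solution\<close>

lemma surface_gradient_Ustar:
  assumes x: "norm x = 1" and y: "norm y = 1" and ne: "x \<noteq> y"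
  shows "surface_gradient (Ustar x) y = (1 / (4 * pi * (1 - x \<bullet> y))) *\<^sub>R (x - (x \<bullet> y) *\<^sub>R y)"
    (is "_ = ?D")
proof (rule surface_gradient_eqI)
  have yy: "y \<bullet> y = 1" using y by (simp add: norm_eq_1)
  show "y \<in> sphere 0 1" using y by simp
  show "?D \<bullet> y = 0" by (simp add: inner_diff_left yy)
  have lt: "x \<bullet> y < 1"
    using norm_cauchy_schwarz[of x y] norm_cauchy_schwarz_eq[of x y] x y ne by (auto simp: less_le)
  \<comment> \<open>The extension homogeneous of degree 0 has a tangential gradient on the sphere
    and agrees there with \<open>Ustar x\<close>, where the absolute value may be dropped.\<close>
  define f where "f z = - 1 / (4 * pi) * ln (1 - (x \<bullet> z) * inverse (norm z))" for z
  have y0: "y \<noteq> 0" using y by auto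
  have "((\<lambda>z. inverse (norm z)) has_derivative (\<lambda>h. - (inverse (norm y) * (h \<bullet> sgn y) * inverse (norm y)))) (at y)"
    by (rule Deriv.has_derivative_inverse[OF _ has_derivative_norm[OF y0]]) (use y0 in simp)
  then have "((\<lambda>z. inverse (norm z)) has_derivative (\<lambda>h. - (h \<bullet> sgn y))) (at y)"
    by (simp only: y inverse_1 mult_1_left mult_1_right)
  then have "((\<lambda>z. (x \<bullet> z) * inverse (norm z)) has_derivative
      (\<lambda>h. (x \<bullet> y) * - (h \<bullet> sgn y) + (x \<bullet> h) * inverse (norm y))) (at y)"
    by (intro has_derivative_mult has_derivative_inner_right has_derivative_ident)
  then have "((\<lambda>z. 1 - (x \<bullet> z) * inverse (norm z)) has_derivative
      (\<lambda>h. 0 - ((x \<bullet> y) * - (h \<bullet> sgn y) + (x \<bullet> h) * inverse (norm y)))) (at y)"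
    by (intro has_derivative_diff has_derivative_const)
  then have "((\<lambda>z. ln (1 - (x \<bullet> z) * inverse (norm z))) has_derivative
      (\<lambda>h. (0 - ((x \<bullet> y) * - (h \<bullet> sgn y) + (x \<bullet> h) * inverse (norm y)))
        * inverse (1 - (x \<bullet> y) * inverse (norm y)))) (at y)"
    by (rule has_derivative_ln[rotated]) (simp add: lt y)
  then have "(f has_derivative (\<lambda>h. - 1 / (4 * pi) *
      ((0 - ((x \<bullet> y) * - (h \<bullet> sgn y) + (x \<bullet> h) * inverse (norm y)))
        * inverse (1 - (x \<bullet> y) * inverse (norm y))))) (at y)"
    unfolding f_def[abs_def] by (rule has_derivative_mult_right)
  then have "(f has_derivative (\<lambda>h. - 1 / (4 * pi) * (inverse (1 - x \<bullet> y) *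
      (- ((x \<bullet> y) * - (h \<bullet> sgn y) + x \<bullet> h))))) (at y)"
    by (simp only: y inverse_1 mult_1_right diff_0 mult.commute[of "- _" "inverse _"])
  also have "(\<lambda>h. - 1 / (4 * pi) * (inverse (1 - x \<bullet> y) *
      (- ((x \<bullet> y) * - (h \<bullet> sgn y) + x \<bullet> h)))) = (\<lambda>h. ?D \<bullet> h)"
  proof
    fix h
    have alg: "- 1 / (4 * pi) * (inverse e * (- (c * - Y + X))) = 1 / (4 * pi * e) * (X - c * Y)"
      for e c X Y :: real
      by (cases "e = 0") (simp_all add: field_simps)
    have "h \<bullet> sgn y = y \<bullet> h" using y by (simp add: sgn_div_norm inner_commute)
    then show "- 1 / (4 * pi) * (inverse (1 - x \<bullet> y) * (- ((x \<bullet> y) * - (h \<bullet> sgn y) + x \<bullet> h))) = ?D \<bullet> h"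
      by (simp only: alg inner_scaleR_left inner_diff_left)
  qed
  finally have "(f has_derivative (\<lambda>h. ?D \<bullet> h)) (at y within sphere 0 1)"
    by (rule has_derivative_at_withinI)
  then show "(Ustar x has_derivative (\<lambda>h. ?D \<bullet> h)) (at y within sphere 0 1)"
  proof (rule has_derivative_transform[rotated 2])
    show "Ustar x z = f z" if "z \<in> sphere 0 1" for z
      using that x norm_cauchy_schwarz[of x z] by (simp add: Ustar_def f_def)
  qed (use y in simp)
qed

lemma vector_curl_Ustar:
  assumes "norm x = 1" "norm y = 1" "x \<noteq> y"
  shows "vector_curl (Ustar x) y \<bullet> v = 1 / (4 * pi) * (x \<bullet> cross3 y v) / (1 - x \<bullet> y)"
proof -
  have "cross3 y x \<bullet> v = - (x \<bullet> cross3 y v)" by (simp add: cross3_simps)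
  then show ?thesis
    unfolding vector_curl_def surface_gradient_Ustar[OF assms]
    by (simp add: cross_mult_right Cross3.right_diff_distrib)
qed


section \<open>The jump relation\<close>

context sphere_curve
begin

lemma norm_normal: "norm (cross3 (\<gamma> s) (\<gamma>' s)) = norm (\<gamma>' s)"
proof -
  have "(norm (cross3 (\<gamma> s) (\<gamma>' s)))\<^sup>2 = (norm (\<gamma>' s))\<^sup>2"
    using norm_cross_dot[of "\<gamma> s" "\<gamma>' s"] by (simp add: tangent on_sphere)
  then show ?thesis by (simp add: power2_eq_iff_nonneg)
qed

lemma dipole_one_constant:
  assumes "connected S" "S \<subseteq> sphere 0 1 - range \<gamma>"
  shows "dipole (\<lambda>s. 1) constant_on S"
proof (rule constant_on_sphere_component[OF open_visible[OF continuous_curve] _ assms(1)])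
  show "S \<subseteq> sphere 0 1 \<inter> visible \<gamma>" using assms(2) visible_iff by auto
  show "\<exists>L. (dipole (\<lambda>s. 1) has_derivative L) (at x) \<and> (\<forall>v. v \<bullet> x = 0 \<longrightarrow> L v = 0)"
    if "x \<in> visible \<gamma>" "norm x = 1" for x
    using solid_angle_tangential_derivative[OF deriv continuous_deriv on_sphere _ that] periodic[of 0]
    by (simp add: dipole_def)
qed

text \<open>Numerator and denominator both vanish to second order on the diagonal, uniformly after
  reduction of \<open>s - s\<^sub>0\<close> modulo the period to at most 1/2 in size.\<close>

lemma on_curve_kernel_bounded:
  obtains Q where "Q > 0"
    "\<And>s\<^sub>0 s. \<bar>(\<gamma> s\<^sub>0 \<bullet> cross3 (\<gamma> s) (\<gamma>' s)) / (1 - \<gamma> s\<^sub>0 \<bullet> \<gamma> s)\<bar> \<le> Q"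
proof -
  obtain K where K: "K > 0" "\<And>s h. \<bar>\<gamma> s \<bullet> cross3 (\<gamma> (s + h)) (\<gamma>' (s + h))\<bar> \<le> K * h\<^sup>2"
    using triple_quadratic by blast
  obtain m where m: "m > 0" "\<And>s h. \<bar>h\<bar> \<le> 1/2 \<Longrightarrow> m * \<bar>h\<bar> \<le> norm (\<gamma> (s + h) - \<gamma> s)"
    using bilipschitz by blast
  have "\<bar>(\<gamma> s\<^sub>0 \<bullet> cross3 (\<gamma> s) (\<gamma>' s)) / (1 - \<gamma> s\<^sub>0 \<bullet> \<gamma> s)\<bar> \<le> 2 * K / m\<^sup>2" for s\<^sub>0 s
  proof -
    define k where "k = \<lfloor>s - s\<^sub>0 + 1/2\<rfloor>"
    define h where "h = s - s\<^sub>0 - of_int k"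
    have h: "\<bar>h\<bar> \<le> 1/2" unfolding h_def k_def by linarith
    have s: "\<gamma> s = \<gamma> (s\<^sub>0 + h)" "\<gamma>' s = \<gamma>' (s\<^sub>0 + h)"
      using periodic_of_int[where f = \<gamma>, OF periodic, of "s\<^sub>0 + h" k]
        periodic_of_int[where f = \<gamma>', OF periodic_deriv, of "s\<^sub>0 + h" k] by (simp_all add: h_def)
    show ?thesis
    proof (cases "h = 0")
      case True
      then show ?thesis using s K m by (simp add: dot_cross_self)
    next
      case False
      have "(m * \<bar>h\<bar>)\<^sup>2 \<le> (norm (\<gamma> (s\<^sub>0 + h) - \<gamma> s\<^sub>0))\<^sup>2" using m(2)[OF h] m(1) by (intro power_mono) auto
      then have D: "m\<^sup>2 * h\<^sup>2 / 2 \<le> 1 - \<gamma> s\<^sub>0 \<bullet> \<gamma> s"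
        unfolding s distance_eq[OF on_sphere] by (simp add: power_mult_distrib norm_minus_commute)
      have pos: "0 < m\<^sup>2 * h\<^sup>2 / 2" using m(1) False by simp
      have "\<bar>\<gamma> s\<^sub>0 \<bullet> cross3 (\<gamma> s) (\<gamma>' s)\<bar> / (1 - \<gamma> s\<^sub>0 \<bullet> \<gamma> s) \<le> K * h\<^sup>2 / (m\<^sup>2 * h\<^sup>2 / 2)"
        using K D pos unfolding s by (intro frac_le) auto
      also have "\<dots> = 2 * K / m\<^sup>2" using False by simp
      finally show ?thesis using D pos by (simp add: abs_divide)
    qed
  qed
  with K m show ?thesis by (intro that[of "2 * K / m\<^sup>2"]) auto
qed

text \<open>Because the kernel on the curve is bounded, dominated convergence removes the cutoff:
  the principal value is an ordinary integral, which is \<open>dipole\<close> at the point of the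
  curve.\<close>

lemma cutoff_dipole_lim:
  fixes s\<^sub>0 :: real
  assumes r: "continuous_on {0..1} r" and e: "\<And>n. \<epsilon> n > 0" "\<epsilon> \<longlonglongrightarrow> 0"
  defines "k \<equiv> \<lambda>s. r s * (\<gamma> s\<^sub>0 \<bullet> cross3 (\<gamma> s) (\<gamma>' s)) / (1 - \<gamma> s\<^sub>0 \<bullet> \<gamma> s)"
  shows "k integrable_on {0..1}"
    and "(\<lambda>n. integral {0..1} (\<lambda>s. if \<epsilon> n \<le> norm (\<gamma> s - \<gamma> s\<^sub>0) then k s else 0)) \<longlonglongrightarrow> dipole r (\<gamma> s\<^sub>0)"
proof -
  let ?f = "\<lambda>n s. if \<epsilon> n \<le> norm (\<gamma> s - \<gamma> s\<^sub>0) then k s else 0"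
  obtain Q where Q: "Q > 0"
    "\<And>s\<^sub>0 s. \<bar>(\<gamma> s\<^sub>0 \<bullet> cross3 (\<gamma> s) (\<gamma>' s)) / (1 - \<gamma> s\<^sub>0 \<bullet> \<gamma> s)\<bar> \<le> Q"
    using on_curve_kernel_bounded by blast
  have "compact (r ` {0..1})" using r by (intro compact_continuous_image) auto
  then obtain R where R: "R > 0" "\<And>s. s \<in> {0..1} \<Longrightarrow> \<bar>r s\<bar> \<le> R"
    using compact_imp_bounded bounded_pos by (metis imageI real_norm_def)
  have nz: "1 - \<gamma> s\<^sub>0 \<bullet> \<gamma> s \<noteq> 0" if "\<epsilon> n \<le> norm (\<gamma> s - \<gamma> s\<^sub>0)" for s n
    using distance_eq[OF on_sphere[of s\<^sub>0], of s] that e(1)[of n] by auto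
  have fi: "?f n integrable_on {0..1}" for n
  proof -
    \<comment> \<open>The cutoff integrand jumps at the edge of the excluded part, but it is a
      continuous function restricted to a compact set, hence integrable.\<close>
    let ?K = "{0..1} \<inter> {s. \<epsilon> n \<le> norm (\<gamma> s - \<gamma> s\<^sub>0)}"
    have "closed {s. \<epsilon> n \<le> norm (\<gamma> s - \<gamma> s\<^sub>0)}"
      by (intro closed_Collect_le continuous_intros continuous_curve)
    then have "compact ?K" by (intro compact_Int_closed) auto
    moreover have "continuous_on ?K k"
      unfolding k_def
      by (intro continuous_intros continuous_on_cross continuous_curve continuous_deriv continuous_on_subset[OF r])
         (use nz[of n] in auto)
    ultimately have "integrable lborel (\<lambda>s. indicator ?K s *\<^sub>R k s)" by (rule borel_integrable_compact)
    then have "(\<lambda>s. indicator ?K s *\<^sub>R k s) integrable_on UNIV" by (rule integrable_on_lborel)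
    then have "(\<lambda>s. indicator ?K s *\<^sub>R k s) integrable_on {0..1}" by (rule integrable_on_subinterval) simp
    then show ?thesis
      by (rule integrable_spike_finite[of "{}", rotated 2]) (auto simp: indicator_def)
  qed
  have le: "norm (?f n s) \<le> R * Q" if "s \<in> {0..1}" for n s
  proof -
    have "\<bar>k s\<bar> = \<bar>r s\<bar> * \<bar>(\<gamma> s\<^sub>0 \<bullet> cross3 (\<gamma> s) (\<gamma>' s)) / (1 - \<gamma> s\<^sub>0 \<bullet> \<gamma> s)\<bar>"
      by (simp add: k_def abs_mult)
    also have "\<dots> \<le> R * Q" using R(1) R(2)[OF that] Q by (intro mult_mono) auto
    finally show ?thesis using R(1) Q(1) by auto
  qed
  have lim: "(\<lambda>n. ?f n s) \<longlonglongrightarrow> k s" if "s \<in> {0..1}" for s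
  proof (cases "\<gamma> s = \<gamma> s\<^sub>0")
    case True
    \<comment> \<open>At parameters of the singular point itself the cutoff value and
      \<open>k s\<close> are both 0.\<close>
    then have "?f n s = k s" for n using e(1)[of n] by (simp add: k_def dot_cross_self)
    then show ?thesis by simp
  next
    case False
    then have "\<forall>\<^sub>F n in sequentially. \<epsilon> n < norm (\<gamma> s - \<gamma> s\<^sub>0)"
      by (intro order_tendstoD(2)[OF e(2)]) simp
    then have "\<forall>\<^sub>F n in sequentially. k s = ?f n s" by eventually_elim simp
    then show ?thesis by (rule Lim_transform_eventually[OF tendsto_const])
  qed
  have "(\<lambda>s. R * Q) integrable_on {0..1::real}" by (rule integrable_const_ivl)
  note dc = dominated_convergence[of ?f "{0..1}" "\<lambda>s. R * Q" k, OF fi this le lim]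
  show "k integrable_on {0..1}" using dc(1) by blast
  show "(\<lambda>n. integral {0..1} (?f n)) \<longlonglongrightarrow> dipole r (\<gamma> s\<^sub>0)"
    using dc(2) unfolding dipole_eq k_def by blast
qed

lemma dipole_diff_on_curve:
  assumes "continuous_on {0..1} r" "continuous_on {0..1} q"
  shows "dipole (\<lambda>s. r s - q s) (\<gamma> s\<^sub>0) = dipole r (\<gamma> s\<^sub>0) - dipole q (\<gamma> s\<^sub>0)"
proof -
  \<comment> \<open>Integrability on the curve was obtained together with the limit of the cutoff
    integrals; some null sequence of cutoffs has to be supplied.\<close>
  note i = cutoff_dipole_lim(1)[OF _ _ LIMSEQ_inverse_real_of_nat]
  have "integral {0..1} (\<lambda>s. r s * (\<gamma> s\<^sub>0 \<bullet> cross3 (\<gamma> s) (\<gamma>' s)) / (1 - \<gamma> s\<^sub>0 \<bullet> \<gamma> s)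
      - q s * (\<gamma> s\<^sub>0 \<bullet> cross3 (\<gamma> s) (\<gamma>' s)) / (1 - \<gamma> s\<^sub>0 \<bullet> \<gamma> s)) = dipole r (\<gamma> s\<^sub>0) - dipole q (\<gamma> s\<^sub>0)"
    unfolding dipole_eq
    by (rule Henstock_Kurzweil_Integration.integral_diff; rule i; use assms in simp)
  then show ?thesis unfolding dipole_eq by (simp only: left_diff_distrib diff_divide_distrib)
qed

text \<open>The jump across the curve is only computed for the constant density, along a normal.
  As the potential of the constant density is constant on \<open>S\<close>, this determines its limit
  along every sequence in \<open>S\<close>, and no description of \<open>S\<close> near the curve is required.\<close>

lemma dipole_jump:
  assumes S: "connected S" "S \<subseteq> sphere 0 1 - range \<gamma>" and \<kappa>: "\<kappa>\<^sup>2 = 1"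
    and left: "\<forall>\<^sub>F \<epsilon> in at_right 0. cos \<epsilon> *\<^sub>R \<gamma> s\<^sub>0
        + sin \<epsilon> *\<^sub>R ((\<kappa> / norm (\<gamma>' s\<^sub>0)) *\<^sub>R cross3 (\<gamma> s\<^sub>0) (\<gamma>' s\<^sub>0)) \<in> S"
    and r: "continuous_on UNIV r" "\<And>s. r (s + 1) = r s"
    and x: "\<And>n. x n \<in> S" "x \<longlonglongrightarrow> \<gamma> s\<^sub>0"
  shows "(\<lambda>n. dipole r (x n)) \<longlonglongrightarrow> dipole r (\<gamma> s\<^sub>0) + 2 * pi * \<kappa> * r s\<^sub>0"
proof -
  define n\<^sub>0 where "n\<^sub>0 = (\<kappa> / norm (\<gamma>' s\<^sub>0)) *\<^sub>R cross3 (\<gamma> s\<^sub>0) (\<gamma>' s\<^sub>0)"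
  have v: "norm (\<gamma>' s\<^sub>0) > 0" using regular by simp
  have k: "\<bar>\<kappa>\<bar> = 1" using \<kappa> by (auto simp: power2_eq_1_iff)
  have n: "norm n\<^sub>0 = 1" "n\<^sub>0 \<bullet> \<gamma> s\<^sub>0 = 0" "n\<^sub>0 \<bullet> \<gamma>' s\<^sub>0 = 0"
    using v k by (simp_all add: n\<^sub>0_def norm_normal dot_cross_self)
  have N: "n\<^sub>0 \<bullet> cross3 (\<gamma> s\<^sub>0) (\<gamma>' s\<^sub>0) = \<kappa> * norm (\<gamma>' s\<^sub>0)"
    using v by (simp add: n\<^sub>0_def norm_normal power2_eq_square flip: power2_norm_eq_inner)
  have vis: "y \<in> visible \<gamma>" if "y \<in> S" for y using that S(2) visible_iff by auto
  obtain w where w: "\<And>y. y \<in> S \<Longrightarrow> dipole (\<lambda>s. 1) y = w"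
    using dipole_one_constant[OF S] by (auto simp: constant_on_def)
  have w_eq: "w = dipole (\<lambda>s. 1) (\<gamma> s\<^sub>0) + 2 * pi * \<kappa>"
  proof -
    obtain b\<^sub>1 where b1: "b\<^sub>1 > 0" "\<And>\<epsilon>. 0 < \<epsilon> \<Longrightarrow> \<epsilon> < b\<^sub>1 \<Longrightarrow> cos \<epsilon> *\<^sub>R \<gamma> s\<^sub>0 + sin \<epsilon> *\<^sub>R n\<^sub>0 \<in> S"
      using left unfolding n\<^sub>0_def[symmetric] eventually_at_right_field by blast
    obtain b\<^sub>2 c where b2: "b\<^sub>2 > 0" "\<And>\<epsilon>. (\<forall>n. 0 < \<epsilon> n \<and> \<epsilon> n < b\<^sub>2) \<and> \<epsilon> \<longlonglongrightarrow> 0 \<Longrightarrow>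
      curve_approach \<gamma> \<gamma>' \<gamma>'' s\<^sub>0 (\<lambda>_. s\<^sub>0) \<epsilon> (\<lambda>n. cos (\<epsilon> n) *\<^sub>R \<gamma> s\<^sub>0 + sin (\<epsilon> n) *\<^sub>R n\<^sub>0) c"
      using normal_approach[OF n] by blast
    \<comment> \<open>\<open>Suc (Suc n)\<close> keeps the factor strictly below 1, so every angle
      is admissible for both bounds.\<close>
    define \<epsilon> where "\<epsilon> n = min b\<^sub>1 b\<^sub>2 * inverse (real (Suc (Suc n)))" for n
    have e: "0 < \<epsilon> n" "\<epsilon> n < min b\<^sub>1 b\<^sub>2" for n
    proof -
      have "inverse (real (Suc (Suc n))) < 1" by (simp add: field_simps)
      then have "min b\<^sub>1 b\<^sub>2 * inverse (real (Suc (Suc n))) < min b\<^sub>1 b\<^sub>2 * 1"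
        using b1(1) b2(1) by (intro mult_strict_left_mono) auto
      then show "0 < \<epsilon> n" "\<epsilon> n < min b\<^sub>1 b\<^sub>2" using b1(1) b2(1) by (simp_all add: \<epsilon>_def)
    qed
    have e0: "\<epsilon> \<longlonglongrightarrow> 0"
    proof -
      have "(\<lambda>n. min b\<^sub>1 b\<^sub>2 * inverse (real (Suc (Suc n)))) \<longlonglongrightarrow> min b\<^sub>1 b\<^sub>2 * 0"
        by (intro tendsto_mult tendsto_const LIMSEQ_Suc[OF LIMSEQ_inverse_real_of_nat])
      then show ?thesis by (simp add: \<epsilon>_def[abs_def])
    qed
    let ?x = "\<lambda>n. cos (\<epsilon> n) *\<^sub>R \<gamma> s\<^sub>0 + sin (\<epsilon> n) *\<^sub>R n\<^sub>0"
    interpret A: curve_approach \<gamma> \<gamma>' \<gamma>'' s\<^sub>0 "\<lambda>_. s\<^sub>0" \<epsilon> ?x c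
      by (rule b2(2)) (use e e0 in auto)
    have e_at: "filterlim \<epsilon> (at 0) sequentially"
      using e0 e(1) by (intro filterlim_atI) (auto simp: less_le intro!: always_eventually)
    \<comment> \<open>The derivatives of cosine and sine at 0 show that the rescaled offset from the
      curve tends to the normal.\<close>
    have "((\<lambda>h. (cos (0 + h) - cos 0) / h) \<longlongrightarrow> - sin 0) (at (0::real))"
      "((\<lambda>h. (sin (0 + h) - sin 0) / h) \<longlongrightarrow> cos 0) (at (0::real))"
      using DERIV_cos[of 0] DERIV_sin[of 0] by (simp_all only: DERIV_def)
    from this[THEN filterlim_compose, OF e_at]
    have "(\<lambda>n. ((cos (\<epsilon> n) - 1) / \<epsilon> n) *\<^sub>R \<gamma> s\<^sub>0 + (sin (\<epsilon> n) / \<epsilon> n) *\<^sub>R n\<^sub>0) \<longlonglongrightarrow> 0 *\<^sub>R \<gamma> s\<^sub>0 + 1 *\<^sub>R n\<^sub>0"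
      by (intro tendsto_add tendsto_scaleR tendsto_const) simp_all
    moreover have "((cos (\<epsilon> n) - 1) / \<epsilon> n) *\<^sub>R \<gamma> s\<^sub>0 + (sin (\<epsilon> n) / \<epsilon> n) *\<^sub>R n\<^sub>0 = (?x n - \<gamma> s\<^sub>0) /\<^sub>R \<epsilon> n" for n
      by (simp add: algebra_simps divide_inverse)
    ultimately have "(\<lambda>n. (?x n - \<gamma> s\<^sub>0) /\<^sub>R \<epsilon> n) \<longlonglongrightarrow> n\<^sub>0" by simp
    from A.dipole_one_lim_normal[OF refl this n(1,3)]
    have "(\<lambda>n. dipole (\<lambda>s. 1) (?x n)) \<longlonglongrightarrow> dipole (\<lambda>s. 1) (\<gamma> s\<^sub>0) + 2 * pi * \<kappa>"
      using v by (simp add: N mult.assoc)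
    moreover have "dipole (\<lambda>s. 1) (?x n) = w" for n
      by (rule w) (use b1(2) e in auto)
    ultimately show ?thesis by (simp add: LIMSEQ_const_iff)
  qed
  \<comment> \<open>The density is split into its value at \<open>s\<^sub>0\<close> and a remainder
    vanishing there. The remainder passes to the limit without a jump, and the constant part has
    potential \<open>r s\<^sub>0 * w\<close> all over \<open>S\<close>.\<close>
  let ?q = "\<lambda>s. r s - r s\<^sub>0"
  have rc: "continuous_on A r" for A using r(1) continuous_on_subset by blast
  have xS: "norm (x n) = 1" "x n \<notin> range \<gamma>" for n using x(1)[of n] S(2) by auto
  have "\<exists>s d c. curve_approach \<gamma> \<gamma>' \<gamma>'' s\<^sub>0 s d x c"
    by (rule nearest_approach[OF xS x(2)])
  then obtain s d c where "curve_approach \<gamma> \<gamma>' \<gamma>'' s\<^sub>0 s d x c" by blast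
  then interpret A: curve_approach \<gamma> \<gamma>' \<gamma>'' s\<^sub>0 s d x c .
  have q: "(\<lambda>n. dipole ?q (x n)) \<longlonglongrightarrow> dipole ?q (\<gamma> s\<^sub>0)"
    by (rule A.dipole_lim_zero) (use r rc in \<open>auto intro!: continuous_intros\<close>)
  have one: "dipole (\<lambda>s. r s\<^sub>0) y = r s\<^sub>0 * dipole (\<lambda>s. 1) y" for y
    using dipole_cmult[of "r s\<^sub>0" "\<lambda>s. 1" y] by simp
  have "dipole ?q (x n) = dipole r (x n) - r s\<^sub>0 * w" for n
    using dipole_diff[OF rc continuous_on_const vis[OF x(1)], of "r s\<^sub>0" n] one w[OF x(1)] by simp
  moreover have "dipole ?q (\<gamma> s\<^sub>0) = dipole r (\<gamma> s\<^sub>0) - r s\<^sub>0 * dipole (\<lambda>s. 1) (\<gamma> s\<^sub>0)"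
    unfolding one[symmetric]
    by (rule dipole_diff_on_curve) (use r rc in auto)
  ultimately have "(\<lambda>n. dipole r (x n) - r s\<^sub>0 * w + r s\<^sub>0 * w) \<longlonglongrightarrow>
      dipole r (\<gamma> s\<^sub>0) - r s\<^sub>0 * dipole (\<lambda>s. 1) (\<gamma> s\<^sub>0) + r s\<^sub>0 * w"
    using q by (intro tendsto_add tendsto_const) simp
  then show ?thesis by (simp add: w_eq algebra_simps)
qed

end


section \<open>The layer potentials and the Dirichlet problem\<close>

lemma C2_simple_closed_curve_sphere_curve:
  assumes \<gamma>: "C2_simple_closed_curve \<gamma>" and s: "path_image \<gamma> \<subseteq> sphere 0 1"
  obtains \<gamma>'' where "sphere_curve \<gamma> (\<lambda>s. vector_derivative \<gamma> (at s)) \<gamma>''"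
proof -
  have p: "\<gamma> (s + 1) = \<gamma> s" for s using \<gamma> by (simp add: C2_simple_closed_curve_def)
  have fr: "frac s \<in> {0..<1}" "\<gamma> (frac s) = \<gamma> s" for s
    using frac_lt_1[of s] periodic_frac[where f = \<gamma>, OF p] by simp_all
  obtain \<gamma>'' where \<gamma>'': "\<And>s. ((\<lambda>s. vector_derivative \<gamma> (at s)) has_vector_derivative \<gamma>'' s) (at s)"
    "continuous_on UNIV \<gamma>''"
    using \<gamma> unfolding C2_simple_closed_curve_def C1_differentiable_on_def by blast
  show ?thesis
  proof (rule that[of \<gamma>''], unfold_locales)
    show "\<gamma> (s + 1) = \<gamma> s" for s by (rule p)
    show "(\<gamma> has_vector_derivative vector_derivative \<gamma> (at s)) (at s)" for s
      using \<gamma> unfolding C2_simple_closed_curve_def C1_differentiable_on_def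
      by (metis UNIV_I vector_derivative_at)
    show "((\<lambda>s. vector_derivative \<gamma> (at s)) has_vector_derivative \<gamma>'' s) (at s)" for s by (rule \<gamma>'')
    show "continuous_on UNIV \<gamma>''" by (rule \<gamma>'')
    show "norm (\<gamma> s) = 1" for s
    proof -
      have "\<gamma> (frac s) \<in> path_image \<gamma>" unfolding path_image_def by (rule imageI) (use fr(1)[of s] in auto)
      then show ?thesis using s fr(2)[of s] by auto
    qed
    show "vector_derivative \<gamma> (at s) \<noteq> 0" for s using \<gamma> by (simp add: C2_simple_closed_curve_def)
    show "\<exists>k. s - s' = of_int k" if "\<gamma> s = \<gamma> s'" for s s'
    proof -
      \<comment> \<open>\<open>loop_free\<close> speaks of \<open>{0..1}\<close> and exempts the end
        points; fractional parts never equal 1, so that exception cannot occur.\<close>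
      have "loop_free \<gamma>" using \<gamma> by (simp add: C2_simple_closed_curve_def simple_path_def)
      moreover have "frac s \<in> {0..1}" "frac s' \<in> {0..1}" "\<gamma> (frac s) = \<gamma> (frac s')"
        using that fr[of s] fr[of s'] by auto
      ultimately have "frac s = frac s' \<or> frac s = 0 \<and> frac s' = 1 \<or> frac s = 1 \<and> frac s' = 0"
        unfolding loop_free_def by blast
      then have "frac s = frac s'" using frac_lt_1[of s] frac_lt_1[of s'] by auto
      then have "s - s' = of_int (\<lfloor>s\<rfloor> - \<lfloor>s'\<rfloor>)" by (simp add: frac_def)
      then show ?thesis by blast
    qed
  qed
qed

lemma tendsto_within_sequentially:
  assumes "\<And>X. (\<And>n. X n \<in> S) \<Longrightarrow> X \<longlonglongrightarrow> a \<Longrightarrow> (\<lambda>n. f (X n)) \<longlonglongrightarrow> l"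
  shows "(f \<longlongrightarrow> l) (at (a::'a::first_countable_topology) within S)"
  unfolding tendsto_at_iff_sequentially using assms by (auto simp: o_def)

text \<open>The layer potentials are tied to the sphere (an absolute value, a surface gradient).
  Everything is therefore checked on one function \<open>F\<close> that is smooth in an open set of
  space and agrees with \<open>u\<close> on the sphere.\<close>

lemma solves_dirichletI:
  assumes V: "open V" "S \<subseteq> sphere 0 1 \<inter> V" and F: "\<And>k. Ck_on k V F"
    and u: "\<And>y. y \<in> sphere 0 1 \<inter> V \<Longrightarrow> u y = F y"
    and harmonic: "\<And>G H x. twice_diff_on V F G H \<Longrightarrow> x \<in> V \<Longrightarrow> sphere_laplacian G H x = 0"
    and lim: "\<And>a X. a \<in> C \<Longrightarrow> (\<And>n. X n \<in> S) \<Longrightarrow> X \<longlonglongrightarrow> a \<Longrightarrow> (\<lambda>n. F (X n)) \<longlonglongrightarrow> g a"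
  shows "solves_dirichlet S C g u"
  unfolding solves_dirichlet_def
proof (intro conjI ballI)
  have uS: "u x = F x" if "x \<in> S" for x using u V(2) that by blast
  show "smooth_on S u"
    unfolding smooth_on_def
  proof
    fix x assume "x \<in> S"
    then show "\<exists>U F. open U \<and> x \<in> U \<and> (\<forall>k. Ck_on k U F) \<and> (\<forall>y\<in>S \<inter> U. u y = F y)"
      using V F uS by (intro exI[of _ V] exI[of _ F]) blast
  qed
  show "- laplace_beltrami u x = 0" if "x \<in> S" for x
  proof -
    have x: "x \<in> sphere 0 1" "x \<in> V" using V(2) that by auto
    obtain G H where GH: "twice_diff_on V F G H" using Ck_on_imp_twice_diff_on[OF V(1) F] by blast
    show ?thesis using laplace_beltrami_eq[OF GH u x] harmonic[OF GH x(2)] by simp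
  qed
  show "(u \<longlongrightarrow> g a) (at a within S)" if "a \<in> C" for a
  proof (rule tendsto_within_sequentially)
    fix X assume X: "\<And>n. X n \<in> S" "X \<longlonglongrightarrow> a"
    show "(\<lambda>n. u (X n)) \<longlonglongrightarrow> g a" using lim[OF that X] by (simp add: uS[OF X(1)])
  qed
qed

context sphere_curve
begin

lemma arc_integral_eq: "arc_integral \<gamma> f = integral {0..1} (\<lambda>s. f (\<gamma> s) * norm (\<gamma>' s))"
  by (simp add: arc_integral_def vector_derivative_at[OF deriv])

text \<open>A unit vector on the tangent line is plus or minus the normalized velocity, and a
  continuous sign on an interval is constant. \<open>\<kappa>\<close> records whether
  \<open>t\<close> runs with or against the parametrization.\<close>

lemma unit_tangent_field_sign:
  assumes "unit_tangent_field \<gamma> t"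
  obtains \<kappa> where "\<kappa>\<^sup>2 = 1" "\<And>s. s \<in> {0..1} \<Longrightarrow> t (\<gamma> s) = (\<kappa> / norm (\<gamma>' s)) *\<^sub>R \<gamma>' s"
proof -
  define f where "f s = t (\<gamma> s) \<bullet> \<gamma>' s / norm (\<gamma>' s)" for s
  have t: "norm (t (\<gamma> s)) = 1" "t (\<gamma> s) \<in> span {\<gamma>' s}" if "s \<in> {0..1}" for s
    using assms that by (auto simp: unit_tangent_field_def vector_derivative_at[OF deriv])
  have f: "(f s)\<^sup>2 = 1 \<and> t (\<gamma> s) = (f s / norm (\<gamma>' s)) *\<^sub>R \<gamma>' s" if s: "s \<in> {0..1}" for s
  proof -
    have v: "norm (\<gamma>' s) > 0" using regular by simp
    obtain k where k: "t (\<gamma> s) = k *\<^sub>R \<gamma>' s" using t(2)[OF s] by (auto simp: span_singleton)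
    have fk: "f s = k * norm (\<gamma>' s)"
      using v by (simp add: f_def k power2_eq_square flip: power2_norm_eq_inner)
    have "\<bar>k\<bar> * norm (\<gamma>' s) = 1" using t(1)[OF s] by (simp add: k)
    then have "\<bar>f s\<bar> = 1" by (simp add: fk abs_mult)
    then show ?thesis using v k fk by (simp add: power2_eq_1_iff abs_if split: if_splits)
  qed
  have "continuous_on {0..1} (\<lambda>s. t (\<gamma> s))"
    by (rule continuous_on_compose2[OF _ continuous_curve, of "path_image \<gamma>"])
       (use assms in \<open>auto simp: unit_tangent_field_def path_image_def\<close>)
  then have "continuous_on {0..1} f"
    unfolding f_def[abs_def] by (intro continuous_intros continuous_deriv) (use regular in auto)
  moreover have "f s \<in> {1, -1}" if "s \<in> {0..1}" for s
    using f[OF that] by (simp add: power2_eq_1_iff)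
  then have "f ` {0..1} \<subseteq> {1, -1}" by blast
  then have "finite (f ` {0..1})" by (rule finite_subset) simp
  ultimately have "f constant_on {0..1}"
    by (intro continuous_finite_range_constant) (auto simp: connected_Icc)
  then obtain \<kappa> where "\<And>s. s \<in> {0..1} \<Longrightarrow> f s = \<kappa>" by (auto simp: constant_on_def)
  then show ?thesis using f f[of 0] by (intro that[of \<kappa>]) auto
qed

text \<open>This holds on the curve too, so it identifies the potential and the boundary operator
  with one function.\<close>

lemma single_layer_eq:
  assumes "norm x = 1"
  shows "single_layer \<gamma> \<sigma> x = log_pot \<gamma> (\<lambda>s. - 1 / (4 * pi) * (\<sigma> (\<gamma> s) * norm (\<gamma>' s))) x"
proof -
  have "\<bar>1 - x \<bullet> \<gamma> s\<bar> = 1 - x \<bullet> \<gamma> s" for s unfolding distance_eq[OF assms] by simp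
  then show ?thesis
    by (simp add: single_layer_def arc_integral_eq log_pot_def Ustar_def mult_ac)
qed

context
  fixes t :: "real^3 \<Rightarrow> real^3" and \<kappa> :: real
  assumes t: "\<And>s. s \<in> {0..1} \<Longrightarrow> t (\<gamma> s) = (\<kappa> / norm (\<gamma>' s)) *\<^sub>R \<gamma>' s"
begin

lemma double_layer_integrand:
  assumes "norm x = 1" "s \<in> {0..1}" "x \<noteq> \<gamma> s"
  shows "\<mu> (\<gamma> s) * (vector_curl (Ustar x) (\<gamma> s) \<bullet> t (\<gamma> s)) * norm (\<gamma>' s)
    = \<kappa> / (4 * pi) * \<mu> (\<gamma> s) * (x \<bullet> cross3 (\<gamma> s) (\<gamma>' s)) / (1 - x \<bullet> \<gamma> s)"
  using regular[of s]
  by (simp add: vector_curl_Ustar[OF assms(1) on_sphere assms(3)] t[OF assms(2)] cross_mult_right)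

lemma double_layer_eq:
  assumes "norm x = 1" "x \<notin> range \<gamma>"
  shows "double_layer \<gamma> t \<mu> x = dipole (\<lambda>s. \<kappa> / (4 * pi) * \<mu> (\<gamma> s)) x"
  unfolding double_layer_def arc_integral_eq dipole_eq
proof (rule integral_cong)
  fix s :: real assume s: "s \<in> {0..1}"
  have "x \<noteq> \<gamma> s" using assms(2) by blast
  from double_layer_integrand[OF assms(1) s this]
  show "\<mu> (\<gamma> s) * (vector_curl (Ustar x) (\<gamma> s) \<bullet> t (\<gamma> s)) * norm (\<gamma>' s)
    = \<kappa> / (4 * pi) * \<mu> (\<gamma> s) * (x \<bullet> cross3 (\<gamma> s) (\<gamma>' s)) / (1 - x \<bullet> \<gamma> s)" .
qed

lemma double_layer_boundary_eq:
  assumes "continuous_on (range \<gamma>) \<mu>"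
  shows "double_layer_boundary \<gamma> t \<mu> (\<gamma> s\<^sub>0) = dipole (\<lambda>s. \<kappa> / (4 * pi) * \<mu> (\<gamma> s)) (\<gamma> s\<^sub>0)"
proof -
  let ?r = "\<lambda>s. \<kappa> / (4 * pi) * \<mu> (\<gamma> s)"
  have r: "continuous_on {0..1} ?r"
    by (intro continuous_intros continuous_on_compose2[OF assms continuous_curve]) auto
  have "((\<lambda>\<epsilon>. arc_integral \<gamma> (\<lambda>y. if \<epsilon> \<le> norm (y - \<gamma> s\<^sub>0)
      then \<mu> y * (vector_curl (Ustar (\<gamma> s\<^sub>0)) y \<bullet> t y) else 0)) \<longlongrightarrow> dipole ?r (\<gamma> s\<^sub>0)) (at_right 0)"
  proof (rule tendsto_within_sequentially)
    fix \<epsilon> :: "nat \<Rightarrow> real" assume e: "\<And>n. \<epsilon> n \<in> {0<..}" "\<epsilon> \<longlonglongrightarrow> 0"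
    have "arc_integral \<gamma> (\<lambda>y. if \<epsilon> n \<le> norm (y - \<gamma> s\<^sub>0)
      then \<mu> y * (vector_curl (Ustar (\<gamma> s\<^sub>0)) y \<bullet> t y) else 0) = integral {0..1} (\<lambda>s.
      if \<epsilon> n \<le> norm (\<gamma> s - \<gamma> s\<^sub>0) then ?r s * (\<gamma> s\<^sub>0 \<bullet> cross3 (\<gamma> s) (\<gamma>' s)) / (1 - \<gamma> s\<^sub>0 \<bullet> \<gamma> s) else 0)" for n
      unfolding arc_integral_eq
    proof (rule integral_cong)
      fix s :: real assume s: "s \<in> {0..1}"
      show "(if \<epsilon> n \<le> norm (\<gamma> s - \<gamma> s\<^sub>0) then \<mu> (\<gamma> s) * (vector_curl (Ustar (\<gamma> s\<^sub>0)) (\<gamma> s) \<bullet> t (\<gamma> s)) else 0)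
          * norm (\<gamma>' s) = (if \<epsilon> n \<le> norm (\<gamma> s - \<gamma> s\<^sub>0)
          then ?r s * (\<gamma> s\<^sub>0 \<bullet> cross3 (\<gamma> s) (\<gamma>' s)) / (1 - \<gamma> s\<^sub>0 \<bullet> \<gamma> s) else 0)"
      proof (cases "\<epsilon> n \<le> norm (\<gamma> s - \<gamma> s\<^sub>0)")
        case True
        then have "\<gamma> s\<^sub>0 \<noteq> \<gamma> s" using e(1)[of n] by auto
        from double_layer_integrand[OF on_sphere s this] True show ?thesis by (simp only: if_True)
      next
        case False
        then show ?thesis by (simp only: if_False mult_zero_left)
      qed
    qed
    then show "(\<lambda>n. arc_integral \<gamma> (\<lambda>y. if \<epsilon> n \<le> norm (y - \<gamma> s\<^sub>0)
      then \<mu> y * (vector_curl (Ustar (\<gamma> s\<^sub>0)) y \<bullet> t y) else 0)) \<longlonglongrightarrow> dipole ?r (\<gamma> s\<^sub>0)"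
      using cutoff_dipole_lim(2)[OF r _ e(2), of s\<^sub>0] e(1) by simp
  qed
  then show ?thesis
    unfolding double_layer_boundary_def by (intro tendsto_Lim trivial_limit_at_right_real)
qed

end

end

theorem lemma4p1:
  fixes \<gamma> :: "real \<Rightarrow> real^3" and C S1 S2 :: "(real^3) set"
    and t :: "real^3 \<Rightarrow> real^3" and g :: "real^3 \<Rightarrow> real"
  assumes "C2_simple_closed_curve \<gamma>" and "C = path_image \<gamma>" and "C \<subseteq> sphere 0 1"
    and "components (sphere 0 1 - C) = {S1, S2}" and "S1 \<noteq> S2"
    and "unit_tangent_field \<gamma> t" and "lies_left_of S2 C t"
    and "smooth_on C g"
  shows
    "(\<forall>\<sigma>. continuous_on C \<sigma> \<and> (\<forall>x\<^sub>0\<in>C. single_layer \<gamma> \<sigma> x\<^sub>0 = g x\<^sub>0) \<and> arc_integral \<gamma> \<sigma> = 0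
        \<longrightarrow> solves_dirichlet S2 C g (single_layer \<gamma> \<sigma>))
     \<and>
     (\<forall>\<mu>. continuous_on C \<mu> \<and>
          (\<forall>x\<^sub>0\<in>C. 1 / 2 * \<mu> x\<^sub>0 + double_layer_boundary \<gamma> t \<mu> x\<^sub>0 = g x\<^sub>0)
        \<longrightarrow> solves_dirichlet S2 C g (double_layer \<gamma> t \<mu>) \<and>
            (\<forall>u. solves_dirichlet S2 C g u \<longrightarrow> (\<forall>x\<in>S2. u x = double_layer \<gamma> t \<mu> x)))"
proof -
  obtain \<gamma>'' where "sphere_curve \<gamma> (\<lambda>s. vector_derivative \<gamma> (at s)) \<gamma>''"
    using C2_simple_closed_curve_sphere_curve assms(1,2,3) by blast
  then interpret sphere_curve \<gamma> "\<lambda>s. vector_derivative \<gamma> (at s)" \<gamma>'' .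
  let ?\<gamma>' = "\<lambda>s. vector_derivative \<gamma> (at s)"
  have C: "C = range \<gamma>" using assms(2) range_curve by (simp add: path_image_def)
  have cC: "compact C" unfolding C range_curve by (intro compact_continuous_image continuous_curve) auto
  have S2: "S2 \<in> components (sphere 0 1 - C)" and S1: "S1 \<in> components (sphere 0 1 - C)"
    using assms(4) by auto
  have sub: "S2 \<subseteq> sphere 0 1 - C" and con: "connected S2"
    using in_components_subset[OF S2] in_components_connected[OF S2] by auto
  have oC: "openin (top_of_set (sphere 0 1)) (sphere 0 1 - C)"
    using compact_imp_closed[OF cC] by (simp add: Diff_eq openin_open_Int open_Compl)
  have "locally connected (sphere 0 1 - C)"
    by (rule locally_open_subset[OF locally_connected_sphere oC])
  then have op: "openin (top_of_set (sphere 0 1)) S2"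
    using openin_trans[OF openin_components_locally_connected[OF _ S2] oC] by blast
  have cl: "closure S2 \<subseteq> S2 \<union> C"
  proof -
    have "closure S2 \<subseteq> sphere 0 1" using sub by (intro closure_minimal) auto
    \<comment> \<open>A component is relatively closed in the complement of \<open>C\<close>, so the
      closure can add points of \<open>C\<close> only.\<close>
    moreover have "S2 = (sphere 0 1 - C) \<inter> closure S2"
    proof -
      obtain T where "closed T" "S2 = (sphere 0 1 - C) \<inter> T"
        using closedin_component[OF S2] by (auto simp: closedin_closed)
      then have "closure S2 \<subseteq> T" by (intro closure_minimal) auto
      then show ?thesis using \<open>S2 = (sphere 0 1 - C) \<inter> T\<close> closure_subset[of S2] by blast
    qed
    ultimately show ?thesis by blast
  qed
  \<comment> \<open>The pole of the barrier is placed in the other component, away from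
    \<open>S2\<close> and its boundary.\<close>
  obtain q where q: "q \<in> S1" using in_components_nonempty[OF S1] by blast
  have q': "q \<in> sphere 0 1" "q \<notin> S2" "q \<notin> C"
    using q in_components_subset[OF S1] components_nonoverlap[OF S1 S2] assms(5) by auto
  obtain \<kappa> where \<kappa>: "\<kappa>\<^sup>2 = 1" and t: "\<And>s. s \<in> {0..1} \<Longrightarrow> t (\<gamma> s) = (\<kappa> / norm (?\<gamma>' s)) *\<^sub>R ?\<gamma>' s"
    using unit_tangent_field_sign[OF assms(6)] by blast
  have S2_vis: "S2 \<subseteq> sphere 0 1 \<inter> visible \<gamma>" using sub visible_iff by (auto simp: C)
  have S2_range: "S2 \<subseteq> sphere 0 1 - range \<gamma>" using sub by (simp add: C)
  have C_obtain: "\<exists>s\<in>{0..1}. a = \<gamma> s" if "a \<in> C" for a using that C range_curve by auto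
  have cont: "continuous_on A (\<lambda>s. \<rho> (\<gamma> s))" if "continuous_on C \<rho>" for A and \<rho> :: "real^3 \<Rightarrow> real"
    by (rule continuous_on_compose2[OF that continuous_curve]) (auto simp: C)
  have single: "solves_dirichlet S2 C g (single_layer \<gamma> \<sigma>)"
    if \<sigma>: "continuous_on C \<sigma>" and eq: "\<And>a. a \<in> C \<Longrightarrow> single_layer \<gamma> \<sigma> a = g a"
      and zero: "arc_integral \<gamma> \<sigma> = 0" for \<sigma>
  proof -
    let ?r = "\<lambda>s. - 1 / (4 * pi) * (\<sigma> (\<gamma> s) * norm (?\<gamma>' s))"
    have r: "continuous_on A ?r" for A by (intro continuous_intros cont[OF \<sigma>] continuous_deriv)
    have rp: "?r (s + 1) = ?r s" for s by (simp only: periodic periodic_deriv)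
    show ?thesis
    proof (rule solves_dirichletI[OF open_visible[OF continuous_curve] S2_vis])
      show "Ck_on k (visible \<gamma>) (log_pot \<gamma> ?r)" for k by (rule Ck_on_log_pot[OF continuous_curve r])
      show "single_layer \<gamma> \<sigma> y = log_pot \<gamma> ?r y" if "y \<in> sphere 0 1 \<inter> visible \<gamma>" for y
        by (rule single_layer_eq) (use that in simp)
      show "sphere_laplacian G H x = 0" if "twice_diff_on (visible \<gamma>) (log_pot \<gamma> ?r) G H" "x \<in> visible \<gamma>" for G H x
      proof -
        have "sphere_laplacian G H x = - integral {0..1} ?r"
          by (rule sphere_laplacian_log_pot[OF continuous_curve r that(2) on_sphere that(1)])
        \<comment> \<open>The total charge of the logarithmic potential is a multiple of the mean of
          \<open>\<sigma>\<close>, which vanishes by assumption.\<close>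
        also have "integral {0..1} ?r = - 1 / (4 * pi) * arc_integral \<gamma> \<sigma>"
          unfolding arc_integral_eq by (rule integral_mult_right)
        finally show ?thesis using zero by simp
      qed
      show "(\<lambda>n. log_pot \<gamma> ?r (X n)) \<longlonglongrightarrow> g a" if a: "a \<in> C" and X: "\<And>n. X n \<in> S2" "X \<longlonglongrightarrow> a" for a X
      proof -
        obtain s\<^sub>0 where s0: "a = \<gamma> s\<^sub>0" using C_obtain[OF a] by blast
        have XS: "norm (X n) = 1" "X n \<notin> range \<gamma>" for n using X(1)[of n] S2_range by auto
        have "\<exists>s d c. curve_approach \<gamma> ?\<gamma>' \<gamma>'' s\<^sub>0 s d X c"
          by (rule nearest_approach[OF XS X(2)[unfolded s0]])
        then obtain s d c where "curve_approach \<gamma> ?\<gamma>' \<gamma>'' s\<^sub>0 s d X c" by blast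
        then interpret A: curve_approach \<gamma> ?\<gamma>' \<gamma>'' s\<^sub>0 s d X c .
        have "log_pot \<gamma> ?r (\<gamma> s\<^sub>0) = g a"
          using eq[OF a] single_layer_eq[OF on_sphere, of \<sigma> s\<^sub>0] s0 by simp
        then show ?thesis using A.log_pot_lim[of ?r, OF r rp] by simp
      qed
    qed
  qed
  have double: "solves_dirichlet S2 C g (double_layer \<gamma> t \<mu>)"
    if \<mu>: "continuous_on C \<mu>"
      and eq: "\<And>a. a \<in> C \<Longrightarrow> 1 / 2 * \<mu> a + double_layer_boundary \<gamma> t \<mu> a = g a" for \<mu>
  proof -
    let ?r = "\<lambda>s. \<kappa> / (4 * pi) * \<mu> (\<gamma> s)"
    have r: "continuous_on A ?r" for A by (intro continuous_intros cont[OF \<mu>])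
    have rp: "?r (s + 1) = ?r s" for s by (simp only: periodic)
    note a = continuous_dipole_density[OF r]
    show ?thesis
    proof (rule solves_dirichletI[OF open_visible[OF continuous_curve] S2_vis])
      show "Ck_on k (visible \<gamma>) (dipole ?r)" for k
        unfolding dipole_def by (rule Ck_on_pot[OF continuous_curve a continuous_on_const])
      show "double_layer \<gamma> t \<mu> y = dipole ?r y" if "y \<in> sphere 0 1 \<inter> visible \<gamma>" for y
        by (rule double_layer_eq[OF t]) (use that visible_iff in auto)
      show "sphere_laplacian G H x = 0" if "twice_diff_on (visible \<gamma>) (dipole ?r) G H" "x \<in> visible \<gamma>" for G H x
        by (rule sphere_laplacian_dipole[OF continuous_curve a that(2) on_sphere _ that(1)[unfolded dipole_def]])
           (simp add: dot_cross_self)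
      show "(\<lambda>n. dipole ?r (X n)) \<longlonglongrightarrow> g a" if a: "a \<in> C" and X: "\<And>n. X n \<in> S2" "X \<longlonglongrightarrow> a" for a X
      proof -
        obtain s\<^sub>0 where s0: "a = \<gamma> s\<^sub>0" "s\<^sub>0 \<in> {0..1}" using C_obtain[OF a] by blast
        have "\<forall>\<^sub>F \<epsilon> in at_right 0. cos \<epsilon> *\<^sub>R \<gamma> s\<^sub>0 + sin \<epsilon> *\<^sub>R
            ((\<kappa> / norm (?\<gamma>' s\<^sub>0)) *\<^sub>R cross3 (\<gamma> s\<^sub>0) (?\<gamma>' s\<^sub>0)) \<in> S2"
          using assms(7) a s0 t[OF s0(2)] unfolding lies_left_of_def by (auto simp: cross_mult_right)
        from dipole_jump[OF con S2_range \<kappa> this r rp X(1) X(2)[unfolded s0(1)]]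
        have "(\<lambda>n. dipole ?r (X n)) \<longlonglongrightarrow> dipole ?r (\<gamma> s\<^sub>0) + 2 * pi * \<kappa> * ?r s\<^sub>0" .
        \<comment> \<open>One factor \<open>\<kappa>\<close> comes from the side of approach, the
          other from the density; with \<open>\<kappa>\<^sup>2 = 1\<close> the jump does not depend
          on the direction of the parametrization.\<close>
        also have "2 * pi * \<kappa> * ?r s\<^sub>0 = 1 / 2 * \<mu> a"
          using \<kappa> s0 by (simp add: power2_eq_square)
        also have "dipole ?r (\<gamma> s\<^sub>0) = double_layer_boundary \<gamma> t \<mu> a"
          using double_layer_boundary_eq[OF t, of \<mu> s\<^sub>0] \<mu> s0 by (simp add: C)
        finally show ?thesis using eq[OF a] by (simp add: add.commute)
      qed
    qed
  qed
  have unique: "u x = v x" if "solves_dirichlet S2 C g u" "solves_dirichlet S2 C g v" "x \<in> S2" for u v x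
    by (rule antisym; rule solves_dirichlet_le[OF op cl _ cC assms(3) q'])
       (use that sub in auto)
  show ?thesis using single double unique by blast
qed

end
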